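(* Let $N\ge1$ and let $R'\subset R^+$ be a set of positive roots of $GL_N$ such that $$H_{R'}=\bigcap_{\alpha\in R'}H_\alpha\subset C_N,\qquad H_\alpha=\{\nu\in C_N\mid\langle\alpha,\nu\rangle=1\},$$ consists of a single point $\nu=(\nu_1,\dots,\nu_N)$. Then the irreducible $\mathbb{H}^{1/2}_{GL_N}$-module $L(\nu)$ is unitary.
   Context: $C_N=\{\nu\in\mathbb{R}^N\mid \nu_1>\dots>\nu_N,\ \nu_i+\nu_{N+1-i}=0 \text{ for all } i\}$; $R^+=\{e_i-e_j\mid 1\le i<j\le N\}$ with $\langle e_i-e_j,\nu\rangle=\nu_i-\nu_j$ (an intersection over the empty set is $C_N$). $W=S_N$ acts on $X=\mathbb{Z}^N$ (basis $e_i$) by permutations; $\mathbb{H}_N=\mathbb{H}^{1/2}_{GL_N}$ is the $\mathbb{C}$-algebra with underlying space $\mathrm{Sym}(X\otimes\mathbb{C})\otimes\mathbb{C}[W]$, both factors being subalgebras (basis of $\mathbb{C}[W]$: $t_w$), with relations $t_{s_\alpha}\theta-s_\alpha(\theta)t_{s_\alpha}=\langle\alpha^\vee,\theta\rangle$ for simple $\alpha=e_i-e_{i+1}$ with reflection $s_\alpha$ and coroot $\alpha^\vee$, and $\theta\in X$. For $\nu\in C_N$, $X(\nu)=\mathbb{H}_N\otimes_{\mathrm{Sym}(X\otimes\mathbb{C})}\mathbb{C}_\nu$, where $e_i$ acts on the line $\mathbb{C}_\nu$ by $\nu_i$; $L(\nu)$ is its unique irreducible quotient. $*$ is the conjugate-linear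 anti-involution of $\mathbb{H}_N$ with $t_w^*=t_{w^{-1}}$ and $\theta^*=(-1)^{\deg\theta}t_{w_0}\,{}^{w_0}\bar\theta\,t_{w_0}$ for homogeneous $\theta\in\mathrm{Sym}(X\otimes\mathbb{C})$, $w_0$ the longest element of $W$. A finite-dimensional module $V$ is unitary if it carries a positive definite Hermitian form with $\langle hx,y\rangle=\langle x,h^*y\rangle$ for all $h\in\mathbb{H}_N$, $x,y\in V$. *)

theory Defs
  imports
    Complex_Main
    "HOL-Algebra.Algebra"
    "HOL-Library.Poly_Mapping"
    "HOL-Combinatorics.Permutations"
begin

section \<open>Left modules over a ring that need not be commutative\<close>

text \<open>The locale \<^locale>\<open>module\<close> insists on a commutative ring of scalars; the axioms below
  are otherwise the same, and so is the record type. Its fields \<open>mult\<close> and \<open>one\<close> play no role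
  for modules. The library locale \<^locale>\<open>submodule\<close> does not need commutativity.\<close>

locale left_module = R?: ring R + M?: abelian_group M
  for R :: "('r, 'm) ring_scheme" (structure) and M :: "('r, 'v, 'n) module_scheme" (structure) +
  assumes smult_closed:
      "\<lbrakk>a \<in> carrier R; x \<in> carrier M\<rbrakk> \<Longrightarrow> a \<odot>\<^bsub>M\<^esub> x \<in> carrier M"
    and smult_l_distr:
      "\<lbrakk>a \<in> carrier R; b \<in> carrier R; x \<in> carrier M\<rbrakk> \<Longrightarrow>
        (a \<oplus>\<^bsub>R\<^esub> b) \<odot>\<^bsub>M\<^esub> x = a \<odot>\<^bsub>M\<^esub> x \<oplus>\<^bsub>M\<^esub> b \<odot>\<^bsub>M\<^esub> x"
    and smult_r_distr:
      "\<lbrakk>a \<in> carrier R; x \<in> carrier M; y \<in> carrier M\<rbrakk> \<Longrightarrow>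
        a \<odot>\<^bsub>M\<^esub> (x \<oplus>\<^bsub>M\<^esub> y) = a \<odot>\<^bsub>M\<^esub> x \<oplus>\<^bsub>M\<^esub> a \<odot>\<^bsub>M\<^esub> y"
    and smult_assoc1:
      "\<lbrakk>a \<in> carrier R; b \<in> carrier R; x \<in> carrier M\<rbrakk> \<Longrightarrow>
        (a \<otimes>\<^bsub>R\<^esub> b) \<odot>\<^bsub>M\<^esub> x = a \<odot>\<^bsub>M\<^esub> (b \<odot>\<^bsub>M\<^esub> x)"
    and smult_one: "x \<in> carrier M \<Longrightarrow> \<one>\<^bsub>R\<^esub> \<odot>\<^bsub>M\<^esub> x = x"

definition irreducible_module :: "'r ring \<Rightarrow> ('r, 'v) module \<Rightarrow> bool" where
  "irreducible_module R M \<longleftrightarrow>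
     left_module R M \<and> carrier M \<noteq> {\<zero>\<^bsub>M\<^esub>} \<and>
     (\<forall>K. submodule K R M \<longrightarrow> K = {\<zero>\<^bsub>M\<^esub>} \<or> K = carrier M)"

definition quot_module :: "('r, 'v) module \<Rightarrow> 'v set \<Rightarrow> ('r, 'v set) module" where
  "quot_module M K =
     \<lparr>carrier = a_rcosets\<^bsub>M\<^esub> K, monoid.mult = undefined, one = undefined,
      ring.zero = K, ring.add = set_add M,
      smult = (\<lambda>r C. \<Union>x\<in>C. K +>\<^bsub>M\<^esub> (r \<odot>\<^bsub>M\<^esub> x))\<rparr>"

definition unique_irreducible_quotient ::
    "'r ring \<Rightarrow> ('r, 'v) module \<Rightarrow> ('r, 'v set) module" where
  "unique_irreducible_quotient R M =
     quot_module M (THE K. submodule K R M \<and> irreducible_module R (quot_module M K))"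

text \<open>The tensor product of \<open>R\<close> and \<open>V\<close> over \<open>A\<close>, where \<open>R\<close> is a right \<open>A\<close>-module through
  \<open>\<iota> : A \<rightarrow> R\<close>: the free abelian group on pairs modulo the usual relations.\<close>

definition tensor_free :: "'r ring \<Rightarrow> ('a, 'v) module \<Rightarrow> ('r, ('r \<times> 'v) \<Rightarrow>\<^sub>0 int) module" where
  "tensor_free R V =
     \<lparr>carrier = carrier (free_Abelian_group (carrier R \<times> carrier V)),
      monoid.mult = undefined, one = undefined, ring.zero = 0, ring.add = (+),
      smult = (\<lambda>r. frag_extend (\<lambda>(h, v). frag_of (r \<otimes>\<^bsub>R\<^esub> h, v)))\<rparr>"

definition tensor_rels ::
    "'a ring \<Rightarrow> 'r ring \<Rightarrow> ('a \<Rightarrow> 'r) \<Rightarrow> ('a, 'v) module \<Rightarrow> (('r \<times> 'v) \<Rightarrow>\<^sub>0 int) set" where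
  "tensor_rels A R \<iota> V =
     generate (free_Abelian_group (carrier R \<times> carrier V))
       ({frag_of (h \<oplus>\<^bsub>R\<^esub> k, v) - frag_of (h, v) - frag_of (k, v) | h k v.
           h \<in> carrier R \<and> k \<in> carrier R \<and> v \<in> carrier V} \<union>
        {frag_of (h, v \<oplus>\<^bsub>V\<^esub> w) - frag_of (h, v) - frag_of (h, w) | h v w.
           h \<in> carrier R \<and> v \<in> carrier V \<and> w \<in> carrier V} \<union>
        {frag_of (h \<otimes>\<^bsub>R\<^esub> \<iota> a, v) - frag_of (h, a \<odot>\<^bsub>V\<^esub> v) | h a v.
           h \<in> carrier R \<and> a \<in> carrier A \<and> v \<in> carrier V})"

definition tensor_module ::
    "'a ring \<Rightarrow> 'r ring \<Rightarrow> ('a \<Rightarrow> 'r) \<Rightarrow> ('a, 'v) module \<Rightarrow> ('r, (('r \<times> 'v) \<Rightarrow>\<^sub>0 int) set) module" where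
  "tensor_module A R \<iota> V = quot_module (tensor_free R V) (tensor_rels A R \<iota> V)"


section \<open>The underlying space of the graded Hecke algebra\<close>

text \<open>Polynomials in variables indexed by \<open>nat\<close>; \<open>Sym(X \<otimes> \<complex>)\<close> for \<open>X = \<int>\<^sup>N\<close> consists of those in
  the variables \<open>e\<^sub>1, \<dots>, e\<^sub>N\<close>.\<close>

type_synonym sympoly = "(nat \<Rightarrow>\<^sub>0 nat) \<Rightarrow>\<^sub>0 complex"

definition Sym_carrier :: "nat \<Rightarrow> sympoly set" where
  "Sym_carrier N = {p. \<forall>\<mu>\<in>Poly_Mapping.keys p. Poly_Mapping.keys \<mu> \<subseteq> {1..N}}"

definition Sym_ring :: "nat \<Rightarrow> sympoly ring" where
  "Sym_ring N = \<lparr>carrier = Sym_carrier N, monoid.mult = (*), one = 1, ring.zero = 0, ring.add = (+)\<rparr>"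

definition sym_const :: "complex \<Rightarrow> sympoly" where
  "sym_const c = Poly_Mapping.single 0 c"

definition lin :: "nat \<Rightarrow> (nat \<Rightarrow> int) \<Rightarrow> sympoly" where
  "lin N \<theta> = (\<Sum>i\<in>{1..N}. Poly_Mapping.single (Poly_Mapping.single i 1) (of_int (\<theta> i)))"

definition sym_eval :: "(nat \<Rightarrow> real) \<Rightarrow> sympoly \<Rightarrow> complex" where
  "sym_eval \<nu> p = (\<Sum>\<mu>\<in>Poly_Mapping.keys p. Poly_Mapping.lookup p \<mu> *
     (\<Prod>i\<in>Poly_Mapping.keys \<mu>. complex_of_real (\<nu> i) ^ Poly_Mapping.lookup \<mu> i))"

definition sym_homogeneous :: "nat \<Rightarrow> sympoly \<Rightarrow> bool" where
  "sym_homogeneous d p \<longleftrightarrow>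
     (\<forall>\<mu>\<in>Poly_Mapping.keys p. (\<Sum>i\<in>Poly_Mapping.keys \<mu>. Poly_Mapping.lookup \<mu> i) = d)"

definition sym_cnj :: "sympoly \<Rightarrow> sympoly" where
  "sym_cnj = Poly_Mapping.map cnj"

text \<open>The action \<open>e\<^sub>i \<mapsto> e\<^bsub>w(i)\<^esub>\<close>: since \<^const>\<open>Poly_Mapping.map_key\<close> is precomposition, the
  coefficient of \<open>\<mu>\<close> in \<open>w p\<close> is that of \<open>\<mu> \<circ> w\<close> in \<open>p\<close>.\<close>

definition sym_act :: "(nat \<Rightarrow> nat) \<Rightarrow> sympoly \<Rightarrow> sympoly" where
  "sym_act w p = Poly_Mapping.map_key (Poly_Mapping.map_key w) p"

definition longest :: "nat \<Rightarrow> nat \<Rightarrow> nat" where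
  "longest N i = (if i \<in> {1..N} then N + 1 - i else i)"

text \<open>\<open>Sym(X \<otimes> \<complex>) \<otimes> \<complex>[W]\<close>: an element \<open>\<Sum>\<^sub>w \<theta>\<^sub>w \<otimes> t\<^sub>w\<close> is the family of its coefficients \<open>\<theta>\<^sub>w\<close>.\<close>

type_synonym hecke = "(nat \<Rightarrow> nat) \<Rightarrow>\<^sub>0 sympoly"

definition hecke_carrier :: "nat \<Rightarrow> hecke set" where
  "hecke_carrier N = {h. (\<forall>w\<in>Poly_Mapping.keys h. w permutes {1..N}) \<and>
                         (\<forall>w. Poly_Mapping.lookup h w \<in> Sym_carrier N)}"

definition tens :: "sympoly \<Rightarrow> (nat \<Rightarrow> nat) \<Rightarrow> hecke" where
  "tens p w = Poly_Mapping.single w p"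

definition emb :: "sympoly \<Rightarrow> hecke" where
  "emb p = tens p id"

definition tt :: "(nat \<Rightarrow> nat) \<Rightarrow> hecke" where
  "tt w = tens 1 w"

definition hscale :: "complex \<Rightarrow> hecke \<Rightarrow> hecke" where
  "hscale c h = Poly_Mapping.map (\<lambda>p. sym_const c * p) h"

definition hecke_ring :: "nat \<Rightarrow> (hecke \<Rightarrow> hecke \<Rightarrow> hecke) \<Rightarrow> hecke ring" where
  "hecke_ring N mul =
     \<lparr>carrier = hecke_carrier N, monoid.mult = mul, one = tt id, ring.zero = 0, ring.add = (+)\<rparr>"


section \<open>The graded Hecke algebra and its anti-involution\<close>

text \<open>The product is characterised by its defining properties, which determine it on
  \<open>hecke_carrier N\<close>.\<close>

locale graded_hecke_GL =
  fixes N :: nat and mul :: "hecke \<Rightarrow> hecke \<Rightarrow> hecke"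
  assumes is_ring: "ring (hecke_ring N mul)"
    and scale_left: "\<lbrakk>h \<in> hecke_carrier N; k \<in> hecke_carrier N\<rbrakk> \<Longrightarrow>
          mul (hscale c h) k = hscale c (mul h k)"
    and scale_right: "\<lbrakk>h \<in> hecke_carrier N; k \<in> hecke_carrier N\<rbrakk> \<Longrightarrow>
          mul h (hscale c k) = hscale c (mul h k)"
    and Sym_subalgebra: "\<lbrakk>p \<in> Sym_carrier N; q \<in> Sym_carrier N\<rbrakk> \<Longrightarrow>
          mul (emb p) (emb q) = emb (p * q)"
    and group_subalgebra: "\<lbrakk>u permutes {1..N}; w permutes {1..N}\<rbrakk> \<Longrightarrow>
          mul (tt u) (tt w) = tt (u \<circ> w)"
    and mul_emb_tt: "\<lbrakk>p \<in> Sym_carrier N; w permutes {1..N}\<rbrakk> \<Longrightarrow>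
          mul (emb p) (tt w) = tens p w"
    and cross_relation: "\<lbrakk>1 \<le> i; i < N\<rbrakk> \<Longrightarrow>
          mul (tt (Transposition.transpose i (i + 1))) (emb (lin N \<theta>))
          - mul (emb (sym_act (Transposition.transpose i (i + 1)) (lin N \<theta>)))
                (tt (Transposition.transpose i (i + 1)))
          = hscale (of_int (\<theta> i - \<theta> (i + 1))) (tt id)"

locale graded_hecke_GL_star = graded_hecke_GL +
  fixes star :: "hecke \<Rightarrow> hecke"
  assumes star_closed: "h \<in> hecke_carrier N \<Longrightarrow> star h \<in> hecke_carrier N"
    and star_add: "\<lbrakk>h \<in> hecke_carrier N; k \<in> hecke_carrier N\<rbrakk> \<Longrightarrow> star (h + k) = star h + star k"
    and star_scale: "h \<in> hecke_carrier N \<Longrightarrow> star (hscale c h) = hscale (cnj c) (star h)"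
    and star_mul: "\<lbrakk>h \<in> hecke_carrier N; k \<in> hecke_carrier N\<rbrakk> \<Longrightarrow>
          star (mul h k) = mul (star k) (star h)"
    and star_star: "h \<in> hecke_carrier N \<Longrightarrow> star (star h) = h"
    and star_tt: "w permutes {1..N} \<Longrightarrow> star (tt w) = tt (inv_into UNIV w)"
    and star_emb: "\<lbrakk>p \<in> Sym_carrier N; sym_homogeneous d p\<rbrakk> \<Longrightarrow>
          star (emb p) =
            hscale ((-1) ^ d)
              (mul (mul (tt (longest N)) (emb (sym_act (longest N) (sym_cnj p)))) (tt (longest N)))"


section \<open>The modules\<close>

definition C_module :: "(nat \<Rightarrow> real) \<Rightarrow> (sympoly, complex) module" where
  "C_module \<nu> =
     \<lparr>carrier = UNIV, monoid.mult = undefined, one = undefined, ring.zero = 0, ring.add = (+),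
      smult = (\<lambda>p z. sym_eval \<nu> p * z)\<rparr>"

definition X_module ::
    "nat \<Rightarrow> (hecke \<Rightarrow> hecke \<Rightarrow> hecke) \<Rightarrow> (nat \<Rightarrow> real) \<Rightarrow>
     (hecke, ((hecke \<times> complex) \<Rightarrow>\<^sub>0 int) set) module" where
  "X_module N mul \<nu> = tensor_module (Sym_ring N) (hecke_ring N mul) emb (C_module \<nu>)"

definition L_module ::
    "nat \<Rightarrow> (hecke \<Rightarrow> hecke \<Rightarrow> hecke) \<Rightarrow> (nat \<Rightarrow> real) \<Rightarrow>
     (hecke, ((hecke \<times> complex) \<Rightarrow>\<^sub>0 int) set set) module" where
  "L_module N mul \<nu> = unique_irreducible_quotient (hecke_ring N mul) (X_module N mul \<nu>)"

text \<open>Complex scalars act on a Hecke module through \<open>\<complex> \<subset> Sym(X \<otimes> \<complex>)\<close>.\<close>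

definition cscale :: "(hecke, 'v) module \<Rightarrow> complex \<Rightarrow> 'v \<Rightarrow> 'v" where
  "cscale M c x = emb (sym_const c) \<odot>\<^bsub>M\<^esub> x"

definition fin_dim_module :: "(hecke, 'v) module \<Rightarrow> bool" where
  "fin_dim_module M \<longleftrightarrow>
     (\<exists>B. finite B \<and> B \<subseteq> carrier M \<and>
       (\<forall>x\<in>carrier M. \<exists>c :: 'v \<Rightarrow> complex. x = (\<Oplus>\<^bsub>M\<^esub>b\<in>B. cscale M (c b) b)))"

definition pos_def_hermitian_form :: "(hecke, 'v) module \<Rightarrow> ('v \<Rightarrow> 'v \<Rightarrow> complex) \<Rightarrow> bool" where
  "pos_def_hermitian_form M B \<longleftrightarrow>
     (\<forall>x\<in>carrier M. \<forall>y\<in>carrier M. \<forall>z\<in>carrier M. B (x \<oplus>\<^bsub>M\<^esub> y) z = B x z + B y z) \<and>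
     (\<forall>c. \<forall>x\<in>carrier M. \<forall>y\<in>carrier M. B (cscale M c x) y = c * B x y) \<and>
     (\<forall>x\<in>carrier M. \<forall>y\<in>carrier M. B y x = cnj (B x y)) \<and>
     (\<forall>x\<in>carrier M. x \<noteq> \<zero>\<^bsub>M\<^esub> \<longrightarrow> 0 < Re (B x x))"

definition unitary_module ::
    "nat \<Rightarrow> (hecke \<Rightarrow> hecke \<Rightarrow> hecke) \<Rightarrow> (hecke \<Rightarrow> hecke) \<Rightarrow> (hecke, 'v) module \<Rightarrow> bool" where
  "unitary_module N mul star M \<longleftrightarrow>
     left_module (hecke_ring N mul) M \<and> fin_dim_module M \<and>
     (\<exists>B. pos_def_hermitian_form M B \<and>
       (\<forall>h\<in>hecke_carrier N. \<forall>x\<in>carrier M. \<forall>y\<in>carrier M.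
          B (h \<odot>\<^bsub>M\<^esub> x) y = B x (star h \<odot>\<^bsub>M\<^esub> y)))"


section \<open>The chamber, the roots and the hyperplanes\<close>

text \<open>Vectors in \<open>\<real>\<^sup>N\<close> are extensional functions on \<open>{1..N}\<close>.\<close>

definition C_chamber :: "nat \<Rightarrow> (nat \<Rightarrow> real) set" where
  "C_chamber N = {\<nu> \<in> {1..N} \<rightarrow>\<^sub>E UNIV.
     (\<forall>i j. 1 \<le> i \<and> i < j \<and> j \<le> N \<longrightarrow> \<nu> i > \<nu> j) \<and> (\<forall>i\<in>{1..N}. \<nu> i + \<nu> (N + 1 - i) = 0)}"

text \<open>The root \<open>e\<^sub>i - e\<^sub>j\<close> is represented by the pair \<open>(i, j)\<close>.\<close>

definition pos_roots :: "nat \<Rightarrow> (nat \<times> nat) set" where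
  "pos_roots N = {(i, j). 1 \<le> i \<and> i < j \<and> j \<le> N}"

definition root_pairing :: "nat \<times> nat \<Rightarrow> (nat \<Rightarrow> real) \<Rightarrow> real" where
  "root_pairing \<alpha> \<nu> = \<nu> (fst \<alpha>) - \<nu> (snd \<alpha>)"

definition H_plane :: "nat \<Rightarrow> nat \<times> nat \<Rightarrow> (nat \<Rightarrow> real) set" where
  "H_plane N \<alpha> = {\<nu> \<in> C_chamber N. root_pairing \<alpha> \<nu> = 1}"

definition H_inter :: "nat \<Rightarrow> (nat \<times> nat) set \<Rightarrow> (nat \<Rightarrow> real) set" where
  "H_inter N R' = C_chamber N \<inter> (\<Inter>\<alpha>\<in>R'. H_plane N \<alpha>)"

end

(* A root alpha in R' forces nu_i - nu_j = 1, and moving nu towards the vector c with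
   c_i = (#{j > i : nu_j - nu_i integral} - #{j < i : nu_j - nu_i integral}) / 2 preserves all these
   equations. An isolated point therefore equals c: it is a union of at most two centred unit-step
   strings, one in Z and one in 1/2 + Z.

   The algebra acts on the tensor power of C^2, realised as functions of subsets of {1..N}: S_N permutes
   the factors and e_i acts by the sum of r_ij (j > i) minus the sum of r_ji (j < i), where r solves the
   classical Yang-Baxter equation. The l2 inner product is invariant because r_ij is adjoint to r_ji.
   Intertwiners move an eigenvector of the concatenated strings to a vector u of weight nu, which gives a
   homomorphism X(nu) -> H u.

   A polynomial in the e_i that kills the weights w nu, w <> 1, reduces every element of X(nu) to the line
   through its generator. As w_0 nu = -nu, the adjoint of such a polynomial has t_{w_0} u as an eigenvector,
   so a proper submodule is mapped into the orthogonal complement of H t_{w_0} u = H u, that is, to zero.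
   Hence the kernel is the largest proper submodule and L(nu) = H u carries the l2 inner product. *)

theory Submission
  imports Defs
begin

section \<open>The model on functions of subsets\<close>

text \<open>The matrix \<open>r\<close> has to meet three demands at once. The classical Yang-Baxter
  equation makes the operators of the \<open>e_i\<close> commute; \<open>r_ij + r_ji\<close>, the
  flip of two factors, produces the constant in the cross relation; and being real with transpose
  \<open>r_ji\<close> gives invariance of the form, where \<open>w_0\<close> undoes the reversal of
  the order of the factors. Two dimensions per factor suffice because there are at most two strings:
  whether an index lies in the subset records its string. If both strings occur, entries of
  different strings differ by half of an odd number, so the intertwiners that shuffle the strings
  never meet the forbidden differences 0, 1, -1; the condition \<open>A = {} \<or> odd N\<close>
  secures this. The comparison with X(\<nu>) uses no weight decomposition of submodules, only that
  the \<open>t_w\<close> span modulo the annihilator of the generator and that each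
  \<open>e_i\<close> acts triangularly for word length. That the entries of \<nu> are distinct also
  keeps the adjoint polynomials from annihilating \<open>t_{w_0} u\<close>.\<close>

definition perm_op :: "(nat \<Rightarrow> nat) \<Rightarrow> (nat set \<Rightarrow> complex) \<Rightarrow> nat set \<Rightarrow> complex" where
  "perm_op w f = (\<lambda>B. f (w -` B))"

text \<open>A subset marks the tensor factors that carry the first basis vector. On factors
  \<open>i\<close>, \<open>j\<close> this is the standard gl_2 solution
  \<open>1/2 (E_11 x E_11 + E_22 x E_22) + E_12 x E_21\<close>. Applied to the indicator function of
  one subset it can only move membership from \<open>j\<close> to \<open>i\<close>, never
  back.\<close>

definition rmat :: "nat \<Rightarrow> nat \<Rightarrow> (nat set \<Rightarrow> complex) \<Rightarrow> nat set \<Rightarrow> complex" where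
  "rmat i j f B =
     (if (i \<in> B) = (j \<in> B) then f B / 2 else if i \<in> B then f (insert j (B - {i})) else 0)"

text \<open>Antisymmetry in \<open>i\<close> and \<open>j\<close> lets the operator of
  \<open>e_i\<close> be a single sum over all \<open>j\<close>, with no split at
  \<open>i\<close>.\<close>

definition rho :: "nat \<Rightarrow> nat \<Rightarrow> (nat set \<Rightarrow> complex) \<Rightarrow> nat set \<Rightarrow> complex" where
  "rho i j f B = (if i < j then rmat i j f B else if j < i then - rmat j i f B else 0)"

definition theta_op :: "nat \<Rightarrow> nat \<Rightarrow> (nat set \<Rightarrow> complex) \<Rightarrow> nat set \<Rightarrow> complex" where
  "theta_op N i f = (\<lambda>B. \<Sum>j\<in>{1..N}. rho i j f B)"

lemma perm_op_comp: "perm_op u (perm_op w f) = perm_op (u \<circ> w) f"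
  by (simp add: perm_op_def vimage_comp)

lemma perm_op_id [simp]: "perm_op id f = f"
  by (simp add: perm_op_def)

lemma rho_self [simp]: "rho i i f B = 0"
  by (simp add: rho_def)

lemma rho_swap: "rho j i f B = - rho i j f B"
  by (simp add: rho_def)

lemma rho_add: "rho i j (\<lambda>B. f B + g B) B = rho i j f B + rho i j g B"
  by (simp add: rho_def rmat_def add_divide_distrib)

lemma rho_scale: "rho i j (\<lambda>B. c * f B) B = c * rho i j f B"
  by (simp add: rho_def rmat_def)

lemma rho_minus: "rho i j (\<lambda>B. - f B) B = - rho i j f B"
  by (simp add: rho_def rmat_def)

lemma rho_sum: "finite S \<Longrightarrow> rho i j (\<lambda>B. \<Sum>a\<in>S. g a B) B = (\<Sum>a\<in>S. rho i j (g a) B)"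
proof (induction S rule: finite_induct)
  case empty
  show ?case by (simp add: rho_def rmat_def)
next
  case (insert a S)
  then show ?case using rho_add[of i j "g a" "\<lambda>B. \<Sum>a\<in>S. g a B" B] by simp
qed

section \<open>The Yang-Baxter equation and commuting operators\<close>

lemma classical_Yang_Baxter:
  assumes "i \<noteq> j" "i \<noteq> k" "j \<noteq> k"
  shows "rmat i j (rmat i k f) B - rmat i k (rmat i j f) B
       + (rmat i j (rmat j k f) B - rmat j k (rmat i j f) B)
       + (rmat i k (rmat j k f) B - rmat j k (rmat i k f) B) = 0"
proof -
  have h1: "insert a (insert b (B - {a}) - {c}) = insert b (B - {c})"
    if "a \<in> B" "a \<noteq> c" "b \<noteq> c" for a b c using that by auto
  have h2: "insert b (B - {a}) - {b} = B - {a}" if "b \<notin> B" for a b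
    using that by auto
  \<comment> \<open>Only the membership of the three indices in \<open>B\<close> matters, which
    leaves eight finite checks; \<open>h1\<close> and \<open>h2\<close> normalise the sets reached
    by two successive moves.\<close>
  show ?thesis
    using assms by (cases "i \<in> B"; cases "j \<in> B"; cases "k \<in> B")
      (simp_all add: rmat_def h1 h2 del: insert_Diff1)
qed

lemma rmat_disjoint:
  assumes "distinct [i, j, k, l]"
  shows "rmat i j (rmat k l f) B = rmat k l (rmat i j f) B"
  using assms by (auto simp: rmat_def insert_Diff_if insert_commute intro!: arg_cong[where f = f])

lemma rho_disjoint:
  assumes "i \<noteq> k" "i \<noteq> l" "j \<noteq> k" "j \<noteq> l"
  shows "rho i j (rho k l f) B = rho k l (rho i j f) B"
proof (cases "i = j \<or> k = l")
  case True
  then show ?thesis by (auto simp: rho_def rmat_def)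
next
  case False
  have minus: "rmat a b (\<lambda>B. - f B) B = - rmat a b f B" for a b f B
    by (simp add: rmat_def)
  have e: "rho i j f = (if i < j then rmat i j f else if j < i then (\<lambda>B. - rmat j i f B) else (\<lambda>B. 0))" for i j f
    by (auto simp: rho_def)
  show ?thesis using assms False
    by (auto simp: e minus rmat_disjoint)
qed

text \<open>The signs in \<open>rho\<close> absorb the order of the indices: each of the six
  orderings reduces to the instance of the classical equation with sorted indices.\<close>

lemma rho_Yang_Baxter:
  assumes "i \<noteq> k" "l \<noteq> i" "l \<noteq> k"
  shows "(rho i k (rho k l f) B - rho k l (rho i k f) B)
       + (rho i l (rho k i f) B - rho k i (rho i l f) B)
       + (rho i l (rho k l f) B - rho k l (rho i l f) B) = 0"
proof -
  have minus: "rmat a b (\<lambda>B. - f B) B = - rmat a b f B" for a b f B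
    by (simp add: rmat_def)
  have e: "rho i j f = (if i < j then rmat i j f else if j < i then (\<lambda>B. - rmat j i f B) else (\<lambda>B. 0))" for i j f
    by (auto simp: rho_def)
  \<comment> \<open>Solved for one product and restricted to sorted indices, the equation becomes a
    terminating rewrite rule that serves all six orderings.\<close>
  have YB: "rmat i k (rmat j k f) B = - (rmat i j (rmat i k f) B - rmat i k (rmat i j f) B
       + (rmat i j (rmat j k f) B - rmat j k (rmat i j f) B)) + rmat j k (rmat i k f) B"
    if "i < j" "j < k" for i j k
    using classical_Yang_Baxter[of i j k f B] that by (simp add: algebra_simps add_eq_0_iff)
  consider "i < k" "k < l" | "i < l" "l < k" | "k < i" "i < l" | "k < l" "l < i" | "l < i" "i < k" | "l < k" "k < i"
    using assms by linarith
  then show ?thesis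
  proof cases
    case 1 then show ?thesis by (simp add: e minus YB)
  next
    case 2 then show ?thesis by (simp add: e minus YB)
  next
    case 3 then show ?thesis by (simp add: e minus YB)
  next
    case 4 then show ?thesis by (simp add: e minus YB)
  next
    case 5 then show ?thesis by (simp add: e minus YB)
  next
    case 6 then show ?thesis by (simp add: e minus YB)
  qed
qed

text \<open>In the double sum of commutators only pairs that share an index survive; for each third
  index \<open>l\<close> the three survivors form one Yang-Baxter expression.\<close>

lemma theta_op_commute:
  assumes "i \<in> {1..N}" "k \<in> {1..N}"
  shows "theta_op N i (theta_op N k f) = theta_op N k (theta_op N i f)"
proof (cases "i = k")
  case False
  show ?thesis
  proof
    fix B
    define c where "c j l = rho i j (rho k l f) B - rho k l (rho i j f) B" for j l
    have ki: "c k i = 0"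
    proof -
      have "rho k i f = (\<lambda>B. - rho i k f B)" by (auto simp: rho_swap[of k i])
      then show ?thesis by (simp add: c_def rho_swap[of k i] rho_minus)
    qed
    have z: "c i l = 0" "c l k = 0" for l
      by (auto simp: c_def rho_def rmat_def)
    \<comment> \<open>If two of the three conditions hold together, the commutator is zero, so
      adding the three cases counts nothing twice.\<close>
    have split: "c j l = (if j = k then c k l else 0) + (if l = i then c j i else 0)
        + (if l = j then c j j else 0)" for j l
      using ki z rho_disjoint[of i k l j] False by (auto simp: c_def)
    have "theta_op N i (theta_op N k f) B - theta_op N k (theta_op N i f) B
        = (\<Sum>j\<in>{1..N}. \<Sum>l\<in>{1..N}. rho i j (rho k l f) B)
          - (\<Sum>l\<in>{1..N}. \<Sum>j\<in>{1..N}. rho k l (rho i j f) B)"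
      by (simp add: theta_op_def rho_sum)
    also have "\<dots> = (\<Sum>j\<in>{1..N}. \<Sum>l\<in>{1..N}. c j l)"
      by (subst (2) sum.swap) (simp add: c_def sum_subtractf)
    also have "\<dots> = (\<Sum>j\<in>{1..N}. \<Sum>l\<in>{1..N}. if j = k then c k l else 0)
       + (\<Sum>j\<in>{1..N}. \<Sum>l\<in>{1..N}. if l = i then c j i else 0)
       + (\<Sum>j\<in>{1..N}. \<Sum>l\<in>{1..N}. if l = j then c j j else 0)"
      by (subst split) (simp only: sum.distrib)
    also have "(\<Sum>j\<in>{1..N}. \<Sum>l\<in>{1..N}. if j = k then c k l else 0) = (\<Sum>l\<in>{1..N}. c k l)"
      using assms by (subst sum.swap) simp
    also have "(\<Sum>l\<in>{1..N}. c k l) + (\<Sum>j\<in>{1..N}. \<Sum>l\<in>{1..N}. if l = i then c j i else 0)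
       + (\<Sum>j\<in>{1..N}. \<Sum>l\<in>{1..N}. if l = j then c j j else 0)
       = (\<Sum>l\<in>{1..N}. c k l + c l i + c l l)"
      using assms by (simp add: sum.distrib)
    also have "\<dots> = 0"
    proof (intro sum.neutral ballI)
      fix l
      show "c k l + c l i + c l l = 0"
        using z ki rho_Yang_Baxter[OF False, of l f B]
        by (cases "l = i \<or> l = k") (auto simp: c_def)
    qed
    finally show "theta_op N i (theta_op N k f) B = theta_op N k (theta_op N i f) B" by simp
  qed
qed simp

section \<open>Adjacent transpositions and the cross relation\<close>

lemma rmat_add_rmat_swap:
  assumes "i \<noteq> j"
  shows "rmat i j f B + rmat j i f B = perm_op (transpose i j) f B"
proof -
  have "transpose i j -` B = (if (i \<in> B) = (j \<in> B) then B
      else if i \<in> B then insert j (B - {i}) else insert i (B - {j}))"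
    using assms by (auto simp: transpose_def split: if_splits)
  then show ?thesis by (auto simp: perm_op_def rmat_def)
qed

lemma perm_op_rmat:
  assumes "bij w"
  shows "perm_op w (rmat i j f) = rmat (w i) (w j) (perm_op w f)"
proof
  fix B
  have "w -` insert (w j) (B - {w i}) = insert j (w -` B - {i})"
    using bij_is_inj[OF assms] by (auto simp: inj_def)
  then show "perm_op w (rmat i j f) B = rmat (w i) (w j) (perm_op w f) B"
    by (simp add: perm_op_def rmat_def)
qed

text \<open>An adjacent transposition preserves the order of every pair except \<open>k\<close>,
  \<open>k + 1\<close>. For that pair the order flips, and replacing \<open>r_ij\<close> by the flip
  minus \<open>r_ji\<close> leaves the extra multiple of \<open>f\<close>.\<close>

lemma perm_op_rho:
  fixes k :: nat
  defines "s \<equiv> transpose k (k + 1)"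
  shows "perm_op s (rho i j f) B = rho (s i) (s j) (perm_op s f) B
     + (if i = k \<and> j = k + 1 then f B else if i = k + 1 \<and> j = k then - f B else 0)"
proof -
  have bij: "bij s" by (simp add: s_def)
  have R: "rmat i j f (s -` B) = rmat (s i) (s j) (perm_op s f) B" for i j
    using perm_op_rmat[OF bij, of i j f] by (simp add: perm_op_def fun_eq_iff)
  have P: "perm_op s (rho i j f) B =
      (if i < j then rmat (s i) (s j) (perm_op s f) B
       else if j < i then - rmat (s j) (s i) (perm_op s f) B else 0)"
    by (simp add: perm_op_def rho_def R)
  have ss: "perm_op s (perm_op s f) B = f B"
    by (simp add: perm_op_comp s_def)
  have sw: "rmat (Suc k) k (perm_op s f) B = f B - rmat k (Suc k) (perm_op s f) B"
    using rmat_add_rmat_swap[of k "Suc k" "perm_op s f" B] ss by (simp add: s_def algebra_simps)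
  have sk: "s k = Suc k" "s (Suc k) = k" by (simp_all add: s_def)
  show ?thesis
  proof (cases "(i = k \<and> j = k + 1) \<or> (i = k + 1 \<and> j = k)")
    case True
    then show ?thesis
      using sw by (auto simp: P rho_def sk)
  next
    case False
    then have "i < j \<longleftrightarrow> s i < s j" "j < i \<longleftrightarrow> s j < s i"
      by (auto simp: s_def transpose_def split: if_splits)
    with False show ?thesis by (auto simp: P rho_def)
  qed
qed

text \<open>Only the summand pairing \<open>k\<close> with \<open>k + 1\<close> has a correction, so
  the sum over \<open>j\<close> yields exactly the cross relation for \<open>e_i\<close>: 1 at
  \<open>k\<close> and -1 at \<open>k + 1\<close>.\<close>

lemma perm_op_theta_op:
  fixes k :: nat
  defines "s \<equiv> transpose k (k + 1)"
  assumes k: "1 \<le> k" "k < N" and i: "i \<in> {1..N}"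
  shows "perm_op s (theta_op N i f) B = theta_op N (s i) (perm_op s f) B
     + (if i = k then f B else if i = k + 1 then - f B else 0)"
proof -
  have s: "s permutes {1..N}"
    unfolding s_def using k by (intro permutes_swap_id) auto
  have "perm_op s (theta_op N i f) B = (\<Sum>j\<in>{1..N}. perm_op s (rho i j f) B)"
    by (simp add: perm_op_def theta_op_def)
  also have "\<dots> = (\<Sum>j\<in>{1..N}. rho (s i) (s j) (perm_op s f) B)
     + (\<Sum>j\<in>{1..N}. if i = k \<and> j = k + 1 then f B else if i = k + 1 \<and> j = k then - f B else 0)"
    unfolding s_def by (subst perm_op_rho) (simp only: sum.distrib)
  also have "(\<Sum>j\<in>{1..N}. rho (s i) (s j) (perm_op s f) B) = theta_op N (s i) (perm_op s f) B"
    unfolding theta_op_def by (rule sum.permute[OF s, unfolded comp_def, symmetric])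
  also have "(\<Sum>j\<in>{1..N}. if i = k \<and> j = k + 1 then f B else if i = k + 1 \<and> j = k then - f B else 0)
      = (if i = k then f B else if i = k + 1 then - f B else 0)"
  proof -
    have "(\<Sum>j\<in>{1..N}. if i = k \<and> j = k + 1 then f B else if i = k + 1 \<and> j = k then - f B else 0)
      = (\<Sum>j\<in>{1..N}. (if j = k + 1 then (if i = k then f B else 0) else 0)
          + (if j = k then (if i = k + 1 then - f B else 0) else 0))"
      by (rule sum.cong) auto
    also have "\<dots> = (if i = k then f B else 0) + (if i = k + 1 then - f B else 0)"
      unfolding sum.distrib using k by (subst (1 2) sum.delta) auto
    also have "\<dots> = (if i = k then f B else if i = k + 1 then - f B else 0)"
      by auto
    finally show ?thesis .
  qed
  finally show ?thesis .
qed

subsection \<open>Polynomials in the commuting operators\<close>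

definition op_linear :: "((nat set \<Rightarrow> complex) \<Rightarrow> nat set \<Rightarrow> complex) \<Rightarrow> bool" where
  "op_linear T \<longleftrightarrow> (\<forall>f g. T (\<lambda>B. f B + g B) = (\<lambda>B. T f B + T g B)) \<and>
                   (\<forall>c f. T (\<lambda>B. c * f B) = (\<lambda>B. c * T f B))"

lemma op_linearD:
  assumes "op_linear T"
  shows "T (\<lambda>B. f B + g B) B = T f B + T g B" "T (\<lambda>B. c * f B) B = c * T f B"
  using assms by (simp_all add: op_linear_def)

lemma op_linear_zero: "op_linear T \<Longrightarrow> T (\<lambda>B. 0) B = 0"
  using op_linearD(2)[of T 0 "\<lambda>B. 0" B] by simp

lemma op_linear_id: "op_linear id"
  by (simp add: op_linear_def)

lemma op_linear_comp: "op_linear S \<Longrightarrow> op_linear T \<Longrightarrow> op_linear (S \<circ> T)"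
  by (simp add: op_linear_def)

lemma op_linear_funpow: "op_linear T \<Longrightarrow> op_linear (T ^^ n)"
  by (induction n) (auto intro: op_linear_comp simp: op_linear_id)

lemma op_linear_perm_op: "op_linear (perm_op w)"
  by (simp add: op_linear_def perm_op_def)

lemma op_linear_theta_op: "op_linear (theta_op N i)"
  by (simp add: op_linear_def theta_op_def rho_add rho_scale sum.distrib sum_distrib_left)

text \<open>Composition is not commutative in general, so a list fixes the order of the factors; the
  commutation of the \<open>theta_op\<close> enters in \<open>mon_op_add\<close>.\<close>

definition mon_op :: "nat list \<Rightarrow> nat \<Rightarrow> (nat \<Rightarrow>\<^sub>0 nat) \<Rightarrow> (nat set \<Rightarrow> complex) \<Rightarrow> nat set \<Rightarrow> complex" where
  "mon_op xs N \<mu> = foldr (\<lambda>i T. (theta_op N i ^^ Poly_Mapping.lookup \<mu> i) \<circ> T) xs id"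

lemma mon_op_Nil: "mon_op [] N \<mu> = id"
  by (simp add: mon_op_def)

lemma mon_op_Cons:
  "mon_op (i # xs) N \<mu> = (theta_op N i ^^ Poly_Mapping.lookup \<mu> i) \<circ> mon_op xs N \<mu>"
  by (simp add: mon_op_def)

lemma op_linear_mon_op: "op_linear (mon_op xs N \<mu>)"
  by (induction xs)
    (simp_all only: mon_op_Nil mon_op_Cons op_linear_id op_linear_comp op_linear_funpow op_linear_theta_op)

lemma funpow_commute:
  assumes "\<And>f. S (T f) = T (S f)"
  shows "S ((T ^^ n) f) = (T ^^ n) (S f)"
  by (induction n) (simp_all add: assms)

lemma mon_op_commute:
  assumes "\<And>i f. i \<in> set xs \<Longrightarrow> T (theta_op N i f) = theta_op N i (T f)"
  shows "T (mon_op xs N \<mu> f) = mon_op xs N \<mu> (T f)"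
  using assms
proof (induction xs)
  case (Cons i xs)
  then have "T ((theta_op N i ^^ n) g) = (theta_op N i ^^ n) (T g)" for n g
    by (intro funpow_commute) simp
  with Cons show ?case by (simp add: mon_op_def)
qed (simp add: mon_op_def)

lemma mon_op_add:
  assumes "set xs \<subseteq> {1..N}"
  shows "mon_op xs N (\<mu> + \<mu>') f = mon_op xs N \<mu> (mon_op xs N \<mu>' f)"
  using assms
proof (induction xs arbitrary: f)
  case (Cons i xs)
  define T where "T = theta_op N i"
  have comm: "(T ^^ n) (mon_op xs N \<mu> f) = mon_op xs N \<mu> ((T ^^ n) f)" for n f
  proof (rule mon_op_commute)
    fix j g assume "j \<in> set xs"
    then show "(T ^^ n) (theta_op N j g) = theta_op N j ((T ^^ n) g)"
      unfolding T_def using Cons.prems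
      by (intro funpow_commute[symmetric] theta_op_commute) auto
  qed
  have e: "mon_op (i # xs) N \<mu> f = (T ^^ Poly_Mapping.lookup \<mu> i) (mon_op xs N \<mu> f)" for \<mu> f
    by (simp add: mon_op_def T_def)
  show ?case using Cons by (simp add: e lookup_add funpow_add comm)
qed (simp add: mon_op_def)

lemma mon_op_zero [simp]: "mon_op xs N 0 f = f"
  by (induction xs) (simp_all add: mon_op_def)

lemma mon_op_single:
  assumes "distinct xs"
  shows "mon_op xs N (Poly_Mapping.single i 1) f = (if i \<in> set xs then theta_op N i f else f)"
  using assms
proof (induction xs)
  case (Cons j xs)
  have "mon_op (j # xs) N \<mu> f = (theta_op N j ^^ Poly_Mapping.lookup \<mu> j) (mon_op xs N \<mu> f)" for \<mu> f
    by (simp add: mon_op_def)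
  with Cons show ?case by (auto simp: lookup_single when_def)
qed (simp add: mon_op_def)

lemma poly_mapping_sum_single:
  fixes h :: "'a \<Rightarrow>\<^sub>0 'b::comm_monoid_add"
  shows "h = (\<Sum>a\<in>Poly_Mapping.keys h. Poly_Mapping.single a (Poly_Mapping.lookup h a))"
  by (rule poly_mapping_eqI) (auto simp: lookup_sum lookup_single when_def in_keys_iff)

text \<open>Only the terms of \<open>h\<close> itself have to be treated, so support conditions on
  \<open>h\<close> remain available in the induction.\<close>

lemma poly_mapping_keys_induct:
  fixes h :: "'a \<Rightarrow>\<^sub>0 'b::comm_monoid_add"
  assumes "\<And>a. a \<in> Poly_Mapping.keys h \<Longrightarrow> P (Poly_Mapping.single a (Poly_Mapping.lookup h a))"
    and "P 0" and "\<And>x y. P x \<Longrightarrow> P y \<Longrightarrow> P (x + y)"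
  shows "P h"
proof -
  have "P (\<Sum>a\<in>S. Poly_Mapping.single a (Poly_Mapping.lookup h a))"
    if "S \<subseteq> Poly_Mapping.keys h" for S
    using finite_subset[OF that finite_keys] that
    by (induction S rule: finite_induct) (auto intro: assms)
  from this[OF order_refl] show ?thesis by (simp flip: poly_mapping_sum_single)
qed

definition poly_op :: "nat \<Rightarrow> sympoly \<Rightarrow> (nat set \<Rightarrow> complex) \<Rightarrow> nat set \<Rightarrow> complex" where
  "poly_op N p f = (\<lambda>B. \<Sum>\<mu>\<in>Poly_Mapping.keys p.
     Poly_Mapping.lookup p \<mu> * mon_op [1..<Suc N] N \<mu> f B)"

lemma op_linear_poly_op: "op_linear (poly_op N p)"
  using op_linearD[OF op_linear_mon_op]
  by (simp add: op_linear_def poly_op_def fun_eq_iff sum.distrib sum_distrib_left algebra_simps)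

lemma poly_op_add: "poly_op N (p + q) f = (\<lambda>B. poly_op N p f B + poly_op N q f B)"
  unfolding poly_op_def
  by (subst setsum_keys_plus_distrib) (auto simp: algebra_simps)

lemma poly_op_single: "poly_op N (Poly_Mapping.single \<mu> c) f = (\<lambda>B. c * mon_op [1..<Suc N] N \<mu> f B)"
  by (simp add: poly_op_def)

lemma poly_op_zero [simp]: "poly_op N 0 f = (\<lambda>B. 0)"
  by (simp add: poly_op_def)

lemma poly_op_const [simp]: "poly_op N (sym_const c) f = (\<lambda>B. c * f B)"
  by (simp add: sym_const_def poly_op_single)

lemma poly_op_one [simp]: "poly_op N 1 f = f"
  using poly_op_const[of N 1 f] by (simp add: sym_const_def)

lemma poly_op_var:
  "i \<in> {1..N} \<Longrightarrow> poly_op N (Poly_Mapping.single (Poly_Mapping.single i 1) c) f = (\<lambda>B. c * theta_op N i f B)"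
  using mon_op_single[of "[1..<Suc N]" N i f] by (simp add: poly_op_single del: upt_Suc)

lemma poly_op_mult: "poly_op N (p * q) f = poly_op N p (poly_op N q f)"
proof (induction p rule: poly_mapping_keys_induct)
  case (1 \<mu>)
  define c where "c = Poly_Mapping.lookup p \<mu>"
  have L: "op_linear (poly_op N (Poly_Mapping.single \<mu> c))" by (rule op_linear_poly_op)
  have "poly_op N (Poly_Mapping.single \<mu> c * q) f = poly_op N (Poly_Mapping.single \<mu> c) (poly_op N q f)"
  proof (induction q rule: poly_mapping_keys_induct)
    case (1 \<mu>')
    have "set [1..<Suc N] \<subseteq> {1..N}" by auto
    then show ?case
      using op_linearD(2)[OF op_linear_mon_op]
      by (simp add: mult_single poly_op_single mon_op_add mult.assoc del: upt_Suc)
  next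
    case 2
    show ?case using op_linear_zero[OF L] by auto
  next
    case (3 x y)
    then show ?case using op_linearD(1)[OF L] by (simp add: distrib_left poly_op_add)
  qed
  then show ?case by (simp add: c_def)
next
  case 2
  show ?case by simp
next
  case (3 x y)
  then show ?case by (simp add: distrib_right poly_op_add)
qed

subsection \<open>The inner product\<close>

text \<open>Functions live on all sets of naturals, but the sum sees only subsets of
  \<open>{1..N}\<close>. The form is therefore degenerate on the full function type, and vanishing
  and nonvanishing are later tested on those subsets.\<close>

definition ip :: "nat \<Rightarrow> (nat set \<Rightarrow> complex) \<Rightarrow> (nat set \<Rightarrow> complex) \<Rightarrow> complex" where
  "ip N f g = (\<Sum>B\<in>Pow {1..N}. f B * cnj (g B))"

lemma ip_add_left: "ip N (\<lambda>B. f B + f' B) g = ip N f g + ip N f' g"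
  and ip_add_right: "ip N g (\<lambda>B. f B + f' B) = ip N g f + ip N g f'"
  and ip_scale_left: "ip N (\<lambda>B. c * f B) g = c * ip N f g"
  and ip_scale_right: "ip N f (\<lambda>B. c * g B) = cnj c * ip N f g"
  and ip_cnj: "ip N g f = cnj (ip N f g)"
  by (simp_all add: ip_def algebra_simps sum.distrib sum_distrib_left)

lemma ip_minus_right: "ip N f (\<lambda>B. - g B) = - ip N f g"
  by (simp add: ip_def sum_negf)

lemma ip_sum_left: "ip N (\<lambda>B. \<Sum>a\<in>S. f a B) g = (\<Sum>a\<in>S. ip N (f a) g)"
  unfolding ip_def sum_distrib_right by (rule sum.swap)

lemma ip_sum_right: "ip N g (\<lambda>B. \<Sum>a\<in>S. f a B) = (\<Sum>a\<in>S. ip N g (f a))"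
  unfolding ip_def cnj_sum sum_distrib_left by (rule sum.swap)

lemma ip_self: "ip N f f = complex_of_real (\<Sum>B\<in>Pow {1..N}. (cmod (f B))\<^sup>2)"
  by (simp add: ip_def flip: complex_norm_square)

lemma ip_self_nonneg: "0 \<le> Re (ip N f f)"
  by (simp add: ip_self sum_nonneg)

lemma ip_self_eq_0: "Re (ip N f f) = 0 \<longleftrightarrow> (\<forall>B\<in>Pow {1..N}. f B = 0)"
  by (simp add: ip_self sum_nonneg_eq_0_iff)

lemma ip_cong:
  "(\<And>B. B \<subseteq> {1..N} \<Longrightarrow> f B = f' B) \<Longrightarrow> (\<And>B. B \<subseteq> {1..N} \<Longrightarrow> g B = g' B) \<Longrightarrow> ip N f g = ip N f' g'"
  unfolding ip_def by (rule sum.cong) auto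

lemma ip_perm_op:
  assumes "w permutes {1..N}"
  shows "ip N (perm_op w f) g = ip N f (perm_op (inv_into UNIV w) g)"
  unfolding ip_def perm_op_def
  using assms
  by (intro sum.reindex_bij_witness[where i = "\<lambda>B. inv_into UNIV w -` B" and j = "\<lambda>B. w -` B"])
    (auto simp: vimage_comp permutes_inv_o dest: permutes_in_image permutes_in_image[OF permutes_inv])

text \<open>The diagonal part is real. Exchanging \<open>i\<close> for \<open>j\<close> is a
  bijection from the sets that contain only \<open>i\<close> of the two to those that contain only
  \<open>j\<close>, and it turns the off-diagonal part into its transpose.\<close>

lemma ip_rmat:
  assumes ij: "i \<in> {1..N}" "j \<in> {1..N}" "i \<noteq> j"
  shows "ip N (rmat i j f) g = ip N f (rmat j i g)"
proof -
  define same where "same B \<longleftrightarrow> (i \<in> B) = (j \<in> B)" for B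
  let ?P = "Pow {1..N}"
  have "ip N (rmat i j f) g = (\<Sum>B\<in>?P. if same B then f B / 2 * cnj (g B) else 0)
      + (\<Sum>B\<in>?P. if i \<in> B \<and> j \<notin> B then f (insert j (B - {i})) * cnj (g B) else 0)"
    unfolding ip_def sum.distrib[symmetric] by (rule sum.cong) (auto simp: rmat_def same_def)
  also have "(\<Sum>B\<in>?P. if i \<in> B \<and> j \<notin> B then f (insert j (B - {i})) * cnj (g B) else 0)
      = (\<Sum>B\<in>{B \<in> ?P. i \<in> B \<and> j \<notin> B}. f (insert j (B - {i})) * cnj (g B))"
    by (rule sum.inter_filter[symmetric]) simp
  also have "\<dots> = (\<Sum>B\<in>{B \<in> ?P. j \<in> B \<and> i \<notin> B}. f B * cnj (g (insert i (B - {j}))))"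
  proof (rule sum.reindex_bij_witness[where i = "\<lambda>B. insert i (B - {j})" and j = "\<lambda>B. insert j (B - {i})"])
    fix B assume "B \<in> {B \<in> ?P. i \<in> B \<and> j \<notin> B}"
    then have e: "insert i (insert j (B - {i}) - {j}) = B" and p: "B \<subseteq> {1..N}" "i \<in> B" "j \<notin> B"
      by auto
    show "insert i (insert j (B - {i}) - {j}) = B" by (rule e)
    show "insert j (B - {i}) \<in> {B \<in> ?P. j \<in> B \<and> i \<notin> B}" using ij p by auto
    show "f (insert j (B - {i})) * cnj (g (insert i (insert j (B - {i}) - {j})))
      = f (insert j (B - {i})) * cnj (g B)" by (simp only: e)
  next
    fix B assume "B \<in> {B \<in> ?P. j \<in> B \<and> i \<notin> B}"
    then show "insert j (insert i (B - {j}) - {i}) = B"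
      and "insert i (B - {j}) \<in> {B \<in> ?P. i \<in> B \<and> j \<notin> B}"
      using ij by auto
  qed
  also have "\<dots> = (\<Sum>B\<in>?P. if j \<in> B \<and> i \<notin> B then f B * cnj (g (insert i (B - {j}))) else 0)"
    by (rule sum.inter_filter) simp
  also have "(\<Sum>B\<in>?P. if same B then f B / 2 * cnj (g B) else 0) + \<dots> = ip N f (rmat j i g)"
    unfolding ip_def sum.distrib[symmetric] by (rule sum.cong) (auto simp: rmat_def same_def)
  finally show ?thesis .
qed

lemma longest_in [simp]: "i \<in> {1..N} \<Longrightarrow> longest N i \<in> {1..N}"
  by (auto simp: longest_def)

lemma longest_longest [simp]: "longest N (longest N i) = i"
  by (auto simp: longest_def)

lemma longest_comp [simp]: "longest N \<circ> longest N = id"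
  by auto

lemma bij_longest: "bij (longest N)"
  by (rule o_bij[of "longest N"]) simp_all

lemma permutes_longest: "longest N permutes {1..N}"
proof (rule bij_imp_permutes)
  show "bij_betw (longest N) {1..N} {1..N}"
    by (rule bij_betw_byWitness[where f' = "longest N"])
      (auto simp del: atLeastAtMost_iff One_nat_def)
qed (auto simp: longest_def)

text \<open>Taking adjoints replaces \<open>r_ij\<close> by \<open>r_ji\<close>, which has the wrong
  order of indices. Conjugation by \<open>longest\<close> reverses the order as well, and the
  antisymmetry of \<open>rho\<close> supplies the sign. The result has the form of
  \<open>star\<close> on an element of degree one.\<close>

lemma ip_theta_op:
  assumes i: "i \<in> {1..N}"
  shows "ip N (theta_op N i f) g
    = - ip N f (perm_op (longest N) (theta_op N (longest N i) (perm_op (longest N) g)))"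
proof -
  define w where "w = longest N"
  have rho: "ip N (rho i j f) g = - ip N f (perm_op w (rho (w i) (w j) (perm_op w g)))"
    if j: "j \<in> {1..N}" for j
  proof -
    have "perm_op w (rmat (w a) (w b) (perm_op w g)) = rmat a b g" for a b
      using perm_op_rmat[OF bij_longest[of N], of "w a" "w b" "perm_op w g"]
      by (simp add: w_def perm_op_comp)
    then have R: "rmat (w a) (w b) (perm_op w g) (w -` B) = rmat a b g B" for a b B
      by (simp add: perm_op_def fun_eq_iff)
    have less: "w i < w j \<longleftrightarrow> j < i" "w j < w i \<longleftrightarrow> i < j"
      using i j by (auto simp: w_def longest_def)
    consider "i < j" | "j < i" | "i = j" by linarith
    then show ?thesis
    proof cases
      case 1
      then have "perm_op w (rho (w i) (w j) (perm_op w g)) = (\<lambda>B. - rmat j i g B)"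
        using less by (auto simp: perm_op_def rho_def R[unfolded perm_op_def])
      moreover have "rho i j f = rmat i j f" using 1 by (auto simp: rho_def)
      ultimately show ?thesis using i j 1 by (simp add: ip_minus_right ip_rmat)
    next
      case 2
      then have "perm_op w (rho (w i) (w j) (perm_op w g)) = rmat i j g"
        using less by (auto simp: perm_op_def rho_def R[unfolded perm_op_def])
      moreover have "rho i j f = (\<lambda>B. - 1 * rmat j i f B)" using 2 by (auto simp: rho_def)
      ultimately show ?thesis using i j 2 by (simp only: ip_scale_left) (simp add: ip_rmat)
    next
      case 3
      then show ?thesis by (simp add: perm_op_def rho_def ip_def)
    qed
  qed
  have "ip N (theta_op N i f) g = (\<Sum>j\<in>{1..N}. ip N (rho i j f) g)"
    by (simp add: theta_op_def ip_sum_left)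
  also have "\<dots> = - (\<Sum>j\<in>{1..N}. ip N f (perm_op w (rho (w i) (w j) (perm_op w g))))"
    by (simp add: rho sum_negf)
  also have "(\<Sum>j\<in>{1..N}. ip N f (perm_op w (rho (w i) (w j) (perm_op w g))))
      = (\<Sum>j\<in>{1..N}. ip N f (perm_op w (rho (w i) j (perm_op w g))))"
    using sum.permute[OF permutes_longest[of N], of "\<lambda>j. ip N f (perm_op w (rho (w i) j (perm_op w g)))"]
    by (simp add: w_def comp_def)
  also have "\<dots> = ip N f (perm_op w (theta_op N (w i) (perm_op w g)))"
    by (simp add: ip_sum_right[symmetric] perm_op_def theta_op_def)
  finally show ?thesis by (simp add: w_def)
qed

subsection \<open>Weight vectors\<close>

text \<open>The weight is doubled to stay integral, so that its parity can tell the two blocks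
  apart. On a block of size \<open>m\<close> the halves run through (m-1)/2, (m-3)/2, ...,
  (1-m)/2.\<close>

definition block_weight :: "nat \<Rightarrow> nat set \<Rightarrow> nat \<Rightarrow> int" where
  "block_weight N A i = (\<Sum>j\<in>{1..N}. if (j \<in> A) = (i \<in> A) then sgn (int j - int i) else 0)"

definition weight_vector :: "nat \<Rightarrow> (nat \<Rightarrow> real) \<Rightarrow> (nat set \<Rightarrow> complex) \<Rightarrow> bool" where
  "weight_vector N c u \<longleftrightarrow> (\<exists>B\<subseteq>{1..N}. u B \<noteq> 0) \<and>
     (\<forall>i\<in>{1..N}. theta_op N i u = (\<lambda>B. complex_of_real (c i) * u B))"

text \<open>Adding the block size raises each sign by one: later members of the block count 2,
  earlier ones 0, and \<open>i\<close> itself 1, so the total is odd.\<close>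

lemma block_weight_parity:
  assumes "i \<in> {1..N}"
  shows "odd (block_weight N A i) \<longleftrightarrow> even (card {j \<in> {1..N}. (j \<in> A) = (i \<in> A)})"
proof -
  have "block_weight N A i + int (card {j \<in> {1..N}. (j \<in> A) = (i \<in> A)})
    = (\<Sum>j\<in>{1..N}. if (j \<in> A) = (i \<in> A) then sgn (int j - int i) + 1 else 0)"
    unfolding block_weight_def
    by (simp add: sum.inter_filter[symmetric] sum.distrib)
  also have "\<dots> = (\<Sum>j\<in>{1..N}. 2 * (if (j \<in> A) = (i \<in> A) \<and> i < j then 1 else 0) + (if j = i then 1 else 0))"
    by (rule sum.cong) (auto simp: sgn_if)
  also have "\<dots> = 2 * (\<Sum>j\<in>{1..N}. if (j \<in> A) = (i \<in> A) \<and> i < j then 1 else 0) + 1"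
    using assms by (simp add: sum.distrib sum_distrib_left)
  finally have "odd (block_weight N A i + int (card {j \<in> {1..N}. (j \<in> A) = (i \<in> A)}))"
    by simp
  then show ?thesis by simp
qed

text \<open>Two indices in the same block contribute the diagonal 1/2 with the sign of their order.
  For indices in different blocks the diagonal part vanishes, and the off-diagonal part would move
  membership from the larger index to the smaller; in an initial segment the smaller one is already
  a member.\<close>

lemma weight_vector_initial:
  "weight_vector N (\<lambda>i. block_weight N {1..m} i / 2) (\<lambda>B. if B = {1..m} then 1 else 0)"
  if "m \<le> N"
proof -
  define f :: "nat set \<Rightarrow> complex" where "f = (\<lambda>B. if B = {1..m} then 1 else 0)"
  have rho: "rho i j f B = of_int (if (j \<in> {1..m}) = (i \<in> {1..m}) then sgn (int j - int i) else 0) / 2 * f B"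
    if "i \<ge> 1" "j \<ge> 1" for i j B
  proof -
    have z: "f (insert b (B - {a})) = 0" if "1 \<le> a" "a < b" "b \<notin> B" for a b
    proof -
      have "insert b (B - {a}) \<noteq> {1..m}"
      proof
        assume e: "insert b (B - {a}) = {1..m}"
        then have "b \<in> {1..m}" "a \<notin> {1..m}" using that by auto
        with that show False by auto
      qed
      then show ?thesis by (simp add: f_def)
    qed
    have n: "f B = 0" if "(i \<in> B) = (j \<in> B)" "(i \<in> {1..m}) \<noteq> (j \<in> {1..m})"
      using that by (auto simp: f_def)
    have n': "f B = 0" if "(i \<in> B) \<noteq> (j \<in> B)" "(i \<in> {1..m}) = (j \<in> {1..m})"
      using that by (auto simp: f_def)
    consider "i < j" | "j < i" | "i = j" by linarith
    then show ?thesis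
    proof cases
      case 1
      then show ?thesis using z[of i j] n n' that
        by (auto simp: rho_def rmat_def)
    next
      case 2
      then show ?thesis using z[of j i] n n' that
        by (auto simp: rho_def rmat_def)
    qed simp
  qed
  have "theta_op N i f B = complex_of_real (block_weight N {1..m} i / 2) * f B" if "i \<in> {1..N}" for i B
  proof -
    have "theta_op N i f B = (\<Sum>j\<in>{1..N}. of_int (if (j \<in> {1..m}) = (i \<in> {1..m}) then sgn (int j - int i) else 0) / 2 * f B)"
      unfolding theta_op_def using that by (intro sum.cong refl rho) auto
    then show ?thesis
      by (simp add: block_weight_def sum_divide_distrib sum_distrib_right)
  qed
  then show ?thesis using that unfolding weight_vector_def f_def[symmetric]
    by (auto simp: f_def intro!: exI[of _ "{1..m}"])
qed

text \<open>The operator \<open>t_s - 1/d\<close>, with \<open>d\<close> the difference of the two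
  eigenvalues, is the normalised intertwiner: the cross relation makes it exchange these
  eigenvalues. It can annihilate \<open>u\<close> only if \<open>d\<close> is 1 or -1.\<close>

lemma weight_vector_swap:
  fixes k :: nat
  defines "s \<equiv> transpose k (k + 1)"
  assumes u: "weight_vector N c u" and k: "1 \<le> k" "k < N"
    and d: "c k - c (k + 1) \<notin> {0, 1, -1}"
  shows "\<exists>u'. weight_vector N (c \<circ> s) u'"
proof -
  define d where "d = c k - c (k + 1)"
  define u' where "u' = (\<lambda>B. perm_op s u B + (- 1 / complex_of_real d) * u B)"
  have d: "d \<noteq> 0" "d\<^sup>2 \<noteq> 1" using d by (auto simp: d_def power2_eq_1_iff)
  have s: "s permutes {1..N}" unfolding s_def using k by (intro permutes_swap_id) auto
  have ss: "s (s i) = i" for i by (simp add: s_def)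
  obtain B where B: "B \<subseteq> {1..N}" "u B \<noteq> 0" using u by (auto simp: weight_vector_def)
  have sB: "s -` B \<subseteq> {1..N}" using B(1) s by (auto dest: permutes_in_image)
  have ssB: "s -` s -` B = B" by (auto simp: ss)
  \<comment> \<open>If \<open>u'\<close> vanished at \<open>B\<close> and at its image, each of the
    two values of \<open>u\<close> would be 1/d times the other, which forces the square of
    \<open>d\<close> to be 1.\<close>
  have nz: "u' B \<noteq> 0 \<or> u' (s -` B) \<noteq> 0"
  proof (rule ccontr)
    assume "\<not> ?thesis"
    then have "u (s -` B) = u B / d" "u B = u (s -` B) / d"
      by (auto simp: u'_def perm_op_def ssB)
    then have "u B = u B / complex_of_real d / complex_of_real d" by simp
    then have "u B * d\<^sup>2 = u B"
      using d(1) by (simp add: power2_eq_square field_simps)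
    with B(2) have "complex_of_real (d\<^sup>2) = 1" by simp
    with d show False by (simp only: of_real_eq_1_iff)
  qed
  have th: "theta_op N i u' B = complex_of_real (c (s i)) * u' B" if i: "i \<in> {1..N}" for i B
  proof -
    have si: "s i \<in> {1..N}" using s i by (simp only: permutes_in_image)
    have 1: "perm_op s (theta_op N (s i) u) B = c (s i) * perm_op s u B"
      using u si by (simp add: weight_vector_def perm_op_def)
    have 2: "theta_op N i (perm_op s u) B
        = perm_op s (theta_op N (s i) u) B - (if s i = k then u B else if s i = k + 1 then - u B else 0)"
      using perm_op_theta_op[OF k si, of u B] unfolding s_def[symmetric] by (simp add: ss)
    have 3: "theta_op N i u' B = theta_op N i (perm_op s u) B + (- 1 / complex_of_real d) * theta_op N i u B"
      unfolding u'_def by (simp only: op_linearD[OF op_linear_theta_op])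
    have 4: "theta_op N i u B = c i * u B" using u i by (simp add: weight_vector_def)
    have sk: "s k = Suc k" "s (Suc k) = k" by (simp_all add: s_def)
    have si_eq: "s i = (if i = k then k + 1 else if i = k + 1 then k else i)"
      by (auto simp: s_def)
    have "complex_of_real d \<noteq> 0" using d by simp
    moreover have ck: "complex_of_real (c k) = complex_of_real d + complex_of_real (c (k + 1))"
      by (simp add: d_def)
    moreover have u'B: "u' B = perm_op s u B + (- 1 / complex_of_real d) * u B"
      by (simp add: u'_def)
    ultimately show ?thesis
      unfolding 3 2 1 4 u'B
      by (cases "i = k"; cases "i = k + 1") (simp_all add: si_eq sk ck field_simps del: of_real_add of_real_diff)
  qed
  show ?thesis
    using nz B(1) sB th unfolding weight_vector_def by (intro exI[of _ u']) (auto simp: fun_eq_iff)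
qed

lemma downward_closed_eq_interval:
  assumes "finite A" "0 \<notin> A" "\<And>k. 1 \<le> k \<Longrightarrow> Suc k \<in> A \<Longrightarrow> k \<in> A"
  shows "A = {1..card A}"
proof (cases "A = {}")
  case False
  have le: "j \<in> A" if "1 \<le> j" "j \<le> Max A" for j
    using that(2,1)
  proof (induction j rule: inc_induct)
    case base
    show ?case using False assms(1) by simp
  next
    case (step n)
    then show ?case using assms(3)[of n] by simp
  qed
  have "A = {1..Max A}"
  proof
    show "A \<subseteq> {1..Max A}"
      using assms by (auto simp: Suc_le_eq intro!: gr0I)
  qed (use le in auto)
  then show ?thesis by (metis card_atLeastAtMost diff_Suc_1)
qed simp

text \<open>Induction on the sum of \<open>A\<close>: moving a member down to a free neighbour ends
  in an initial segment, and the intertwiners lead back. For odd \<open>N\<close> the two blocks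
  have sizes of opposite parity, so exchanged eigenvalues differ by half of an odd number and the
  intertwiner is always available.\<close>

lemma weight_vector_exists:
  assumes "A \<subseteq> {1..N}" "A = {} \<or> odd N"
  shows "\<exists>u. weight_vector N (\<lambda>i. block_weight N A i / 2) u"
  using assms
proof (induction "\<Sum>A" arbitrary: A rule: less_induct)
  case less
  have fin: "finite A" using less.prems finite_subset by blast
  show ?case
  proof (cases "\<exists>k\<ge>1. Suc k \<in> A \<and> k \<notin> A")
    case False
    then have "A = {1..card A}"
      using less.prems fin by (intro downward_closed_eq_interval) auto
    moreover have "card A \<le> N"
      using card_mono[OF _ less.prems(1)] by simp
    ultimately show ?thesis using weight_vector_initial[of "card A" N] by auto
  next
    case True
    then obtain k where k: "k \<ge> 1" "Suc k \<in> A" "k \<notin> A" by blast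
    then have kN: "k < N" using less.prems by auto
    define s where "s = transpose k (k + 1)"
    have s: "s permutes {1..N}" unfolding s_def using k kN by (intro permutes_swap_id) auto
    define A' where "A' = insert k (A - {Suc k})"
    have sA: "i \<in> A \<longleftrightarrow> s i \<in> A'" for i
      using k by (auto simp: A'_def s_def transpose_def)
    have A'N: "A' \<subseteq> {1..N}" using less.prems k kN by (auto simp: A'_def)
    have oddN: "odd N" using less.prems k by auto
    have "\<Sum>A' = k + \<Sum>(A - {Suc k})" unfolding A'_def using k fin by simp
    moreover have "\<Sum>A = Suc k + \<Sum>(A - {Suc k})" using sum.remove[OF fin k(2), of "\<lambda>x. x"] by simp
    ultimately have "\<Sum>A' < \<Sum>A" by simp
    then obtain u where u: "weight_vector N (\<lambda>i. block_weight N A' i / 2) u"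
      using less.hyps A'N oddN by blast
    \<comment> \<open>The exchanged indices \<open>k\<close> and \<open>k + 1\<close> lie in
      different blocks, so the order inside each block, and with it every weight, is only
      relabelled.\<close>
    have bw: "block_weight N A i = block_weight N A' (s i)" for i
    proof -
      have "block_weight N A' (s i) = (\<Sum>j\<in>{1..N}. if (s j \<in> A') = (s i \<in> A') then sgn (int (s j) - int (s i)) else 0)"
        unfolding block_weight_def by (rule sum.permute[OF s, unfolded comp_def])
      also have "\<dots> = block_weight N A i"
        unfolding block_weight_def
      proof (rule sum.cong[OF refl])
        fix j
        show "(if (s j \<in> A') = (s i \<in> A') then sgn (int (s j) - int (s i)) else 0)
            = (if (j \<in> A) = (i \<in> A) then sgn (int j - int i) else 0)"
        proof (cases "(j \<in> A) = (i \<in> A)")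
          case True
          then have "\<not> (j = k \<and> i = k + 1)" "\<not> (j = k + 1 \<and> i = k)" using k by auto
          then have "s j < s i \<longleftrightarrow> j < i" "s i < s j \<longleftrightarrow> i < j"
            by (auto simp: s_def transpose_def)
          moreover have "s j = s i \<longleftrightarrow> j = i" using permutes_inj[OF s] by (simp add: inj_eq)
          ultimately show ?thesis using True unfolding sA[symmetric] by (auto simp: sgn_if)
        qed (simp add: sA[symmetric])
      qed
      finally show ?thesis by simp
    qed
    have odd: "odd (block_weight N A' k - block_weight N A' (k + 1))"
    proof -
      have kk: "k \<in> A'" "k + 1 \<notin> A'" by (auto simp: A'_def)
      have "{j \<in> {1..N}. (j \<in> A') = (k \<in> A')} = A'" "{j \<in> {1..N}. (j \<in> A') = (k + 1 \<in> A')} = {1..N} - A'"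
        using kk A'N by auto
      moreover have "card ({1..N} - A') + card A' = N"
        using A'N card_mono[OF _ A'N] by (simp add: card_Diff_subset finite_subset)
      ultimately show ?thesis
        using block_weight_parity[of k N A'] block_weight_parity[of "k + 1" N A'] k kN oddN
        by simp (metis even_add)
    qed
    have "block_weight N A' k / 2 - block_weight N A' (k + 1) / 2 \<notin> {0, 1, - 1 :: real}"
    proof
      assume *: "block_weight N A' k / 2 - block_weight N A' (k + 1) / 2 \<in> {0, 1, - 1 :: real}"
      then have "block_weight N A' k - block_weight N A' (k + 1) \<in> {0, 2, -2}"
        by (simp, linarith)
      then have "even (block_weight N A' k - block_weight N A' (k + 1))"
        by (elim insertE emptyE) (simp_all only: even_minus even_numeral dvd_0_right)
      with odd show False by blast
    qed
    from weight_vector_swap[OF u k(1) kN this]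
    show ?thesis unfolding s_def[symmetric] by (simp add: comp_def bw)
  qed
qed

section \<open>Isolated points of the hyperplane arrangement\<close>

definition class_weight :: "nat \<Rightarrow> (nat \<Rightarrow> real) \<Rightarrow> nat \<Rightarrow> real" where
  "class_weight N \<nu> i = (\<Sum>j\<in>{1..N}. if \<nu> j - \<nu> i \<in> \<int> then sgn (real j - real i) / 2 else 0)"

lemma class_weight_antisymmetric:
  assumes "\<nu> \<in> C_chamber N" "i \<in> {1..N}"
  shows "class_weight N \<nu> i + class_weight N \<nu> (N + 1 - i) = 0"
proof -
  have anti: "\<nu> (N + 1 - j) = - \<nu> j" if "j \<in> {1..N}" for j
    using assms(1) that by (auto simp: C_chamber_def add_eq_0_iff)
  have "class_weight N \<nu> (N + 1 - i) = (\<Sum>j\<in>{1..N}. if \<nu> (1 + N - j) - \<nu> (N + 1 - i) \<in> \<int>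
      then sgn (real (1 + N - j) - real (N + 1 - i)) / 2 else 0)"
    unfolding class_weight_def 
    by (rule sum.reindex_bij_witness[of _ "\<lambda>j. 1 + N - j" "\<lambda>j. 1 + N - j"]) auto
  also have "\<dots> = (\<Sum>j\<in>{1..N}. - (if \<nu> j - \<nu> i \<in> \<int> then sgn (real j - real i) / 2 else 0))"
  proof (rule sum.cong[OF refl])
    fix j assume j: "j \<in> {1..N}"
    have "\<nu> (1 + N - j) - \<nu> (N + 1 - i) = - (\<nu> j - \<nu> i)"
      using anti[OF j] anti[OF assms(2)] by (simp add: add.commute)
    then have "\<nu> (1 + N - j) - \<nu> (N + 1 - i) \<in> \<int> \<longleftrightarrow> \<nu> j - \<nu> i \<in> \<int>"
      by (simp only: minus_in_Ints_iff)
    moreover have "real (1 + N - j) - real (N + 1 - i) = - (real j - real i)"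
      using j assms(2) by (simp add: of_nat_diff)
    ultimately show "(if \<nu> (1 + N - j) - \<nu> (N + 1 - i) \<in> \<int>
      then sgn (real (1 + N - j) - real (N + 1 - i)) / 2 else 0)
      = - (if \<nu> j - \<nu> i \<in> \<int> then sgn (real j - real i) / 2 else 0)"
      by (simp only: sgn_minus) simp
  qed
  also have "\<dots> = - class_weight N \<nu> i"
    by (simp only: sum_negf class_weight_def)
  finally show ?thesis by simp
qed

text \<open>An index of the same class strictly between \<open>a\<close> and \<open>b\<close> would
  give an integer strictly between 0 and 1. Hence \<open>a\<close> and \<open>b\<close> are
  neighbours in their class, and the two sums differ only in the terms for \<open>a\<close> and
  \<open>b\<close>, by 1/2 each.\<close>

lemma class_weight_root:
  assumes \<nu>: "\<nu> \<in> C_chamber N" and ab: "1 \<le> a" "a < b" "b \<le> N" and d: "\<nu> a - \<nu> b = 1"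
  shows "class_weight N \<nu> a - class_weight N \<nu> b = 1"
proof -
  have same: "\<nu> j - \<nu> a \<in> \<int> \<longleftrightarrow> \<nu> j - \<nu> b \<in> \<int>" for j
  proof -
    have "\<nu> j - \<nu> b = (\<nu> j - \<nu> a) + 1" using d by simp
    then show ?thesis by (metis Ints_1 Ints_add Ints_diff add_diff_cancel_right')
  qed
  have between: "\<nu> j - \<nu> b \<notin> \<int>" if "a < j" "j < b" for j
  proof
    assume "\<nu> j - \<nu> b \<in> \<int>"
    then obtain z where z: "\<nu> j - \<nu> b = of_int z" by (elim Ints_cases)
    have "\<nu> a > \<nu> j" "\<nu> j > \<nu> b" using \<nu> that ab by (auto simp: C_chamber_def)
    with z d have "0 < real_of_int z" "real_of_int z < 1" by auto
    then show False by simp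
  qed
  have "class_weight N \<nu> a - class_weight N \<nu> b
    = (\<Sum>j\<in>{1..N}. (if j = a then 1 / 2 else 0) + (if j = b then 1 / 2 else 0))"
    unfolding class_weight_def sum_subtractf[symmetric]
  proof (rule sum.cong[OF refl])
    fix j
    have a: "\<nu> a - \<nu> b \<in> \<int>" using d by simp
    have sgn: "sgn (real j - real i) = (if j < i then -1 else if j = i then 0 else 1)" for i
      by (simp add: sgn_if)
    consider "j < a" | "j = a" | "a < j" "j < b" | "j = b" | "b < j" by linarith
    then show "(if \<nu> j - \<nu> a \<in> \<int> then sgn (real j - real a) / 2 else 0)
        - (if \<nu> j - \<nu> b \<in> \<int> then sgn (real j - real b) / 2 else 0)
        = (if j = a then 1 / 2 else 0) + (if j = b then 1 / 2 else 0)"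
      unfolding same sgn using ab a between[of j]
      by cases simp_all
  qed
  also have "\<dots> = 1" unfolding sum.distrib using ab by (simp add: sum.delta)
  finally show ?thesis .
qed

lemma isolated_point_eq_class_weight:
  assumes R: "R' \<subseteq> pos_roots N" and H: "H_inter N R' = {\<nu>}" and i: "i \<in> {1..N}"
  shows "\<nu> i = class_weight N \<nu> i"
proof -
  define g where "g i = class_weight N \<nu> i - \<nu> i" for i
  have \<nu>: "\<nu> \<in> C_chamber N" and root: "\<And>\<alpha>. \<alpha> \<in> R' \<Longrightarrow> root_pairing \<alpha> \<nu> = 1"
    using H by (auto simp: H_inter_def H_plane_def)
  have dec: "\<nu> i > \<nu> j" if "1 \<le> i" "i < j" "j \<le> N" for i j
    using \<nu> that by (auto simp: C_chamber_def)
  \<comment> \<open>The chamber is cut out by finitely many strict inequalities, together with the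
    antisymmetry that \<open>g\<close> respects; a short enough step along \<open>g\<close>
    therefore stays in it.\<close>
  have "eventually (\<lambda>\<epsilon>. \<forall>(i, j)\<in>{1..N} \<times> {1..N}. i < j \<longrightarrow> 0 < (\<nu> i - \<nu> j) + \<epsilon> * (g i - g j)) (at_right (0::real))"
  proof (intro eventually_ball_finite ballI; clarify?)
    fix i j assume ij: "i \<in> {1..N}" "j \<in> {1..N}"
    show "eventually (\<lambda>\<epsilon>. i < j \<longrightarrow> 0 < (\<nu> i - \<nu> j) + \<epsilon> * (g i - g j)) (at_right (0::real))"
    proof (cases "i < j")
      case True
      have "((\<lambda>\<epsilon>. (\<nu> i - \<nu> j) + \<epsilon> * (g i - g j)) \<longlongrightarrow> (\<nu> i - \<nu> j) + 0 * (g i - g j)) (at_right 0)"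
        by (intro tendsto_intros)
      then have "eventually (\<lambda>\<epsilon>. 0 < (\<nu> i - \<nu> j) + \<epsilon> * (g i - g j)) (at_right 0)"
        using dec[of i j] ij True by (intro order_tendstoD(1)) auto
      then show ?thesis by eventually_elim simp
    qed simp
  qed auto
  moreover have "eventually (\<lambda>\<epsilon>. 0 < \<epsilon>) (at_right (0::real))"
    by (simp add: eventually_at_right_less)
  ultimately have "eventually (\<lambda>\<epsilon>. 0 < \<epsilon> \<and> (\<forall>(i, j)\<in>{1..N} \<times> {1..N}. i < j \<longrightarrow> 0 < (\<nu> i - \<nu> j) + \<epsilon> * (g i - g j))) (at_right (0::real))"
    by (rule eventually_conj[rotated])
  then obtain \<epsilon> :: real where \<epsilon>: "\<epsilon> > 0"
    and pos: "\<And>i j. i \<in> {1..N} \<Longrightarrow> j \<in> {1..N} \<Longrightarrow> i < j \<Longrightarrow> 0 < (\<nu> i - \<nu> j) + \<epsilon> * (g i - g j)"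
    by (auto dest!: eventually_happens'[OF trivial_limit_at_right_real])
  define \<mu> where "\<mu> = restrict (\<lambda>i. \<nu> i + \<epsilon> * g i) {1..N}"
  have \<mu>: "\<mu> i = \<nu> i + \<epsilon> * g i" if "i \<in> {1..N}" for i
    using that by (simp add: \<mu>_def)
  have ganti: "g i + g (N + 1 - i) = 0" if "i \<in> {1..N}" for i
  proof -
    have "\<nu> i + \<nu> (N + 1 - i) = 0" using \<nu> that by (simp add: C_chamber_def)
    then show ?thesis
      using class_weight_antisymmetric[OF \<nu> that] by (simp add: g_def)
  qed
  have "\<mu> \<in> C_chamber N"
  proof -
    have "\<mu> i > \<mu> j" if "1 \<le> i" "i < j" "j \<le> N" for i j
      using pos[of i j] that by (simp add: \<mu> algebra_simps)
    moreover have "\<mu> i + \<mu> (N + 1 - i) = 0" if i: "i \<in> {1..N}" for i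
    proof -
      have "N + 1 - i \<in> {1..N}" using i by auto
      then have "\<mu> i + \<mu> (N + 1 - i) = (\<nu> i + \<nu> (N + 1 - i)) + \<epsilon> * (g i + g (N + 1 - i))"
        using i by (simp only: \<mu> distrib_left)
      then show ?thesis using \<nu> i ganti[OF i] by (simp add: C_chamber_def del: atLeastAtMost_iff)
    qed
    ultimately show ?thesis unfolding C_chamber_def \<mu>_def by (auto simp del: atLeastAtMost_iff)
  qed
  moreover have "root_pairing \<alpha> \<mu> = 1" if \<alpha>: "\<alpha> \<in> R'" for \<alpha>
  proof -
    obtain a b where ab: "\<alpha> = (a, b)" "1 \<le> a" "a < b" "b \<le> N"
      using R \<alpha> by (auto simp: pos_roots_def)
    have d: "\<nu> a - \<nu> b = 1" using root[OF \<alpha>] ab by (simp add: root_pairing_def)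
    have "g a = g b" using class_weight_root[OF \<nu> ab(2-4) d] d by (simp add: g_def)
    then show ?thesis using d ab by (simp add: root_pairing_def \<mu>)
  qed
  ultimately have "\<mu> \<in> H_inter N R'" by (auto simp: H_inter_def H_plane_def)
  then have "\<mu> = \<nu>" using H by simp
  then have "\<epsilon> * g i = 0" using \<mu>[OF i] by simp
  then show ?thesis using \<epsilon> by (simp add: g_def)
qed

text \<open>Class weights lie in one half of the integers, so at most two classes modulo the
  integers occur, and \<open>A\<close> is the integral one. By parity, integral entries need a block
  of odd size and the others a block of even size; a nonempty \<open>A\<close> thus forces
  \<open>N\<close> to be odd.\<close>

lemma isolated_point_eq_block_weight:
  assumes R: "R' \<subseteq> pos_roots N" and H: "H_inter N R' = {\<nu>}"
  obtains A where "A \<subseteq> {1..N}" "A = {} \<or> odd N" "\<And>i. i \<in> {1..N} \<Longrightarrow> \<nu> i = block_weight N A i / 2"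
proof
  define A where "A = {i \<in> {1..N}. \<nu> i \<in> \<int>}"
  show AN: "A \<subseteq> {1..N}" by (auto simp: A_def)
  have cw: "\<nu> i = class_weight N \<nu> i" if "i \<in> {1..N}" for i
    using isolated_point_eq_class_weight[OF R H that] .
  have half: "2 * \<nu> i \<in> \<int>" if "i \<in> {1..N}" for i
  proof -
    have "2 * \<nu> i = (\<Sum>j\<in>{1..N}. if \<nu> j - \<nu> i \<in> \<int> then sgn (real j - real i) else 0)"
      by (subst cw[OF that]) (auto simp: class_weight_def sum_distrib_left intro!: sum.cong)
    also have "\<dots> \<in> \<int>" by (intro Ints_sum) (auto simp: sgn_if)
    finally show ?thesis .
  qed
  have same: "\<nu> j - \<nu> i \<in> \<int> \<longleftrightarrow> (j \<in> A) = (i \<in> A)" if ij: "i \<in> {1..N}" "j \<in> {1..N}" for i j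
  proof -
    obtain a b where ab: "2 * \<nu> i = real_of_int a" "2 * \<nu> j = real_of_int b"
      using half[OF ij(1)] half[OF ij(2)] by (elim Ints_cases) auto
    have int: "x \<in> \<int> \<longleftrightarrow> even z" if "2 * x = real_of_int z" for x z
    proof
      assume "x \<in> \<int>"
      then obtain y where "x = real_of_int y" by (elim Ints_cases)
      with that have "real_of_int z = real_of_int (2 * y)" by simp
      then have "z = 2 * y" by (simp only: of_int_eq_iff)
      then show "even z" by simp
    next
      assume "even z"
      then obtain y where "z = 2 * y" by (elim evenE)
      with that have "x = real_of_int y" by simp
      then show "x \<in> \<int>" by simp
    qed
    have "2 * (\<nu> j - \<nu> i) = real_of_int (b - a)" using ab by simp
    from int[OF this] int[OF ab(1)] int[OF ab(2)] ij show ?thesis by (auto simp: A_def)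
  qed
  show bw: "\<nu> i = block_weight N A i / 2" if i: "i \<in> {1..N}" for i
  proof -
    have "\<nu> i = (\<Sum>j\<in>{1..N}. if (j \<in> A) = (i \<in> A) then sgn (real j - real i) / 2 else 0)"
      by (subst cw[OF i]) (auto simp: class_weight_def same[OF i] simp del: atLeastAtMost_iff intro!: sum.cong)
    also have "\<dots> = block_weight N A i / 2"
      unfolding block_weight_def of_int_sum sum_divide_distrib
      by (rule sum.cong) (auto simp: sgn_if)
    finally show ?thesis .
  qed
  have even_bw: "even (block_weight N A i) \<longleftrightarrow> i \<in> A" if i: "i \<in> {1..N}" for i
  proof
    assume "even (block_weight N A i)"
    then obtain z where "block_weight N A i = 2 * z" by (elim evenE)
    then show "i \<in> A" using bw[OF i] i by (simp add: A_def)
  next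
    assume "i \<in> A"
    then obtain z where "\<nu> i = real_of_int z" by (auto simp: A_def elim: Ints_cases)
    with bw[OF i] have "real_of_int (block_weight N A i) = real_of_int (2 * z)" by simp
    then have "block_weight N A i = 2 * z" by (simp only: of_int_eq_iff)
    then show "even (block_weight N A i)" by simp
  qed
  show "A = {} \<or> odd N"
  proof (cases "A = {}")
    case False
    then obtain i where i: "i \<in> A" by auto
    have "{j \<in> {1..N}. (j \<in> A) = (i \<in> A)} = A" using i AN by auto
    then have oddA: "odd (card A)"
      using block_weight_parity[of i N A] even_bw[of i] i AN by auto
    have evenC: "even (card ({1..N} - A))"
    proof (cases "{1..N} - A = {}")
      case True
      then show ?thesis by (simp only: card.empty) simp
    next
      case False
      then obtain k where k: "k \<in> {1..N}" "k \<notin> A" by blast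
      then have "{j \<in> {1..N}. (j \<in> A) = (k \<in> A)} = {1..N} - A" by auto
      then show ?thesis using block_weight_parity[of k N A] even_bw[of k] k by simp
    qed
    have "card ({1..N} - A) + card A = N"
      using AN card_mono[OF _ AN] by (simp add: card_Diff_subset finite_subset)
    then show ?thesis using oddA evenC by (metis even_add)
  qed simp
qed

section \<open>Generators of the graded Hecke algebra\<close>

definition sym_var :: "nat \<Rightarrow> sympoly" where
  "sym_var i = Poly_Mapping.single (Poly_Mapping.single i 1) 1"

lemma Sym_carrier_zero [simp]: "0 \<in> Sym_carrier N"
  and Sym_carrier_const [simp]: "sym_const c \<in> Sym_carrier N"
  and Sym_carrier_one [simp]: "1 \<in> Sym_carrier N"
  by (auto simp: Sym_carrier_def sym_const_def)

lemma Sym_carrier_single: "Poly_Mapping.keys \<mu> \<subseteq> {1..N} \<Longrightarrow> Poly_Mapping.single \<mu> c \<in> Sym_carrier N"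
  by (simp add: Sym_carrier_def)

lemma Sym_carrier_var [simp]: "i \<in> {1..N} \<Longrightarrow> sym_var i \<in> Sym_carrier N"
  unfolding sym_var_def by (rule Sym_carrier_single) simp

lemma poly_op_sym_var: "i \<in> {1..N} \<Longrightarrow> poly_op N (sym_var i) f = theta_op N i f"
  using poly_op_var[of i N 1 f] by (simp add: sym_var_def)

lemma Sym_carrier_add [simp]: "p \<in> Sym_carrier N \<Longrightarrow> q \<in> Sym_carrier N \<Longrightarrow> p + q \<in> Sym_carrier N"
  using keys_add[of p q] by (auto simp: Sym_carrier_def)

lemma Sym_carrier_mult [simp]: "p \<in> Sym_carrier N \<Longrightarrow> q \<in> Sym_carrier N \<Longrightarrow> p * q \<in> Sym_carrier N"
  unfolding Sym_carrier_def
proof (intro CollectI ballI)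
  fix \<mu>
  assume pq: "p \<in> {p. \<forall>\<mu>\<in>Poly_Mapping.keys p. Poly_Mapping.keys \<mu> \<subseteq> {1..N}}"
    "q \<in> {p. \<forall>\<mu>\<in>Poly_Mapping.keys p. Poly_Mapping.keys \<mu> \<subseteq> {1..N}}"
    and "\<mu> \<in> Poly_Mapping.keys (p * q)"
  then obtain a b where "\<mu> = a + b" "a \<in> Poly_Mapping.keys p" "b \<in> Poly_Mapping.keys q"
    using keys_mult[of p q] by auto
  then show "Poly_Mapping.keys \<mu> \<subseteq> {1..N}"
    using pq keys_add[of a b] by blast
qed

lemma sym_const_one: "sym_const 1 = 1"
  by (simp add: sym_const_def)

lemma sym_const_add: "sym_const (a + b) = sym_const a + sym_const b"
  by (simp add: sym_const_def single_add)

lemma sym_const_mult: "sym_const (a * b) = sym_const a * sym_const b"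
  by (simp add: sym_const_def mult_single)

text \<open>\<open>sym_act\<close> precomposes at two nested levels. For an involution
  precomposition agrees with taking images, and this covers both adjacent transpositions and
  \<open>longest\<close>.\<close>

lemma sym_act_sym_var:
  assumes s: "s \<circ> s = id"
  shows "sym_act s (sym_var i) = sym_var (s i)"
proof -
  have ss: "s (s j) = j" for j using s by (simp add: pointfree_idE)
  have inj: "inj s" by (rule inj_on_inverseI[of _ s]) (rule ss)
  have "Poly_Mapping.map_key s (Poly_Mapping.single i 1) = Poly_Mapping.single (s i) (1::nat)"
    using map_key_single[OF inj, of "s i" 1] by (simp only: ss)
  moreover have "inj (Poly_Mapping.map_key s :: (nat \<Rightarrow>\<^sub>0 nat) \<Rightarrow> _)"
  proof (rule inj_on_inverseI)
    fix x :: "nat \<Rightarrow>\<^sub>0 nat"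
    have "s \<circ> s = (\<lambda>x. x)" by (auto simp: ss)
    then show "Poly_Mapping.map_key s (Poly_Mapping.map_key s x) = x"
      by (simp add: map_key_compose inj map_key_id)
  qed
  moreover have "Poly_Mapping.map_key s (Poly_Mapping.single (s i) 1) = Poly_Mapping.single i (1::nat)"
    using map_key_single[OF inj, of i 1] .
  ultimately show ?thesis
    using map_key_single[of "Poly_Mapping.map_key s" "Poly_Mapping.single (s i) (1 :: nat)" "1 :: complex"]
    by (simp only: sym_act_def sym_var_def)
qed

text \<open>The multiplicative step adds a single variable on the left, because the cross relation
  is usable one variable at a time.\<close>

lemma Sym_induct [consumes 1, case_names const add var]:
  assumes p: "p \<in> Sym_carrier N"
    and const: "\<And>c. P (sym_const c)"
    and add: "\<And>p q. p \<in> Sym_carrier N \<Longrightarrow> q \<in> Sym_carrier N \<Longrightarrow> P p \<Longrightarrow> P q \<Longrightarrow> P (p + q)"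
    and var: "\<And>i p. i \<in> {1..N} \<Longrightarrow> p \<in> Sym_carrier N \<Longrightarrow> P p \<Longrightarrow> P (sym_var i * p)"
  shows "P p"
proof -
  define Q where "Q p \<longleftrightarrow> p \<in> Sym_carrier N \<and> P p" for p
  have mono: "\<forall>p. Q p \<longrightarrow> Q (Poly_Mapping.single \<mu> 1 * p)" if "Poly_Mapping.keys \<mu> \<subseteq> {1..N}" for \<mu>
  proof (induction \<mu> rule: poly_mapping_keys_induct)
    case (1 i)
    have "\<forall>p. Q p \<longrightarrow> Q (Poly_Mapping.single (Poly_Mapping.single i n) 1 * p)" for n
    proof (induction n)
      case (Suc n)
      have "Poly_Mapping.single i (Suc n) = Poly_Mapping.single i 1 + Poly_Mapping.single i n"
        by (simp flip: single_add)
      then have "Poly_Mapping.single (Poly_Mapping.single i (Suc n)) 1 * p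
        = sym_var i * (Poly_Mapping.single (Poly_Mapping.single i n) 1 * p)" for p :: sympoly
        by (simp only: sym_var_def mult_single mult.assoc[symmetric] mult_1)
      moreover have "Q (sym_var i * p)" if "Q p" for p
        using that 1 \<open>Poly_Mapping.keys \<mu> \<subseteq> {1..N}\<close> var[of i p] Sym_carrier_mult[OF Sym_carrier_var]
        unfolding Q_def by blast
      ultimately show ?case using Suc by presburger
    qed simp
    then show ?case .
  next
    case 2
    show ?case by simp
  next
    case (3 x y)
    have "Poly_Mapping.single (x + y) 1 * p = Poly_Mapping.single x 1 * (Poly_Mapping.single y 1 * p)"
      for p :: sympoly by (simp add: mult_single flip: mult.assoc)
    with 3 show ?case by presburger
  qed
  have "Q p"
  proof (rule poly_mapping_keys_induct)
    fix \<mu> assume "\<mu> \<in> Poly_Mapping.keys p"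
    then have "Poly_Mapping.keys \<mu> \<subseteq> {1..N}" using p by (auto simp: Sym_carrier_def)
    from mono[OF this] have "Q (Poly_Mapping.single \<mu> 1 * sym_const (Poly_Mapping.lookup p \<mu>))"
      using const by (simp add: Q_def)
    then show "Q (Poly_Mapping.single \<mu> (Poly_Mapping.lookup p \<mu>))"
      by (simp add: sym_const_def mult_single)
  next
    show "Q 0" using const[of 0] by (simp add: Q_def sym_const_def)
  qed (auto simp: Q_def add)
  then show ?thesis by (simp add: Q_def)
qed

lemma hecke_carrier_zero [simp]: "0 \<in> hecke_carrier N"
  by (simp add: hecke_carrier_def)

lemma hecke_carrier_tens [simp]: "p \<in> Sym_carrier N \<Longrightarrow> w permutes {1..N} \<Longrightarrow> tens p w \<in> hecke_carrier N"
  by (auto simp: hecke_carrier_def tens_def lookup_single when_def)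

lemma hecke_carrier_emb [simp]: "p \<in> Sym_carrier N \<Longrightarrow> emb p \<in> hecke_carrier N"
  by (simp add: emb_def permutes_id)

lemma hecke_carrier_tt [simp]: "w permutes {1..N} \<Longrightarrow> tt w \<in> hecke_carrier N"
  by (simp add: tt_def)

lemma hecke_carrier_add [simp]:
  "h \<in> hecke_carrier N \<Longrightarrow> k \<in> hecke_carrier N \<Longrightarrow> h + k \<in> hecke_carrier N"
  using keys_add[of h k] by (auto simp: hecke_carrier_def lookup_add)

lemma tens_add: "tens (p + q) w = tens p w + tens q w"
  by (simp add: tens_def single_add)

lemma emb_add: "emb (p + q) = emb p + emb q"
  by (simp add: emb_def tens_add)

lemma hscale_tens: "hscale c (tens p w) = tens (sym_const c * p) w"
  by (simp add: hscale_def tens_def)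

lemma hscale_tt_id: "hscale c (tt id) = emb (sym_const c)"
  by (simp add: tt_def emb_def hscale_tens)

lemma emb_one: "emb 1 = tt id"
  by (simp add: emb_def tt_def)

lemma hecke_tens_induct [consumes 1, case_names zero tens add]:
  assumes h: "h \<in> hecke_carrier N"
    and zero: "P 0"
    and tens: "\<And>p w. p \<in> Sym_carrier N \<Longrightarrow> w permutes {1..N} \<Longrightarrow> P (tens p w)"
    and add: "\<And>h k. h \<in> hecke_carrier N \<Longrightarrow> k \<in> hecke_carrier N \<Longrightarrow> P h \<Longrightarrow> P k \<Longrightarrow> P (h + k)"
  shows "P h"
proof -
  have "h \<in> hecke_carrier N \<and> P h"
  proof (rule poly_mapping_keys_induct)
    fix w assume "w \<in> Poly_Mapping.keys h"
    then have w: "w permutes {1..N}" and p: "Poly_Mapping.lookup h w \<in> Sym_carrier N"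
      using h by (auto simp: hecke_carrier_def)
    show "Poly_Mapping.single w (Poly_Mapping.lookup h w) \<in> hecke_carrier N \<and> P (Poly_Mapping.single w (Poly_Mapping.lookup h w))"
      using tens[OF p w] hecke_carrier_tens[OF p w] by (simp add: tens_def)
  qed (auto simp: zero add)
  then show ?thesis ..
qed

text \<open>The number of letters is carried along but need not be minimal. Reduced words and the
  length function can thus be avoided, at the price that a longer word may still spell the
  identity.\<close>

inductive perm_word :: "nat \<Rightarrow> nat \<Rightarrow> (nat \<Rightarrow> nat) \<Rightarrow> bool" for N where
  perm_word_id: "perm_word N 0 id"
| perm_word_step: "perm_word N n w \<Longrightarrow> 1 \<le> k \<Longrightarrow> k < N \<Longrightarrow> perm_word N (Suc n) (transpose k (k + 1) \<circ> w)"

lemma adjacent_permutes: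
  fixes k :: nat
  shows "1 \<le> k \<Longrightarrow> k < N \<Longrightarrow> transpose k (k + 1) permutes {1..N}"
  by (intro permutes_swap_id) auto

lemma perm_word_permutes: "perm_word N n w \<Longrightarrow> w permutes {1..N}"
proof (induction rule: perm_word.induct)
  case perm_word_id
  show ?case by (rule permutes_id)
next
  case (perm_word_step n w k)
  then show ?case by (intro permutes_compose adjacent_permutes)
qed

text \<open>Conjugating the transposition of \<open>a\<close> and \<open>b\<close> by that of
  \<open>b\<close> and \<open>b + 1\<close> gives the one of \<open>a\<close> and
  \<open>b + 1\<close>. The factor \<open>w\<close> is carried along to match the induction over
  products of transpositions.\<close>

lemma perm_word_transpose:
  assumes "1 \<le> a" "a + Suc d \<le> N" "perm_word N n w"
  shows "\<exists>n. perm_word N n (transpose a (a + Suc d) \<circ> w)"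
  using assms(2-3)
proof (induction d arbitrary: n w)
  case 0
  then show ?case using perm_word_step[of N n w a] assms(1) by (intro exI[of _ "Suc n"]) (simp add: comp_def)
next
  case (Suc d)
  define b where "b = a + Suc d"
  have b: "1 \<le> b" "b < N" using Suc.prems assms(1) by (auto simp: b_def)
  have "perm_word N (Suc n) (transpose b (b + 1) \<circ> w)"
    using Suc.prems b by (intro perm_word_step)
  from Suc.IH[OF _ this] Suc.prems(1) obtain m where
    "perm_word N m (transpose a b \<circ> (transpose b (b + 1) \<circ> w))" unfolding b_def by (auto simp: comp_def)
  from perm_word_step[OF this b]
  have "perm_word N (Suc m) (transpose b (b + 1) \<circ> (transpose a b \<circ> (transpose b (b + 1) \<circ> w)))" .
  also have "transpose b (b + 1) \<circ> (transpose a b \<circ> (transpose b (b + 1) \<circ> w)) = transpose a (b + 1) \<circ> w"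
    by (auto simp: fun_eq_iff transpose_def b_def)
  finally show ?case by (auto simp: b_def)
qed

lemma perm_word_exists:
  assumes "w permutes {1..N}"
  shows "\<exists>n. perm_word N n w"
proof -
  have "finite {1..N}" by simp
  from assms this show ?thesis
  proof (induction rule: permutes_induct)
    case id
    show ?case using perm_word_id by blast
  next
    case (swap a b p)
    then obtain n where n: "perm_word N n p" by blast
    consider "a = b" | "a < b" | "b < a" by linarith
    then show ?case
    proof cases
      case 1
      then show ?thesis using n by auto
    next
      case 2
      then obtain d where "b = a + Suc d" by (auto simp: less_iff_Suc_add)
      then show ?thesis using perm_word_transpose[OF _ _ n, of a d] swap(1-3) by (simp add: comp_def)
    next
      case 3
      then obtain d where "a = b + Suc d" by (auto simp: less_iff_Suc_add)
      then show ?thesis using perm_word_transpose[OF _ _ n, of b d] swap(1-3) transpose_commute[of a b] by (simp add: comp_def)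
    qed
  qed
qed

section \<open>Computation rules in the graded Hecke algebra\<close>

context graded_hecke_GL
begin

lemma mul_closed [simp]: "h \<in> hecke_carrier N \<Longrightarrow> k \<in> hecke_carrier N \<Longrightarrow> mul h k \<in> hecke_carrier N"
  using monoid.m_closed[OF ring.is_monoid[OF is_ring]] by (simp add: hecke_ring_def)

lemma mul_assoc: "h \<in> hecke_carrier N \<Longrightarrow> k \<in> hecke_carrier N \<Longrightarrow> l \<in> hecke_carrier N \<Longrightarrow>
    mul (mul h k) l = mul h (mul k l)"
  using monoid.m_assoc[OF ring.is_monoid[OF is_ring]] by (simp add: hecke_ring_def)

lemma one_mul [simp]: "h \<in> hecke_carrier N \<Longrightarrow> mul (tt id) h = h"
  using monoid.l_one[OF ring.is_monoid[OF is_ring]] by (simp add: hecke_ring_def)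

lemma mul_one [simp]: "h \<in> hecke_carrier N \<Longrightarrow> mul h (tt id) = h"
  using monoid.r_one[OF ring.is_monoid[OF is_ring]] by (simp add: hecke_ring_def)

lemma add_mul: "h \<in> hecke_carrier N \<Longrightarrow> k \<in> hecke_carrier N \<Longrightarrow> l \<in> hecke_carrier N \<Longrightarrow>
    mul (h + k) l = mul h l + mul k l"
  using ring.ring_simprules(13)[OF is_ring] by (simp add: hecke_ring_def)

lemma mul_add: "h \<in> hecke_carrier N \<Longrightarrow> k \<in> hecke_carrier N \<Longrightarrow> l \<in> hecke_carrier N \<Longrightarrow>
    mul l (h + k) = mul l h + mul l k"
  using ring.ring_simprules(23)[OF is_ring] by (simp add: hecke_ring_def)

lemma zero_mul [simp]: "h \<in> hecke_carrier N \<Longrightarrow> mul 0 h = 0"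
  using ring.ring_simprules(24)[OF is_ring] by (simp add: hecke_ring_def)

lemma mul_zero [simp]: "h \<in> hecke_carrier N \<Longrightarrow> mul h 0 = 0"
  using ring.ring_simprules(25)[OF is_ring] by (simp add: hecke_ring_def)

lemma hscale_eq_mul: "h \<in> hecke_carrier N \<Longrightarrow> hscale c h = mul (emb (sym_const c)) h"
  using scale_left[of "tt id" h c] by (simp add: hscale_tt_id permutes_id)

lemma hscale_closed [simp]: "h \<in> hecke_carrier N \<Longrightarrow> hscale c h \<in> hecke_carrier N"
  by (simp add: hscale_eq_mul)

lemma mul_const_comm: "h \<in> hecke_carrier N \<Longrightarrow> mul h (emb (sym_const c)) = mul (emb (sym_const c)) h"
  using scale_right[of h "tt id" c] by (simp add: hscale_tt_id permutes_id hscale_eq_mul)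

lemma tens_eq_mul: "p \<in> Sym_carrier N \<Longrightarrow> w permutes {1..N} \<Longrightarrow> tens p w = mul (emb p) (tt w)"
  by (simp add: mul_emb_tt)

lemma mul_emb_tens: "p \<in> Sym_carrier N \<Longrightarrow> q \<in> Sym_carrier N \<Longrightarrow> w permutes {1..N} \<Longrightarrow>
    mul (emb p) (tens q w) = tens (p * q) w"
  by (simp add: tens_eq_mul Sym_subalgebra flip: mul_assoc)

lemma tt_mul_var:
  fixes k :: nat
  defines "s \<equiv> transpose k (k + 1)"
  assumes k: "1 \<le> k" "k < N" and i: "i \<in> {1..N}"
  shows "mul (tt s) (emb (sym_var i)) = mul (emb (sym_var (s i))) (tt s)
     + emb (sym_const (if i = k then 1 else if i = k + 1 then - 1 else 0))"
proof -
  define \<theta> :: "nat \<Rightarrow> int" where "\<theta> j = (if j = i then 1 else 0)" for j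
  have lin: "lin N \<theta> = sym_var i"
  proof -
    have "lin N \<theta> = (\<Sum>j\<in>{1..N}. if j = i then sym_var i else 0)"
      unfolding lin_def sym_var_def by (rule sum.cong) (auto simp: \<theta>_def)
    then show ?thesis using i by simp
  qed
  have act: "sym_act s (sym_var i) = sym_var (s i)"
    by (rule sym_act_sym_var) (auto simp: s_def)
  have "of_int (\<theta> k - \<theta> (k + 1)) = (if i = k then 1 else if i = k + 1 then - 1 else (0 :: complex))"
    by (auto simp: \<theta>_def)
  with cross_relation[OF k, of \<theta>] show ?thesis
    unfolding lin s_def[symmetric] act hscale_tt_id by (simp add: algebra_simps)
qed

end

section \<open>The representation\<close>

text \<open>The polynomial coefficient stands to the left of \<open>t_w\<close> in the underlying
  space, hence the permutation acts first.\<close>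

definition hecke_op :: "nat \<Rightarrow> hecke \<Rightarrow> (nat set \<Rightarrow> complex) \<Rightarrow> nat set \<Rightarrow> complex" where
  "hecke_op N h f = (\<lambda>B. \<Sum>w\<in>Poly_Mapping.keys h. poly_op N (Poly_Mapping.lookup h w) (perm_op w f) B)"

lemma hecke_op_add: "hecke_op N (h + k) f = (\<lambda>B. hecke_op N h f B + hecke_op N k f B)"
  unfolding hecke_op_def
  by (subst setsum_keys_plus_distrib) (auto simp: poly_op_add)

lemma hecke_op_zero [simp]: "hecke_op N 0 f = (\<lambda>B. 0)"
  by (simp add: hecke_op_def)

lemma hecke_op_tens: "hecke_op N (tens p w) f = poly_op N p (perm_op w f)"
  by (cases "p = 0") (simp_all add: hecke_op_def tens_def)

lemma hecke_op_emb: "hecke_op N (emb p) f = poly_op N p f"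
  by (simp add: emb_def hecke_op_tens)

lemma hecke_op_tt: "hecke_op N (tt w) f = perm_op w f"
  by (simp add: tt_def hecke_op_tens)

lemma op_linear_hecke_op: "op_linear (hecke_op N h)"
proof -
  have "op_linear (poly_op N p \<circ> perm_op w)" for p w
    by (intro op_linear_comp op_linear_poly_op op_linear_perm_op)
  from op_linearD[OF this] show ?thesis
    by (simp add: op_linear_def hecke_op_def fun_eq_iff sum.distrib sum_distrib_left)
qed

context graded_hecke_GL
begin

lemma hecke_op_emb_mul:
  assumes "p \<in> Sym_carrier N" "h \<in> hecke_carrier N"
  shows "hecke_op N (mul (emb p) h) f = poly_op N p (hecke_op N h f)"
  using assms(2)
proof (induction rule: hecke_tens_induct)
  case zero
  show ?case using assms(1) op_linear_zero[OF op_linear_poly_op] by auto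
next
  case (tens q w)
  then show ?case using assms(1) by (simp add: mul_emb_tens hecke_op_tens poly_op_mult)
next
  case (add h k)
  then show ?case
    using assms(1) op_linearD(1)[OF op_linear_poly_op] by (simp add: mul_add hecke_op_add)
qed

text \<open>This is the core of multiplicativity: \<open>t_s\<close> is moved past \<open>q\<close>
  one variable at a time, and every correction term of the cross relation is matched by
  \<open>perm_op_theta_op\<close> in the model.\<close>

lemma hecke_op_adjacent_mul_tens:
  fixes k :: nat
  defines "s \<equiv> transpose k (k + 1)"
  assumes k: "1 \<le> k" "k < N" and q: "q \<in> Sym_carrier N" and w: "w permutes {1..N}"
  shows "hecke_op N (mul (tt s) (tens q w)) f = perm_op s (poly_op N q (perm_op w f))"
  using q
proof (induction rule: Sym_induct)
  case (const c)
  have s: "s permutes {1..N}" unfolding s_def using k by (rule adjacent_permutes)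
  have "tens (sym_const c) u = hscale c (tt u)" for u
    by (simp add: tt_def hscale_tens)
  then have "mul (tt s) (tens (sym_const c) w) = tens (sym_const c) (s \<circ> w)"
    using s w by (simp add: scale_right group_subalgebra)
  then show ?case
    by (simp add: hecke_op_tens perm_op_comp[symmetric]) (simp add: perm_op_def)
next
  case (add p q)
  have s: "tt s \<in> hecke_carrier N" unfolding s_def using k by (intro hecke_carrier_tt adjacent_permutes)
  show ?case
    using add s w by (simp add: tens_add mul_add hecke_op_add poly_op_add) (simp add: perm_op_def)
next
  case (var i q)
  have sp: "s permutes {1..N}" unfolding s_def using k by (rule adjacent_permutes)
  then have s: "tt s \<in> hecke_carrier N" by simp
  have si: "s i \<in> {1..N}" using sp var(1) by (simp only: permutes_in_image)
  define c :: complex where "c = (if i = k then 1 else if i = k + 1 then - 1 else 0)"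
  define T where "T = tens q w"
  define g where "g = poly_op N q (perm_op w f)"
  have T: "T \<in> hecke_carrier N" using var w by (simp add: T_def)
  have [simp]: "emb (sym_var i) \<in> hecke_carrier N" "emb (sym_var (s i)) \<in> hecke_carrier N"
    using var(1) si Sym_carrier_var hecke_carrier_emb by blast+
  have "mul (tt s) (tens (sym_var i * q) w) = mul (mul (tt s) (emb (sym_var i))) T"
    using mul_emb_tens[OF Sym_carrier_var[OF var(1)] var(2) w] s T by (simp only: T_def mul_assoc \<open>emb (sym_var i) \<in> hecke_carrier N\<close>)
  also have "\<dots> = mul (emb (sym_var (s i))) (mul (tt s) T) + mul (emb (sym_const c)) T"
    using tt_mul_var[OF k var(1), folded s_def c_def] s T by (simp add: add_mul mul_assoc)
  finally have "hecke_op N (mul (tt s) (tens (sym_var i * q) w)) f B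
      = theta_op N (s i) (perm_op s g) B + c * g B" for B
    using s T si var by (simp add: hecke_op_add hecke_op_emb_mul T_def[symmetric])
      (simp add: T_def hecke_op_tens g_def poly_op_sym_var)
  moreover have "perm_op s (poly_op N (sym_var i * q) (perm_op w f)) B
      = theta_op N (s i) (perm_op s g) B + c * g B" for B
    using perm_op_theta_op[OF k var(1), of g B, folded s_def] poly_op_sym_var[OF var(1)]
    by (simp add: poly_op_mult g_def[symmetric] c_def)
  ultimately show ?case by (simp add: fun_eq_iff)
qed

lemma hecke_op_tt_mul:
  assumes w: "w permutes {1..N}" and h: "h \<in> hecke_carrier N"
  shows "hecke_op N (mul (tt w) h) f = perm_op w (hecke_op N h f)"
proof -
  obtain n where "perm_word N n w" using perm_word_exists[OF w] ..
  then show ?thesis using h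
  proof (induction arbitrary: h)
    case perm_word_id
    then show ?case by (simp only: one_mul perm_op_id)
  next
    case (perm_word_step n w k)
    define s where "s = transpose k (k + 1)"
    have s: "s permutes {1..N}" unfolding s_def using perm_word_step by (intro adjacent_permutes)
    have w: "w permutes {1..N}" using perm_word_step(1) by (rule perm_word_permutes)
    have adj: "hecke_op N (mul (tt s) h) f = perm_op s (hecke_op N h f)" if "h \<in> hecke_carrier N" for h
      using that
    proof (induction rule: hecke_tens_induct)
      case zero
      show ?case using s by (simp add: perm_op_def)
    next
      case (tens p u)
      then show ?case using hecke_op_adjacent_mul_tens[OF perm_word_step(2,3), folded s_def]
        by (simp add: hecke_op_tens)
    next
      case (add h k)
      then show ?case using s by (simp add: mul_add hecke_op_add) (simp add: perm_op_def)
    qed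
    have "mul (tt (s \<circ> w)) h = mul (tt s) (mul (tt w) h)"
      using s w perm_word_step.prems by (simp add: mul_assoc flip: group_subalgebra)
    then show ?case
      using adj perm_word_step w unfolding s_def[symmetric] by (simp add: perm_op_comp comp_def)
  qed
qed

lemma hecke_op_mul:
  assumes "h \<in> hecke_carrier N" "k \<in> hecke_carrier N"
  shows "hecke_op N (mul h k) f = hecke_op N h (hecke_op N k f)"
  using assms(1)
proof (induction rule: hecke_tens_induct)
  case zero
  show ?case using assms(2) by simp
next
  case (tens p w)
  then show ?case using assms(2)
    by (simp add: tens_eq_mul mul_assoc hecke_op_emb_mul hecke_op_tt_mul hecke_op_tt)
next
  case (add h k')
  then show ?case using assms(2) by (simp add: add_mul hecke_op_add)
qed

lemma emb_mult: "p \<in> Sym_carrier N \<Longrightarrow> q \<in> Sym_carrier N \<Longrightarrow> emb (p * q) = mul (emb p) (emb q)"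
  by (simp add: Sym_subalgebra)

text \<open>For invariance under \<open>star\<close> this reduces the work to constants, single
  variables and group elements; closure under products replaces any formula for \<open>star\<close>
  on a general tensor.\<close>

lemma hecke_generator_induct [consumes 1, case_names const var tt add mul]:
  assumes h: "h \<in> hecke_carrier N"
    and const: "\<And>c. P (emb (sym_const c))"
    and var: "\<And>i. i \<in> {1..N} \<Longrightarrow> P (emb (sym_var i))"
    and tt: "\<And>w. w permutes {1..N} \<Longrightarrow> P (tt w)"
    and add: "\<And>h k. h \<in> hecke_carrier N \<Longrightarrow> k \<in> hecke_carrier N \<Longrightarrow> P h \<Longrightarrow> P k \<Longrightarrow> P (h + k)"
    and mul: "\<And>h k. h \<in> hecke_carrier N \<Longrightarrow> k \<in> hecke_carrier N \<Longrightarrow> P h \<Longrightarrow> P k \<Longrightarrow> P (mul h k)"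
  shows "P h"
proof -
  have emb: "P (emb p)" if "p \<in> Sym_carrier N" for p
    using that
  proof (induction rule: Sym_induct)
    case (const c)
    show ?case by (rule assms)
  next
    case (add p q)
    then show ?case using assms(5) by (simp add: emb_add)
  next
    case (var i p)
    then show ?case using mul[of "emb (sym_var i)" "emb p"] assms(3)[of i]
      by (simp only: emb_mult Sym_carrier_var hecke_carrier_emb)
  qed
  show ?thesis using h
  proof (induction rule: hecke_tens_induct)
    case zero
    have "emb (sym_const 0) = 0" by (simp add: emb_def tens_def sym_const_def)
    then show ?case using const[of 0] by simp
  next
    case (tens p w)
    then show ?case using mul[of "emb p" "tt w"] emb tt by (simp add: tens_eq_mul)
  qed (rule add)
qed

lemma tt_longest_tt_longest [simp]: "mul (tt (longest N)) (tt (longest N)) = tt id"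
  using group_subalgebra[OF permutes_longest permutes_longest] by simp

end

section \<open>The anti-involution and the invariance of the inner product\<close>

context graded_hecke_GL_star
begin

lemma star_const: "star (emb (sym_const c)) = emb (sym_const (cnj c))"
proof -
  have id: "tt id \<in> hecke_carrier N" by (intro hecke_carrier_tt permutes_id)
  show ?thesis
    using star_scale[OF id, of c] star_tt[OF permutes_id] by (simp add: hscale_tt_id inv_id)
qed

lemma star_var:
  assumes i: "i \<in> {1..N}"
  shows "star (emb (sym_var i))
    = mul (mul (tt (longest N)) (emb (sym_const (- 1) * sym_var (longest N i)))) (tt (longest N))"
proof -
  have hom: "sym_homogeneous 1 (sym_var i)"
    by (simp add: sym_homogeneous_def sym_var_def)
  have cnj: "sym_cnj (sym_var i) = sym_var i"
    by (simp add: sym_cnj_def sym_var_def)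
  have v: "sym_var (longest N i) \<in> Sym_carrier N" using i by (intro Sym_carrier_var longest_in)
  have w: "tt (longest N) \<in> hecke_carrier N" by (intro hecke_carrier_tt permutes_longest)
  have "star (emb (sym_var i)) = mul (emb (sym_const (- 1)))
      (mul (mul (tt (longest N)) (emb (sym_var (longest N i)))) (tt (longest N)))"
    using star_emb[OF Sym_carrier_var[OF i] hom] v w
    by (simp add: cnj sym_act_sym_var hscale_eq_mul)
  also have "\<dots> = mul (mul (mul (emb (sym_const (- 1))) (tt (longest N))) (emb (sym_var (longest N i)))) (tt (longest N))"
    using v w by (simp add: mul_assoc)
  also have "mul (emb (sym_const (- 1))) (tt (longest N)) = mul (tt (longest N)) (emb (sym_const (- 1)))"
    using w by (simp add: mul_const_comm)
  finally show ?thesis using v w by (simp add: mul_assoc emb_mult)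
qed

text \<open>Both sides respect sums and products, so generators suffice. The vectors are generalised
  because in a product each factor crosses the form with a different pair of vectors.\<close>

lemma ip_hecke_op:
  assumes "h \<in> hecke_carrier N"
  shows "ip N (hecke_op N h f) g = ip N f (hecke_op N (star h) g)"
  using assms
proof (induction arbitrary: f g rule: hecke_generator_induct)
  case (const c)
  show ?case by (simp add: star_const hecke_op_emb ip_scale_left ip_scale_right)
next
  case (var i)
  define b where "b = sym_const (- 1) * sym_var (longest N i)"
  have w: "longest N permutes {1..N}" by (rule permutes_longest)
  have b: "b \<in> Sym_carrier N" unfolding b_def using var by (intro Sym_carrier_mult Sym_carrier_const Sym_carrier_var longest_in)
  have "hecke_op N (star (emb (sym_var i))) g
      = perm_op (longest N) (poly_op N b (perm_op (longest N) g))"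
    unfolding star_var[OF var] b_def[symmetric] using w b
    by (simp add: hecke_op_mul hecke_op_tt hecke_op_emb)
  also have "\<dots> = (\<lambda>B. - perm_op (longest N) (theta_op N (longest N i) (perm_op (longest N) g)) B)"
    using longest_in[OF var]
    by (simp add: b_def poly_op_mult poly_op_sym_var perm_op_def del: longest_in)
  finally show ?case
    using var by (simp add: hecke_op_emb poly_op_sym_var ip_theta_op ip_minus_right)
next
  case (tt w)
  then show ?case by (simp add: star_tt hecke_op_tt ip_perm_op)
next
  case (add h k)
  then show ?case by (simp add: hecke_op_add star_add ip_add_left ip_add_right)
next
  case (mul h k)
  then show ?case by (simp add: hecke_op_mul star_mul star_closed)
qed

end

section \<open>Left ideals containing the annihilator of a weight vector\<close>

text \<open>Both conditions on \<nu> come from the chamber: strict decrease makes the entries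
  distinct, and antisymmetry says that the longest element negates the weight.\<close>

locale weight_rep = graded_hecke_GL_star +
  fixes \<nu> :: "nat \<Rightarrow> real" and u :: "nat set \<Rightarrow> complex"
  assumes inj_weight: "inj_on \<nu> {1..N}"
    and weight_longest: "i \<in> {1..N} \<Longrightarrow> \<nu> (longest N i) = - \<nu> i"
    and weight_vector: "weight_vector N \<nu> u"

text \<open>\<open>J\<close> models the annihilator of the generator of X(\<nu>). Stating its
  properties alone moves the argument from the tensor product to left ideals of the algebra.\<close>

locale weight_ideal = weight_rep +
  fixes J :: "hecke set"
  assumes J_zero: "0 \<in> J"
    and J_carrier: "J \<subseteq> hecke_carrier N"
    and J_add: "h \<in> J \<Longrightarrow> k \<in> J \<Longrightarrow> h + k \<in> J"
    and J_mul: "h \<in> hecke_carrier N \<Longrightarrow> k \<in> J \<Longrightarrow> mul h k \<in> J"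
    and J_weight: "i \<in> {1..N} \<Longrightarrow> emb (sym_var i + sym_const (- \<nu> i)) \<in> J"
    and J_kills: "h \<in> J \<Longrightarrow> B \<subseteq> {1..N} \<Longrightarrow> hecke_op N h u B = 0"
begin

text \<open>A filtration by word length above \<open>J\<close>. With the strict bound on the number
  of letters, layer 0 is \<open>J\<close> and layer 1 is \<open>J\<close> plus the scalars.\<close>

inductive_set fil :: "nat \<Rightarrow> hecke set" for k where
  fil_J: "h \<in> J \<Longrightarrow> h \<in> fil k"
| fil_word: "perm_word N n w \<Longrightarrow> n < k \<Longrightarrow> tens (sym_const c) w \<in> fil k"
| fil_add: "h \<in> fil k \<Longrightarrow> h' \<in> fil k \<Longrightarrow> h + h' \<in> fil k"

lemma fil_carrier: "h \<in> fil k \<Longrightarrow> h \<in> hecke_carrier N"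
  by (induction rule: fil.induct) (use J_carrier perm_word_permutes in auto)

lemma fil_mono: "h \<in> fil k \<Longrightarrow> k \<le> l \<Longrightarrow> h \<in> fil l"
  by (induction rule: fil.induct) (auto intro: fil.intros)

lemma fil_const: "h \<in> fil k \<Longrightarrow> mul (emb (sym_const c)) h \<in> fil k"
proof (induction rule: fil.induct)
  case (fil_J h)
  then show ?case by (intro fil.fil_J J_mul) simp_all
next
  case (fil_word n w c')
  then have "mul (emb (sym_const c)) (tens (sym_const c') w) = tens (sym_const (c * c')) w"
    using perm_word_permutes by (simp add: mul_emb_tens sym_const_mult)
  then show ?case using fil_word by (simp add: fil.fil_word)
next
  case (fil_add h h')
  then show ?case using fil_carrier by (simp add: mul_add fil.fil_add)
qed

lemma tens_const_eq: "w permutes {1..N} \<Longrightarrow> tens (sym_const c) w = mul (emb (sym_const c)) (tt w)"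
  by (simp add: tens_eq_mul)

lemma fil_adjacent:
  fixes j :: nat
  assumes "h \<in> fil k" "1 \<le> j" "j < N"
  shows "mul (tt (transpose j (j + 1))) h \<in> fil (Suc k)"
  using assms(1)
proof (induction rule: fil.induct)
  case (fil_J h)
  then show ?case using assms(2,3) by (intro fil.fil_J J_mul hecke_carrier_tt adjacent_permutes)
next
  case (fil_word n w c)
  define s where "s = transpose j (j + 1)"
  have s: "s permutes {1..N}" unfolding s_def using assms by (intro adjacent_permutes)
  have w: "w permutes {1..N}" using fil_word perm_word_permutes by blast
  have "mul (tt s) (tens (sym_const c) w) = mul (mul (tt s) (emb (sym_const c))) (tt w)"
    using s w by (simp add: tens_const_eq mul_assoc)
  also have "mul (tt s) (emb (sym_const c)) = mul (emb (sym_const c)) (tt s)"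
    using s by (simp add: mul_const_comm)
  also have "mul (mul (emb (sym_const c)) (tt s)) (tt w) = tens (sym_const c) (s \<circ> w)"
    using s w permutes_compose[OF w s] by (simp add: tens_const_eq mul_assoc group_subalgebra)
  finally have "mul (tt s) (tens (sym_const c) w) = tens (sym_const c) (s \<circ> w)" .
  moreover have "tens (sym_const c) (s \<circ> w) \<in> fil (Suc k)"
    unfolding s_def using fil_word assms(2,3)
    by (intro fil.fil_word[of "Suc n"] perm_word_step) simp_all
  ultimately show ?case unfolding s_def[symmetric] by simp
next
  case (fil_add h h')
  moreover have "tt (transpose j (j + 1)) \<in> hecke_carrier N"
    using assms by (intro hecke_carrier_tt adjacent_permutes)
  ultimately show ?case using fil_carrier by (simp add: mul_add fil.fil_add)
qed

text \<open>Triangularity: modulo shorter words, \<open>t_w\<close> spans a line of weight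
  \<open>w \<nu>\<close>. In the induction \<open>t_s\<close> is moved to the left of the linear
  factor, and the constant left by the cross relation multiplies \<open>t_w\<close>, a word with one
  letter less.\<close>

lemma weight_mul_word:
  assumes "perm_word N n w" "i \<in> {1..N}"
  shows "mul (emb (sym_var (w i) + sym_const (- \<nu> i))) (tt w) \<in> fil n"
  using assms(1)
proof (induction rule: perm_word.induct)
  case perm_word_id
  have "emb (sym_var i + sym_const (- \<nu> i)) \<in> hecke_carrier N"
    using assms(2) by (intro hecke_carrier_emb Sym_carrier_add Sym_carrier_var Sym_carrier_const)
  then have "mul (emb (sym_var i + sym_const (- \<nu> i))) (tt id) \<in> fil 0"
    using J_weight[OF assms(2)] fil_J by (simp only: mul_one)
  then show ?case by (simp only: id_def)
next
  case (perm_word_step n w k)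
  define s where "s = transpose k (k + 1)"
  have s: "s permutes {1..N}" unfolding s_def using perm_word_step by (intro adjacent_permutes)
  have w: "w permutes {1..N}" using perm_word_step perm_word_permutes by blast
  have wi: "w i \<in> {1..N}" "s (w i) \<in> {1..N}" using s w assms(2) by (simp_all only: permutes_in_image)
  define d :: complex where "d = (if w i = k then 1 else if w i = k + 1 then - 1 else 0)"
  define e where "e = emb (sym_var (w i) + sym_const (- \<nu> i))"
  have H: "emb (sym_var (w i)) \<in> hecke_carrier N" "emb (sym_var (s (w i))) \<in> hecke_carrier N"
    "tt s \<in> hecke_carrier N" "tt w \<in> hecke_carrier N"
    "emb (sym_const c) \<in> hecke_carrier N" "e \<in> hecke_carrier N" for c
    using s w wi unfolding e_def
    by (blast intro: hecke_carrier_emb hecke_carrier_tt Sym_carrier_var Sym_carrier_add Sym_carrier_const)+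
  have cancel: "emb (sym_const d) + emb (sym_const (- d)) = 0"
    by (simp add: sym_const_def flip: emb_add single_add) (simp add: emb_def tens_def)
  have "mul (emb (sym_var (s (w i)) + sym_const (- \<nu> i))) (tt s)
      = mul (emb (sym_var (s (w i)))) (tt s) + mul (emb (sym_const (- \<nu> i))) (tt s)"
    using H by (simp add: emb_add add_mul)
  also have "\<dots> = (mul (emb (sym_var (s (w i)))) (tt s) + emb (sym_const d))
      + mul (emb (sym_const (- \<nu> i))) (tt s) + emb (sym_const (- d))"
    using cancel by (simp add: algebra_simps)
  also have "mul (emb (sym_var (s (w i)))) (tt s) + emb (sym_const d) = mul (tt s) (emb (sym_var (w i)))"
    using tt_mul_var[OF perm_word_step(2,3) wi(1)] unfolding s_def[symmetric] d_def by simp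
  also have "mul (emb (sym_const (- \<nu> i))) (tt s) = mul (tt s) (emb (sym_const (- \<nu> i)))"
    using H by (simp add: mul_const_comm)
  also have "mul (tt s) (emb (sym_var (w i))) + mul (tt s) (emb (sym_const (- \<nu> i))) = mul (tt s) e"
    using H by (simp add: e_def emb_add mul_add)
  finally have e1: "mul (emb (sym_var (s (w i)) + sym_const (- \<nu> i))) (tt s) = mul (tt s) e + emb (sym_const (- d))" .
  have e2: "emb (sym_var (s (w i)) + sym_const (- \<nu> i)) \<in> hecke_carrier N"
    using wi by (intro hecke_carrier_emb Sym_carrier_add Sym_carrier_var Sym_carrier_const)
  have "mul (emb (sym_var (s (w i)) + sym_const (- \<nu> i))) (tt (s \<circ> w))
      = mul (tt s) (mul e (tt w)) + tens (sym_const (- d)) w"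
  proof -
    have "mul (emb (sym_var (s (w i)) + sym_const (- \<nu> i))) (tt (s \<circ> w))
        = mul (mul (emb (sym_var (s (w i)) + sym_const (- \<nu> i))) (tt s)) (tt w)"
      using e2 H s w by (simp only: mul_assoc group_subalgebra)
    also have "\<dots> = mul (tt s) (mul e (tt w)) + tens (sym_const (- d)) w"
      unfolding e1 using H w by (simp add: add_mul mul_assoc tens_const_eq)
    finally show ?thesis .
  qed
  also have "\<dots> \<in> fil (Suc n)"
    using fil_adjacent[OF perm_word_step.IH[folded e_def] perm_word_step(2,3)] perm_word_step(1)
    unfolding s_def[symmetric]
    by (rule fil_add[OF _ fil_word[OF _ lessI]])
  finally show ?case by (simp add: s_def comp_def)
qed

lemma fil_var:
  assumes "h \<in> fil k" "i \<in> {1..N}"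
  shows "mul (emb (sym_var i)) h \<in> fil k"
  using assms(1)
proof (induction rule: fil.induct)
  case (fil_J h)
  then show ?case using assms(2) by (intro fil.fil_J J_mul hecke_carrier_emb Sym_carrier_var)
next
  case (fil_word n w c)
  have w: "w permutes {1..N}" using fil_word perm_word_permutes by blast
  \<comment> \<open>The preimage of \<open>i\<close> under \<open>w\<close> names the diagonal
    entry: \<open>e_i\<close> acts on \<open>t_w\<close> by \<open>\<nu> i'\<close> up to a lower
    layer.\<close>
  obtain i' where i': "i' \<in> {1..N}" "i = w i'"
    using assms(2) permutes_image[OF w] by blast
  define e where "e = sym_var i + sym_const (- \<nu> i')"
  have e: "e \<in> Sym_carrier N" unfolding e_def using assms(2) by (intro Sym_carrier_add Sym_carrier_var Sym_carrier_const)
  have "sym_const c * e + sym_const (c * \<nu> i') = sym_var i * sym_const c"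
    by (simp add: e_def sym_const_def algebra_simps mult_single flip: single_add)
  then have "mul (emb (sym_var i)) (tens (sym_const c) w)
      = mul (emb (sym_const c)) (mul (emb e) (tt w)) + tens (sym_const (c * \<nu> i')) w"
    using w e assms(2) Sym_carrier_var[OF assms(2)]
    by (simp only: tens_eq_mul[symmetric] mul_emb_tens Sym_carrier_const Sym_carrier_mult tens_add[symmetric])
  moreover have "mul (emb e) (tt w) \<in> fil n"
    unfolding e_def i'(2) using fil_word(1) i'(1) by (rule weight_mul_word)
  ultimately show ?case
    using fil_word by (auto intro!: fil_add fil_const fil.fil_word elim: fil_mono)
next
  case (fil_add h h')
  moreover have "emb (sym_var i) \<in> hecke_carrier N"
    using assms(2) by (intro hecke_carrier_emb Sym_carrier_var)
  ultimately show ?case using fil_carrier by (simp add: mul_add fil.fil_add)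
qed

lemma fil_Sym:
  assumes "p \<in> Sym_carrier N" "h \<in> fil k"
  shows "mul (emb p) h \<in> fil k"
  using assms(1)
proof (induction rule: Sym_induct)
  case (const c)
  show ?case by (rule fil_const[OF assms(2)])
next
  case (add p q)
  then show ?case using fil_carrier[OF assms(2)] by (simp add: emb_add add_mul fil_add)
next
  case (var i p)
  then have "emb (sym_var i) \<in> hecke_carrier N" by (intro hecke_carrier_emb Sym_carrier_var)
  then show ?case using var fil_carrier[OF assms(2)] Sym_carrier_var[OF var(1)]
    by (simp only: emb_mult mul_assoc hecke_carrier_emb fil_var)
qed

lemma fil_exhaust: "h \<in> hecke_carrier N \<Longrightarrow> \<exists>k. h \<in> fil k"
proof (induction rule: hecke_tens_induct)
  case zero
  have "0 = tens (sym_const 0) id" by (simp add: tens_def sym_const_def)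
  then show ?case using fil_word[OF perm_word_id, of 1 0] by auto
next
  case (tens p w)
  obtain n where "perm_word N n w" using perm_word_exists tens by blast
  then have "tt w \<in> fil (Suc n)"
    using fil_word[of n w "Suc n" 1] by (simp add: tt_def sym_const_one)
  then show ?case using fil_Sym tens by (auto simp: tens_eq_mul)
next
  case (add h k)
  then obtain m n where "h \<in> fil m" "k \<in> fil n" by blast
  then have "h \<in> fil (max m n)" "k \<in> fil (max m n)" by (auto elim: fil_mono)
  then show ?case using fil_add by blast
qed

text \<open>The last two conditions say that the adjoint of \<open>a\<close> multiplies
  \<open>t_{w_0} u\<close> by a nonzero scalar. Orthogonality of \<open>a h u\<close> to that vector
  then implies orthogonality of \<open>h u\<close>.\<close>

definition reducing :: "sympoly \<Rightarrow> bool" where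
  "reducing a \<longleftrightarrow> a \<in> Sym_carrier N \<and> (\<exists>b\<in>Sym_carrier N.
     star (emb a) = mul (mul (tt (longest N)) (emb b)) (tt (longest N)) \<and>
     (\<exists>z. z \<noteq> 0 \<and> poly_op N b u = (\<lambda>B. z * u B)))"

lemma reducing_one: "reducing 1"
proof -
  have "star (tt id) = tt id" using star_tt[OF permutes_id] by (simp add: inv_id)
  moreover have "mul (mul (tt (longest N)) (tt id)) (tt (longest N)) = tt id"
    using permutes_longest[of N] by simp
  ultimately show ?thesis
    unfolding reducing_def by (auto simp: emb_one intro!: bexI[of _ 1] exI[of _ 1])
qed

lemma reducing_mult:
  assumes "reducing a" "reducing a'"
  shows "reducing (a * a')"
proof -
  let ?w = "tt (longest N)"
  obtain b z where b: "a \<in> Sym_carrier N" "b \<in> Sym_carrier N" "z \<noteq> 0"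
    "star (emb a) = mul (mul ?w (emb b)) ?w" "poly_op N b u = (\<lambda>B. z * u B)"
    using assms(1) unfolding reducing_def by blast
  obtain b' z' where b': "a' \<in> Sym_carrier N" "b' \<in> Sym_carrier N" "z' \<noteq> 0"
    "star (emb a') = mul (mul ?w (emb b')) ?w" "poly_op N b' u = (\<lambda>B. z' * u B)"
    using assms(2) unfolding reducing_def by blast
  have w: "?w \<in> hecke_carrier N" by (intro hecke_carrier_tt permutes_longest)
  have "star (emb (a * a')) = mul (mul (mul ?w (emb b')) ?w) (mul (mul ?w (emb b)) ?w)"
    using b b' by (simp add: emb_mult star_mul)
  also have "\<dots> = mul (mul ?w (emb b')) (mul (mul ?w ?w) (mul (emb b) ?w))"
    using w b b' by (simp add: mul_assoc del: tt_longest_tt_longest)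
  also have "\<dots> = mul (mul ?w (emb (b' * b))) ?w"
    using w b b' by (simp add: mul_assoc emb_mult)
  finally have "star (emb (a * a')) = mul (mul ?w (emb (b' * b))) ?w" .
  moreover have "poly_op N (b' * b) u = (\<lambda>B. z * z' * u B)"
    using op_linearD(2)[OF op_linear_poly_op, of N b' z u]
    by (intro ext) (simp add: poly_op_mult b(5) b'(5))
  ultimately show ?thesis
    unfolding reducing_def using b b' by (intro conjI bexI[of _ "b' * b"] exI[of _ "z * z'"]) auto
qed

text \<open>The adjoint is the \<open>w_0\<close>-conjugate of \<open>- e_{w_0 i} - \<nu> j\<close>.
  On \<open>u\<close> the latter has the value
  \<open>- \<nu> (w_0 i) - \<nu> j = \<nu> i - \<nu> j\<close>, nonzero because the entries of \<nu>
  are distinct.\<close>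

lemma reducing_linear:
  assumes i: "i \<in> {1..N}" and j: "j \<in> {1..N}" and "i \<noteq> j"
  shows "reducing (sym_var i + sym_const (- \<nu> j))"
proof -
  let ?w = "tt (longest N)"
  define c where "c = complex_of_real (- \<nu> j)"
  define b where "b = sym_const (- 1) * sym_var (longest N i) + sym_const c"
  have w: "?w \<in> hecke_carrier N" by (intro hecke_carrier_tt permutes_longest)
  have v: "sym_var i \<in> Sym_carrier N" "sym_var (longest N i) \<in> Sym_carrier N"
    using i by (blast intro: Sym_carrier_var longest_in)+
  have "mul (mul ?w (emb (sym_const c))) ?w = mul (emb (sym_const c)) (mul ?w ?w)"
    using w by (simp add: mul_const_comm mul_assoc del: tt_longest_tt_longest)
  then have c: "mul (mul ?w (emb (sym_const c))) ?w = emb (sym_const c)"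
    by simp
  have "star (emb (sym_var i + sym_const c)) = mul (mul ?w (emb b)) ?w"
    using w v c unfolding b_def
    by (simp add: emb_add star_add star_var[OF i] mul_add add_mul) (simp add: star_const c_def)
  moreover have "poly_op N b u = (\<lambda>B. complex_of_real (\<nu> i - \<nu> j) * u B)"
  proof -
    have "theta_op N (longest N i) u = (\<lambda>B. complex_of_real (- \<nu> i) * u B)"
      using weight_vector longest_in[OF i] unfolding weight_vector_def weight_longest[OF i, symmetric] by blast
    then show ?thesis
      by (simp add: b_def c_def poly_op_add poly_op_mult poly_op_sym_var[OF longest_in[OF i]] algebra_simps)
  qed
  moreover have "complex_of_real (\<nu> i - \<nu> j) \<noteq> 0"
    using inj_onD[OF inj_weight _ i j] assms(3) by (simp only: of_real_eq_0_iff) auto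
  ultimately show ?thesis
    unfolding reducing_def c_def[symmetric] using v
    by (intro conjI bexI[of _ b] exI[of _ "complex_of_real (\<nu> i - \<nu> j)"]) (auto simp: b_def)
qed

text \<open>A nontrivial \<open>w\<close> moves some \<open>j\<close>, so the linear factor for
  \<open>w j\<close> and \<open>\<nu> j\<close> is reducing and pushes \<open>t_w\<close> down a
  layer. For sums the two polynomials are multiplied: they commute, and layer 1 is stable under
  polynomials.\<close>

lemma fil_reduce: "h \<in> fil k \<Longrightarrow> \<exists>a. reducing a \<and> mul (emb a) h \<in> fil 1"
proof (induction k arbitrary: h)
  case 0
  then have "mul (emb 1) h \<in> fil 1"
    using fil_carrier[OF 0] fil_mono[OF 0] by (simp add: emb_one)
  then show ?case using reducing_one by blast
next
  case (Suc k)
  note IH = Suc.IH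
  have one: "\<exists>a. reducing a \<and> mul (emb a) h \<in> fil 1" if "h \<in> fil 1" for h
    using that fil_carrier[OF that] reducing_one by (intro exI[of _ 1]) (simp add: emb_one)
  from Suc.prems show ?case
  proof (induction rule: fil.induct)
    case (fil_J h)
    show ?case using fil_J by (intro one fil.fil_J)
  next
    case (fil_word n w c)
    show ?case
    proof (cases "w = id")
      \<comment> \<open>Words need not be reduced, so the identity may occur with positive letter
        count; the element is then already a scalar.\<close>
      case True
      then show ?thesis using one fil.fil_word[OF perm_word_id, of 1] by simp
    next
      case False
      have w: "w permutes {1..N}" using fil_word perm_word_permutes by blast
      obtain j where "w j \<noteq> j" using False by (auto simp: fun_eq_iff)
      then have j: "j \<in> {1..N}" "w j \<noteq> j" using w by (meson permutes_not_in)+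
      then have wj: "w j \<in> {1..N}" using w by (simp only: permutes_in_image)
      define a where "a = sym_var (w j) + sym_const (- \<nu> j)"
      have a: "reducing a" "a \<in> Sym_carrier N"
        using reducing_linear[OF wj j(1,2)] unfolding a_def by (auto simp: reducing_def)
      have "mul (emb a) (tens (sym_const c) w) = mul (emb (sym_const c)) (mul (emb a) (tt w))"
        using a w by (simp add: mul_emb_tens mult.commute flip: tens_eq_mul)
      also have "\<dots> \<in> fil k"
        using weight_mul_word[OF fil_word(1) j(1)] fil_word(2)
        unfolding a_def by (intro fil_const) (auto elim: fil_mono)
      finally obtain a' where a': "reducing a'" "mul (emb a') (mul (emb a) (tens (sym_const c) w)) \<in> fil 1"
        using IH by blast
      moreover have "a' \<in> Sym_carrier N" using a' by (simp add: reducing_def)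
      ultimately show ?thesis using a reducing_mult w
        by (intro exI[of _ "a' * a"]) (simp add: emb_mult mul_assoc)
    qed
  next
    case (fil_add h h')
    then obtain a a' where a: "reducing a" "mul (emb a) h \<in> fil 1" "reducing a'" "mul (emb a') h' \<in> fil 1"
      by blast
    have S: "a \<in> Sym_carrier N" "a' \<in> Sym_carrier N" using a by (auto simp: reducing_def)
    have H: "h \<in> hecke_carrier N" "h' \<in> hecke_carrier N" using fil_add fil_carrier by blast+
    have "mul (emb (a * a')) (h + h') = mul (emb a') (mul (emb a) h) + mul (emb a) (mul (emb a') h')"
      using S H by (simp add: mul_add flip: mul_assoc emb_mult) (simp add: mult.commute)
    also have "\<dots> \<in> fil 1" by (rule fil.fil_add[OF fil_Sym[OF S(2) a(2)] fil_Sym[OF S(1) a(4)]])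
    finally show ?case using a reducing_mult by blast
  qed
qed

lemma fil_one: "h \<in> fil 1 \<Longrightarrow> \<exists>c. \<exists>j\<in>J. h = emb (sym_const c) + j"
proof (induction rule: fil.induct)
  case (fil_J h)
  have "emb (sym_const 0) = 0" by (simp add: emb_def tens_def sym_const_def)
  then show ?case using fil_J by (intro exI[of _ 0] bexI[of _ h]) auto
next
  case (fil_word n w c)
  then have "perm_word N 0 w" by simp
  then have "w = id" by (cases rule: perm_word.cases) auto
  then show ?case using J_zero by (intro exI[of _ c] bexI[of _ 0]) (auto simp: emb_def)
next
  case (fil_add h h')
  then obtain c j c' j' where "j \<in> J" "j' \<in> J" "h = emb (sym_const c) + j" "h' = emb (sym_const c') + j'"
    by blast
  then show ?case using J_add
    by (intro exI[of _ "c + c'"] bexI[of _ "j + j'"]) (auto simp: sym_const_add emb_add)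
qed

text \<open>If a multiple of \<open>h\<close> by a reducing polynomial lies in \<open>J\<close>, then the vector of \<open>h\<close> is orthogonal to
  \<open>t\<^bsub>w\<^sub>0\<^esub> u\<close>; this vector generates the same submodule as \<open>u\<close>.\<close>

lemma proper_left_ideal_kills:
  assumes I: "J \<subseteq> I" "I \<subseteq> hecke_carrier N" "tt id \<notin> I"
    and I_add: "\<And>h k. h \<in> I \<Longrightarrow> k \<in> I \<Longrightarrow> h + k \<in> I"
    and I_mul: "\<And>h k. h \<in> hecke_carrier N \<Longrightarrow> k \<in> I \<Longrightarrow> mul h k \<in> I"
    and y: "y \<in> I" and B: "B \<subseteq> {1..N}"
  shows "hecke_op N y u B = 0"
proof -
  let ?w = "tt (longest N)"
  have w: "?w \<in> hecke_carrier N" by (intro hecke_carrier_tt permutes_longest)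
  have orth: "ip N (hecke_op N h u) (perm_op (longest N) u) = 0" if h: "h \<in> I" for h
  proof -
    have hH: "h \<in> hecke_carrier N" using h I by blast
    obtain k where "h \<in> fil k" using fil_exhaust[OF hH] ..
    then obtain a where a: "reducing a" "mul (emb a) h \<in> fil 1" using fil_reduce by blast
    then have aS: "a \<in> Sym_carrier N" by (simp add: reducing_def)
    obtain c j where j: "j \<in> J" "mul (emb a) h = emb (sym_const c) + j"
      using fil_one[OF a(2)] by blast
    have jH: "j \<in> hecke_carrier N" "j \<in> I" using j J_carrier I by auto
    have ah: "emb (sym_const c) + j \<in> I"
      using I_mul[OF _ h, of "emb a"] aS j by simp
    \<comment> \<open>A nonzero scalar part could be isolated and inverted, which would put the unit
      into the left ideal \<open>I\<close>.\<close>
    have "c = 0"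
    proof (rule ccontr)
      assume c: "c \<noteq> 0"
      have "mul (emb (sym_const (1 / c))) (emb (sym_const c) + j) + mul (emb (sym_const (- 1 / c))) j
        = mul (emb (sym_const (1 / c))) (emb (sym_const c)) + mul (emb (sym_const (1 / c)) + emb (sym_const (- 1 / c))) j"
        using jH by (simp add: mul_add add_mul)
      also have "\<dots> = tt id"
        using c jH by (simp add: Sym_subalgebra sym_const_one emb_one flip: sym_const_mult emb_add sym_const_add)
          (simp add: sym_const_def emb_def tens_def jH)
      finally have "tt id \<in> I"
        using I_add[OF I_mul[OF _ ah] I_mul[OF _ jH(2)]]
        by (metis Sym_carrier_const hecke_carrier_emb)
      with I show False by blast
    qed
    then have "mul (emb a) h = j" using j(2) by (simp add: emb_def tens_def sym_const_def)
    then have "hecke_op N (mul (emb a) h) u B = 0" if "B \<subseteq> {1..N}" for B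
      using J_kills j that by simp
    then have "0 = ip N (hecke_op N (mul (emb a) h) u) (perm_op (longest N) u)"
      by (simp add: ip_def)
    also have "\<dots> = ip N (hecke_op N h u) (hecke_op N (star (emb a)) (perm_op (longest N) u))"
      using aS hH by (simp add: hecke_op_mul ip_hecke_op)
    finally have 0: "ip N (hecke_op N h u) (hecke_op N (star (emb a)) (perm_op (longest N) u)) = 0" by simp
    obtain b z where b: "b \<in> Sym_carrier N" "z \<noteq> 0" "star (emb a) = mul (mul ?w (emb b)) ?w"
      "poly_op N b u = (\<lambda>B. z * u B)"
      using a(1) unfolding reducing_def by blast
    have "hecke_op N (star (emb a)) (perm_op (longest N) u) = perm_op (longest N) (\<lambda>B. z * u B)"
      using b w by (simp add: hecke_op_mul hecke_op_tt hecke_op_emb perm_op_comp)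
    also have "\<dots> = (\<lambda>B. z * perm_op (longest N) u B)" by (simp add: perm_op_def)
    finally show ?thesis using 0 b(2) by (simp add: ip_scale_right)
  qed
  have yH: "y \<in> hecke_carrier N" using y I by blast
  \<comment> \<open>With this choice the adjoint of \<open>g\<close> sends \<open>t_{w_0} u\<close>
    to \<open>y u\<close>, so the orthogonality applied to \<open>g y\<close> becomes the vanishing
    of the norm of \<open>y u\<close>.\<close>
  define g where "g = star (mul y ?w)"
  have g: "g \<in> hecke_carrier N" "star g = mul y ?w"
    using yH w by (simp_all add: g_def star_closed star_star)
  have "0 = ip N (hecke_op N (mul g y) u) (perm_op (longest N) u)"
    using orth[OF I_mul[OF g(1) y]] by simp
  also have "\<dots> = ip N (hecke_op N y u) (hecke_op N y u)"
    using g yH w by (simp add: hecke_op_mul ip_hecke_op hecke_op_tt perm_op_comp)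
  finally have "Re (ip N (hecke_op N y u) (hecke_op N y u)) = 0" by simp
  then show ?thesis using B by (simp add: ip_self_eq_0)
qed

end

section \<open>Quotients of modules\<close>

lemma (in left_module) zero_smult [simp]: "x \<in> carrier M \<Longrightarrow> \<zero> \<odot>\<^bsub>M\<^esub> x = \<zero>\<^bsub>M\<^esub>"
  using smult_l_distr[of \<zero> \<zero> x] smult_closed[of \<zero> x]
  by (simp add: M.add.r_cancel_one')

lemma (in left_module) minus_one_smult: "x \<in> carrier M \<Longrightarrow> (\<ominus> \<one>) \<odot>\<^bsub>M\<^esub> x = \<ominus>\<^bsub>M\<^esub> x"
  using smult_l_distr[of "\<ominus> \<one>" \<one> x] smult_closed[of "\<ominus> \<one>" x]
  by (intro M.minus_equality[symmetric]) (simp_all add: smult_one R.l_neg)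

lemma (in left_module) left_submoduleI:
  assumes S: "S \<subseteq> carrier M" "\<zero>\<^bsub>M\<^esub> \<in> S"
    and add: "\<And>x y. x \<in> S \<Longrightarrow> y \<in> S \<Longrightarrow> x \<oplus>\<^bsub>M\<^esub> y \<in> S"
    and smult: "\<And>a x. a \<in> carrier R \<Longrightarrow> x \<in> S \<Longrightarrow> a \<odot>\<^bsub>M\<^esub> x \<in> S"
  shows "submodule S R M"
proof (intro submodule.intro submodule_axioms.intro smult)
  have "\<ominus>\<^bsub>M\<^esub> x \<in> S" if "x \<in> S" for x
  proof -
    have "\<ominus>\<^bsub>M\<^esub> x = (\<ominus> \<one>) \<odot>\<^bsub>M\<^esub> x" using that S by (intro minus_one_smult[symmetric]) auto
    then show ?thesis using that smult[of "\<ominus> \<one>" x] by simp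
  qed
  then show "subgroup S (add_monoid M)"
    using S add by (intro M.add.subgroupI) (auto simp: a_inv_def)
qed

lemma submodule_closed:
  assumes "submodule K R M"
  shows "\<zero>\<^bsub>M\<^esub> \<in> K" "K \<subseteq> carrier M"
    and "x \<in> K \<Longrightarrow> y \<in> K \<Longrightarrow> x \<oplus>\<^bsub>M\<^esub> y \<in> K"
    and "a \<in> carrier R \<Longrightarrow> x \<in> K \<Longrightarrow> a \<odot>\<^bsub>M\<^esub> x \<in> K"
  using submodule.axioms(1)[OF assms] submodule.smult_closed[OF assms]
    subgroup.one_closed[OF submodule.axioms(1)[OF assms]] subgroup.subset[OF submodule.axioms(1)[OF assms]]
    subgroup.m_closed[OF submodule.axioms(1)[OF assms], of x y]
  by auto

text \<open>Additivity in the scalar is required only modulo \<open>K\<close>. The same construction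
  then covers quotients of genuine modules and the tensor product, where the action on the free
  abelian group becomes additive in the scalar only after dividing by the relations.\<close>

locale module_quotient =
  fixes R :: "'r ring" and M :: "('r, 'v) module" and K :: "'v set"
  assumes ring: "ring R" and abelian: "abelian_group M" and sub: "subgroup K (add_monoid M)"
    and smult_closed: "a \<in> carrier R \<Longrightarrow> x \<in> carrier M \<Longrightarrow> a \<odot>\<^bsub>M\<^esub> x \<in> carrier M"
    and smult_stable: "a \<in> carrier R \<Longrightarrow> x \<in> K \<Longrightarrow> a \<odot>\<^bsub>M\<^esub> x \<in> K"
    and smult_r_distr: "a \<in> carrier R \<Longrightarrow> x \<in> carrier M \<Longrightarrow> y \<in> carrier M \<Longrightarrow>
        a \<odot>\<^bsub>M\<^esub> (x \<oplus>\<^bsub>M\<^esub> y) = a \<odot>\<^bsub>M\<^esub> x \<oplus>\<^bsub>M\<^esub> a \<odot>\<^bsub>M\<^esub> y"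
    and smult_l_distr_mod: "a \<in> carrier R \<Longrightarrow> b \<in> carrier R \<Longrightarrow> x \<in> carrier M \<Longrightarrow>
        (a \<oplus>\<^bsub>R\<^esub> b) \<odot>\<^bsub>M\<^esub> x \<ominus>\<^bsub>M\<^esub> (a \<odot>\<^bsub>M\<^esub> x \<oplus>\<^bsub>M\<^esub> b \<odot>\<^bsub>M\<^esub> x) \<in> K"
    and smult_assoc: "a \<in> carrier R \<Longrightarrow> b \<in> carrier R \<Longrightarrow> x \<in> carrier M \<Longrightarrow>
        (a \<otimes>\<^bsub>R\<^esub> b) \<odot>\<^bsub>M\<^esub> x = a \<odot>\<^bsub>M\<^esub> (b \<odot>\<^bsub>M\<^esub> x)"
    and smult_one: "x \<in> carrier M \<Longrightarrow> \<one>\<^bsub>R\<^esub> \<odot>\<^bsub>M\<^esub> x = x"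
begin

interpretation R: ring R by (rule ring)
interpretation abelian_subgroup K M
  by (rule abelian_subgroupI3[OF additive_subgroup.intro[OF sub] abelian])

lemma coset_eq_iff:
  assumes "x \<in> carrier M" "y \<in> carrier M"
  shows "K +>\<^bsub>M\<^esub> x = K +>\<^bsub>M\<^esub> y \<longleftrightarrow> x \<ominus>\<^bsub>M\<^esub> y \<in> K"
proof
  assume "K +>\<^bsub>M\<^esub> x = K +>\<^bsub>M\<^esub> y"
  then have "x \<in> K +>\<^bsub>M\<^esub> y" using a_rcos_self assms by blast
  then obtain k where k: "k \<in> K" "x = k \<oplus>\<^bsub>M\<^esub> y" by (auto simp: a_r_coset_def')
  then have "k \<in> carrier M" using a_subset by blast
  with k assms have "x \<ominus>\<^bsub>M\<^esub> y = k" by (simp add: minus_eq a_assoc r_neg)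
  with k show "x \<ominus>\<^bsub>M\<^esub> y \<in> K" by simp
next
  assume "x \<ominus>\<^bsub>M\<^esub> y \<in> K"
  then have "(x \<ominus>\<^bsub>M\<^esub> y) \<oplus>\<^bsub>M\<^esub> y \<in> K +>\<^bsub>M\<^esub> y"
    using assms a_subset by (intro a_rcosI)
  moreover have "(x \<ominus>\<^bsub>M\<^esub> y) \<oplus>\<^bsub>M\<^esub> y = x" using assms by (simp add: minus_eq a_assoc l_neg)
  ultimately show "K +>\<^bsub>M\<^esub> x = K +>\<^bsub>M\<^esub> y"
    using a_repr_independence[OF _ assms(2) sub] by simp
qed

lemma coset_eq_self_iff: "x \<in> carrier M \<Longrightarrow> K +>\<^bsub>M\<^esub> x = K \<longleftrightarrow> x \<in> K"
  using coset_eq_iff[of x "\<zero>\<^bsub>M\<^esub>"] a_subset by (simp add: minus_eq add.inv_one[folded a_inv_def])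

lemma quot_carrier: "carrier (quot_module M K) = (\<lambda>x. K +>\<^bsub>M\<^esub> x) ` carrier M"
  by (auto simp: quot_module_def A_RCOSETS_def')

lemma quot_zero: "\<zero>\<^bsub>quot_module M K\<^esub> = K"
  by (simp add: quot_module_def)

lemma quot_add: "x \<in> carrier M \<Longrightarrow> y \<in> carrier M \<Longrightarrow>
    (K +>\<^bsub>M\<^esub> x) \<oplus>\<^bsub>quot_module M K\<^esub> (K +>\<^bsub>M\<^esub> y) = K +>\<^bsub>M\<^esub> (x \<oplus>\<^bsub>M\<^esub> y)"
  by (simp add: quot_module_def a_rcos_sum)

text \<open>The quotient action is a union over all representatives; since \<open>K\<close> is
  stable, all cosets in that union coincide.\<close>

lemma quot_smult:
  assumes "a \<in> carrier R" "x \<in> carrier M"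
  shows "a \<odot>\<^bsub>quot_module M K\<^esub> (K +>\<^bsub>M\<^esub> x) = K +>\<^bsub>M\<^esub> (a \<odot>\<^bsub>M\<^esub> x)"
proof -
  have "K +>\<^bsub>M\<^esub> (a \<odot>\<^bsub>M\<^esub> y) = K +>\<^bsub>M\<^esub> (a \<odot>\<^bsub>M\<^esub> x)" if "y \<in> K +>\<^bsub>M\<^esub> x" for y
  proof -
    from that obtain k where k: "k \<in> K" "y = k \<oplus>\<^bsub>M\<^esub> x" by (auto simp: a_r_coset_def')
    then have kM: "k \<in> carrier M" using a_subset by blast
    have c: "a \<odot>\<^bsub>M\<^esub> k \<in> carrier M" "a \<odot>\<^bsub>M\<^esub> x \<in> carrier M" "a \<odot>\<^bsub>M\<^esub> k \<in> K"
      using assms k kM smult_closed smult_stable by auto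
    have "a \<odot>\<^bsub>M\<^esub> y \<ominus>\<^bsub>M\<^esub> a \<odot>\<^bsub>M\<^esub> x = a \<odot>\<^bsub>M\<^esub> k"
      using c k(2) kM assms by (simp add: smult_r_distr minus_eq a_assoc r_neg)
    then show ?thesis
      using c k(2) kM assms by (subst coset_eq_iff) (auto simp: smult_closed)
  qed
  then have "(\<Union>y\<in>K +>\<^bsub>M\<^esub> x. K +>\<^bsub>M\<^esub> (a \<odot>\<^bsub>M\<^esub> y)) = (\<Union>y\<in>K +>\<^bsub>M\<^esub> x. K +>\<^bsub>M\<^esub> (a \<odot>\<^bsub>M\<^esub> x))"
    by (intro SUP_cong refl)
  moreover have "K +>\<^bsub>M\<^esub> x \<noteq> {}" using a_rcos_self[OF assms(2)] by blast
  ultimately show ?thesis by (simp add: quot_module_def)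
qed

lemma left_module_quot: "left_module R (quot_module M K)"
proof (intro left_module.intro left_module_axioms.intro ring)
  have zero: "\<zero>\<^bsub>quot_module M K\<^esub> = K +>\<^bsub>M\<^esub> \<zero>\<^bsub>M\<^esub>"
    using a_subset by (simp add: quot_zero)
  show "abelian_group (quot_module M K)"
  proof (rule abelian_groupI)
    fix C assume "C \<in> carrier (quot_module M K)"
    then obtain x where x: "x \<in> carrier M" "C = K +>\<^bsub>M\<^esub> x" by (auto simp: quot_carrier)
    then have "(K +>\<^bsub>M\<^esub> (\<ominus>\<^bsub>M\<^esub> x)) \<oplus>\<^bsub>quot_module M K\<^esub> C = \<zero>\<^bsub>quot_module M K\<^esub>"
      by (simp add: quot_add zero l_neg)
    then show "\<exists>D\<in>carrier (quot_module M K). D \<oplus>\<^bsub>quot_module M K\<^esub> C = \<zero>\<^bsub>quot_module M K\<^esub>"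
      using x by (auto simp: quot_carrier)
  qed (auto simp: quot_carrier quot_add zero a_ac)
next
  fix a b x assume "a \<in> carrier R" "b \<in> carrier R" "x \<in> carrier (quot_module M K)"
  then obtain x' where x': "a \<in> carrier R" "b \<in> carrier R" "x' \<in> carrier M" "x = K +>\<^bsub>M\<^esub> x'"
    by (auto simp: quot_carrier)
  then show "(a \<oplus>\<^bsub>R\<^esub> b) \<odot>\<^bsub>quot_module M K\<^esub> x
      = a \<odot>\<^bsub>quot_module M K\<^esub> x \<oplus>\<^bsub>quot_module M K\<^esub> b \<odot>\<^bsub>quot_module M K\<^esub> x"
    and "(a \<otimes>\<^bsub>R\<^esub> b) \<odot>\<^bsub>quot_module M K\<^esub> x
      = a \<odot>\<^bsub>quot_module M K\<^esub> (b \<odot>\<^bsub>quot_module M K\<^esub> x)"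
    by (simp_all add: quot_smult quot_add smult_closed coset_eq_iff smult_l_distr_mod smult_assoc)
next
  fix a x y assume "a \<in> carrier R" "x \<in> carrier (quot_module M K)" "y \<in> carrier (quot_module M K)"
  then show "a \<odot>\<^bsub>quot_module M K\<^esub> (x \<oplus>\<^bsub>quot_module M K\<^esub> y)
      = a \<odot>\<^bsub>quot_module M K\<^esub> x \<oplus>\<^bsub>quot_module M K\<^esub> a \<odot>\<^bsub>quot_module M K\<^esub> y"
    by (auto simp: quot_carrier quot_smult quot_add smult_closed smult_r_distr)
qed (auto simp: quot_carrier quot_smult smult_closed smult_one)

lemma submodule_image:
  assumes "submodule S R M"
  shows "submodule ((\<lambda>x. K +>\<^bsub>M\<^esub> x) ` S) R (quot_module M K)"
proof (rule left_module.left_submoduleI[OF left_module_quot])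
  note S = submodule_closed[OF assms]
  have c: "x \<in> carrier M" if "x \<in> S" for x using S that by blast
  show "(\<lambda>x. K +>\<^bsub>M\<^esub> x) ` S \<subseteq> carrier (quot_module M K)"
    using c by (auto simp: quot_carrier)
  show "\<zero>\<^bsub>quot_module M K\<^esub> \<in> (\<lambda>x. K +>\<^bsub>M\<^esub> x) ` S"
    using S(1) a_subset by (intro image_eqI[of _ _ "\<zero>\<^bsub>M\<^esub>"]) (auto simp: quot_zero)
  show "x \<oplus>\<^bsub>quot_module M K\<^esub> y \<in> (\<lambda>x. K +>\<^bsub>M\<^esub> x) ` S"
    if "x \<in> (\<lambda>x. K +>\<^bsub>M\<^esub> x) ` S" "y \<in> (\<lambda>x. K +>\<^bsub>M\<^esub> x) ` S" for x y
    using that S(3) c by (auto simp: quot_add)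
  show "a \<odot>\<^bsub>quot_module M K\<^esub> x \<in> (\<lambda>x. K +>\<^bsub>M\<^esub> x) ` S"
    if "a \<in> carrier R" "x \<in> (\<lambda>x. K +>\<^bsub>M\<^esub> x) ` S" for a x
    using that S(4) c by (auto simp: quot_smult)
qed

end

lemma module_quotientI:
  fixes R :: "'r ring" and M :: "('r, 'v) module"
  assumes "left_module R M" "submodule K R M"
  shows "module_quotient R M K"
proof -
  interpret left_module R M by fact
  note S = submodule_closed[OF assms(2)]
  show ?thesis
  proof (intro module_quotient.intro R.ring_axioms M.abelian_group_axioms
      submodule.axioms(1)[OF assms(2)] smult_closed smult_r_distr smult_assoc1 smult_one S(4))
    fix a b x assume *: "a \<in> carrier R" "b \<in> carrier R" "x \<in> carrier M"
    then have "a \<odot>\<^bsub>M\<^esub> x \<oplus>\<^bsub>M\<^esub> b \<odot>\<^bsub>M\<^esub> x \<in> carrier M" by (simp add: smult_closed)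
    then show "(a \<oplus>\<^bsub>R\<^esub> b) \<odot>\<^bsub>M\<^esub> x \<ominus>\<^bsub>M\<^esub> (a \<odot>\<^bsub>M\<^esub> x \<oplus>\<^bsub>M\<^esub> b \<odot>\<^bsub>M\<^esub> x) \<in> K"
      using * S(1) by (simp add: smult_l_distr M.minus_eq M.r_neg)
  qed
qed

section \<open>Quotients of a cyclic module generated by a weight vector\<close>

lemma hecke_carrier_diff:
  assumes "h \<in> hecke_carrier N" "k \<in> hecke_carrier N"
  shows "h - k \<in> hecke_carrier N"
proof -
  have S: "p - q \<in> Sym_carrier N" if "p \<in> Sym_carrier N" "q \<in> Sym_carrier N" for p q
    using that keys_diff[of p q] unfolding Sym_carrier_def by blast
  have "Poly_Mapping.lookup (h - k) w \<in> Sym_carrier N" for w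
    using assms S by (simp add: hecke_carrier_def lookup_minus)
  then show ?thesis using assms keys_diff[of h k] unfolding hecke_carrier_def by blast
qed

lemma hecke_op_diff: "hecke_op N (h - k) f B = hecke_op N h f B - hecke_op N k f B"
  using fun_cong[OF hecke_op_add[of N "h - k" k f], of B] by simp

lemma carrier_hecke_ring [simp]: "carrier (hecke_ring N mul) = hecke_carrier N"
  and mult_hecke_ring [simp]: "monoid.mult (hecke_ring N mul) = mul"
  and one_hecke_ring [simp]: "\<one>\<^bsub>hecke_ring N mul\<^esub> = tt id"
  and zero_hecke_ring [simp]: "\<zero>\<^bsub>hecke_ring N mul\<^esub> = 0"
  and add_hecke_ring [simp]: "ring.add (hecke_ring N mul) = (+)"
  by (simp_all add: hecke_ring_def)

text \<open>Such a \<open>V\<close> is the quotient of the algebra by \<open>J\<close>, hence its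
  submodules correspond to left ideals containing \<open>J\<close>.\<close>

locale cyclic_weight_module = weight_ideal N mul star \<nu> u J + V: left_module "hecke_ring N mul" V
  for N mul star \<nu> u J and V :: "(hecke, 'v) module" +
  fixes x0 :: 'v
  assumes x0: "x0 \<in> carrier V"
    and cyclic: "x \<in> carrier V \<Longrightarrow> \<exists>h\<in>hecke_carrier N. x = h \<odot>\<^bsub>V\<^esub> x0"
    and annihilator: "h \<in> hecke_carrier N \<Longrightarrow> h \<odot>\<^bsub>V\<^esub> x0 = \<zero>\<^bsub>V\<^esub> \<longleftrightarrow> h \<in> J"
begin

definition ker :: "hecke set" where
  "ker = {h \<in> hecke_carrier N. \<forall>B\<subseteq>{1..N}. hecke_op N h u B = 0}"

definition max_sub :: "'v set" where
  "max_sub = (\<lambda>h. h \<odot>\<^bsub>V\<^esub> x0) ` ker"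

lemma J_subset_ker: "J \<subseteq> ker"
  using J_carrier J_kills by (auto simp: ker_def)

lemma ker_add: "h \<in> ker \<Longrightarrow> k \<in> ker \<Longrightarrow> h + k \<in> ker"
  by (simp add: ker_def hecke_op_add)

lemma ker_iff: "h \<in> hecke_carrier N \<Longrightarrow> h \<in> ker \<longleftrightarrow> Re (ip N (hecke_op N h u) (hecke_op N h u)) = 0"
  by (auto simp: ker_def ip_self_eq_0)

text \<open>The vector of \<open>k\<close> is known to vanish only on subsets of
  \<open>{1..N}\<close>. Moving \<open>h\<close> across the form keeps the argument on those
  subsets, so no locality of the operators has to be checked.\<close>

lemma ker_mul: "h \<in> hecke_carrier N \<Longrightarrow> k \<in> ker \<Longrightarrow> mul h k \<in> ker"
proof -
  assume h: "h \<in> hecke_carrier N" and k: "k \<in> ker"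
  then have kH: "k \<in> hecke_carrier N" and k0: "\<And>B. B \<subseteq> {1..N} \<Longrightarrow> hecke_op N k u B = 0"
    by (auto simp: ker_def)
  have "ip N (hecke_op N (mul h k) u) g = 0" for g
  proof -
    have "ip N (hecke_op N (mul h k) u) g = ip N (hecke_op N k u) (hecke_op N (star h) g)"
      using h kH by (simp add: hecke_op_mul ip_hecke_op)
    also have "\<dots> = 0" using k0 by (simp add: ip_def)
    finally show ?thesis .
  qed
  then show "mul h k \<in> ker" using h kH by (simp add: ker_iff)
qed

lemma one_notin_ker: "tt id \<notin> ker"
  using weight_vector by (auto simp: ker_def weight_vector_def hecke_op_tt)

lemma smult_x0_closed: "h \<in> hecke_carrier N \<Longrightarrow> h \<odot>\<^bsub>V\<^esub> x0 \<in> carrier V"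
  using V.smult_closed x0 by simp

lemma smult_x0_add: "h \<in> hecke_carrier N \<Longrightarrow> k \<in> hecke_carrier N \<Longrightarrow>
    (h + k) \<odot>\<^bsub>V\<^esub> x0 = h \<odot>\<^bsub>V\<^esub> x0 \<oplus>\<^bsub>V\<^esub> k \<odot>\<^bsub>V\<^esub> x0"
  using V.smult_l_distr x0 by simp

lemma smult_x0_diff:
  assumes "h \<in> hecke_carrier N" "k \<in> hecke_carrier N"
  shows "(h - k) \<odot>\<^bsub>V\<^esub> x0 = h \<odot>\<^bsub>V\<^esub> x0 \<ominus>\<^bsub>V\<^esub> k \<odot>\<^bsub>V\<^esub> x0"
proof -
  have c: "(h - k) \<odot>\<^bsub>V\<^esub> x0 \<in> carrier V" "k \<odot>\<^bsub>V\<^esub> x0 \<in> carrier V"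
    using assms by (simp_all add: smult_x0_closed hecke_carrier_diff)
  have "h \<odot>\<^bsub>V\<^esub> x0 = (h - k) \<odot>\<^bsub>V\<^esub> x0 \<oplus>\<^bsub>V\<^esub> k \<odot>\<^bsub>V\<^esub> x0"
    using smult_x0_add[OF hecke_carrier_diff[OF assms] assms(2)] by simp
  then show ?thesis
    using c by (simp add: V.M.minus_eq V.M.a_assoc V.M.r_neg)
qed

lemma smult_x0_mul: "h \<in> hecke_carrier N \<Longrightarrow> k \<in> hecke_carrier N \<Longrightarrow>
    mul h k \<odot>\<^bsub>V\<^esub> x0 = h \<odot>\<^bsub>V\<^esub> (k \<odot>\<^bsub>V\<^esub> x0)"
  using V.smult_assoc1 x0 by simp

lemma smult_x0_mem_max_sub: "h \<in> hecke_carrier N \<Longrightarrow> h \<odot>\<^bsub>V\<^esub> x0 \<in> max_sub \<longleftrightarrow> h \<in> ker"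
proof
  assume h: "h \<in> hecke_carrier N" and "h \<odot>\<^bsub>V\<^esub> x0 \<in> max_sub"
  then obtain k where k: "k \<in> ker" "h \<odot>\<^bsub>V\<^esub> x0 = k \<odot>\<^bsub>V\<^esub> x0" by (auto simp: max_sub_def)
  then have kH: "k \<in> hecke_carrier N" by (simp add: ker_def)
  have "(h - k) \<odot>\<^bsub>V\<^esub> x0 = \<zero>\<^bsub>V\<^esub>"
    using k kH by (simp add: smult_x0_diff h V.M.r_neg V.M.minus_eq smult_x0_closed)
  then have "h - k \<in> ker"
    using annihilator[OF hecke_carrier_diff[OF h kH]] J_subset_ker by blast
  from ker_add[OF this k(1)] show "h \<in> ker" by simp
qed (auto simp: max_sub_def)

lemma submodule_max_sub: "submodule max_sub (hecke_ring N mul) V"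
proof (rule V.left_submoduleI)
  show "max_sub \<subseteq> carrier V" by (auto simp: max_sub_def ker_def smult_x0_closed)
  have "0 \<odot>\<^bsub>V\<^esub> x0 = \<zero>\<^bsub>V\<^esub>" using V.zero_smult[OF x0] by simp
  moreover have "0 \<in> ker" using J_zero J_subset_ker by blast
  ultimately show "\<zero>\<^bsub>V\<^esub> \<in> max_sub" unfolding max_sub_def by (metis imageI)
next
  fix x y assume "x \<in> max_sub" "y \<in> max_sub"
  then obtain h k where hk: "h \<in> ker" "k \<in> ker" "x = h \<odot>\<^bsub>V\<^esub> x0" "y = k \<odot>\<^bsub>V\<^esub> x0"
    by (auto simp: max_sub_def)
  then have "x \<oplus>\<^bsub>V\<^esub> y = (h + k) \<odot>\<^bsub>V\<^esub> x0" by (simp add: smult_x0_add ker_def)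
  then show "x \<oplus>\<^bsub>V\<^esub> y \<in> max_sub" using ker_add hk by (simp add: max_sub_def)
next
  fix a x assume "a \<in> carrier (hecke_ring N mul)" "x \<in> max_sub"
  then obtain h where h: "a \<in> hecke_carrier N" "h \<in> ker" "x = h \<odot>\<^bsub>V\<^esub> x0"
    by (auto simp: max_sub_def)
  then have "a \<odot>\<^bsub>V\<^esub> x = mul a h \<odot>\<^bsub>V\<^esub> x0" by (simp add: smult_x0_mul ker_def)
  then show "a \<odot>\<^bsub>V\<^esub> x \<in> max_sub" using ker_mul h by (simp add: max_sub_def)
qed

text \<open>Pulled back to the algebra, a proper submodule becomes a left ideal that contains
  \<open>J\<close> and misses the unit, so \<open>proper_left_ideal_kills\<close> applies.\<close>

lemma proper_submodule_le:
  assumes K: "submodule K (hecke_ring N mul) V" and ne: "K \<noteq> carrier V"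
  shows "K \<subseteq> max_sub"
proof -
  note S = submodule_closed[OF K]
  define I where "I = {h \<in> hecke_carrier N. h \<odot>\<^bsub>V\<^esub> x0 \<in> K}"
  have "I \<subseteq> ker"
  proof
    fix y assume y: "y \<in> I"
    have one: "tt id \<notin> I"
    proof
      assume "tt id \<in> I"
      then have x0K: "x0 \<in> K" using V.smult_one[OF x0] by (simp add: I_def)
      have "x \<in> K" if "x \<in> carrier V" for x
        using cyclic[OF that] S(4)[OF _ x0K] by auto
      with ne S(2) show False by blast
    qed
    have "J \<subseteq> I"
    proof
      fix h assume "h \<in> J"
      then have "h \<in> hecke_carrier N" "h \<odot>\<^bsub>V\<^esub> x0 = \<zero>\<^bsub>V\<^esub>"
        using J_carrier annihilator by blast+
      then show "h \<in> I" using S(1) by (simp add: I_def)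
    qed
    moreover have "h + k \<in> I" if "h \<in> I" "k \<in> I" for h k
      using that S(3) by (simp add: I_def smult_x0_add)
    moreover have "mul h k \<in> I" if "h \<in> hecke_carrier N" "k \<in> I" for h k
      using that S(4)[of h] by (simp add: I_def smult_x0_mul)
    ultimately have "hecke_op N y u B = 0" if "B \<subseteq> {1..N}" for B
      using one y that by (intro proper_left_ideal_kills[of I]) (auto simp: I_def)
    with y show "y \<in> ker" by (simp add: ker_def I_def)
  qed
  show ?thesis
  proof
    fix x assume x: "x \<in> K"
    then obtain h where h: "h \<in> hecke_carrier N" "x = h \<odot>\<^bsub>V\<^esub> x0" using cyclic S(2) by blast
    with x have "h \<in> I" by (simp add: I_def)
    with \<open>I \<subseteq> ker\<close> h show "x \<in> max_sub" by (auto simp: max_sub_def)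
  qed
qed

lemma x0_notin_max_sub: "x0 \<notin> max_sub"
  using smult_x0_mem_max_sub[of "tt id"] one_notin_ker V.smult_one[OF x0] by (simp add: permutes_id)

section \<open>The irreducible quotient and its form\<close>

abbreviation L where "L \<equiv> quot_module V max_sub"

interpretation Q: module_quotient "hecke_ring N mul" V max_sub
  by (rule module_quotientI[OF V.left_module_axioms submodule_max_sub])

definition proj :: "hecke \<Rightarrow> 'v set" where
  "proj h = max_sub +>\<^bsub>V\<^esub> (h \<odot>\<^bsub>V\<^esub> x0)"

lemma proj_closed: "h \<in> hecke_carrier N \<Longrightarrow> proj h \<in> carrier L"
  by (simp add: proj_def Q.quot_carrier smult_x0_closed)

lemma proj_surj: "C \<in> carrier L \<Longrightarrow> \<exists>h\<in>hecke_carrier N. C = proj h"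
  using cyclic by (fastforce simp: proj_def Q.quot_carrier)

lemma proj_add: "h \<in> hecke_carrier N \<Longrightarrow> k \<in> hecke_carrier N \<Longrightarrow> proj h \<oplus>\<^bsub>L\<^esub> proj k = proj (h + k)"
  by (simp add: proj_def Q.quot_add smult_x0_closed smult_x0_add)

lemma proj_smult: "a \<in> hecke_carrier N \<Longrightarrow> h \<in> hecke_carrier N \<Longrightarrow> a \<odot>\<^bsub>L\<^esub> proj h = proj (mul a h)"
  by (simp add: proj_def Q.quot_smult smult_x0_closed smult_x0_mul)

lemma proj_eq_zero_iff: "h \<in> hecke_carrier N \<Longrightarrow> proj h = \<zero>\<^bsub>L\<^esub> \<longleftrightarrow> h \<in> ker"
  by (simp add: proj_def Q.quot_zero Q.coset_eq_self_iff smult_x0_closed smult_x0_mem_max_sub)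

lemma proj_eq_iff: "h \<in> hecke_carrier N \<Longrightarrow> k \<in> hecke_carrier N \<Longrightarrow> proj h = proj k \<longleftrightarrow> h - k \<in> ker"
  by (simp add: proj_def Q.coset_eq_iff smult_x0_closed smult_x0_mem_max_sub hecke_carrier_diff
      flip: smult_x0_diff)

text \<open>The preimage in \<open>V\<close> of a submodule is everything or lies in
  \<open>max_sub\<close>, because \<open>max_sub\<close> contains every proper submodule.\<close>

lemma irreducible_L: "irreducible_module (hecke_ring N mul) L"
  unfolding irreducible_module_def
proof (intro conjI allI impI)
  show LM: "left_module (hecke_ring N mul) L" by (rule Q.left_module_quot)
  have "proj (tt id) \<noteq> \<zero>\<^bsub>L\<^esub>" "proj (tt id) \<in> carrier L"
    using one_notin_ker by (simp_all add: proj_eq_zero_iff proj_closed permutes_id)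
  then show "carrier L \<noteq> {\<zero>\<^bsub>L\<^esub>}" by blast
next
  fix S assume S: "submodule S (hecke_ring N mul) L"
  note s = submodule_closed[OF S]
  define K where "K = {x \<in> carrier V. max_sub +>\<^bsub>V\<^esub> x \<in> S}"
  have memK: "h \<odot>\<^bsub>V\<^esub> x0 \<in> K \<longleftrightarrow> proj h \<in> S" if "h \<in> hecke_carrier N" for h
    using that by (simp add: K_def proj_def smult_x0_closed)
  have "submodule K (hecke_ring N mul) V"
  proof (rule V.left_submoduleI)
    show "\<zero>\<^bsub>V\<^esub> \<in> K"
      using s(1) submodule_closed(1)[OF submodule_max_sub] Q.coset_eq_self_iff[of "\<zero>\<^bsub>V\<^esub>"]
      by (simp add: K_def Q.quot_zero)
  next
    show "x \<oplus>\<^bsub>V\<^esub> y \<in> K" if "x \<in> K" "y \<in> K" for x y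
      using that s(3) by (auto simp: K_def simp flip: Q.quot_add)
  next
    show "a \<odot>\<^bsub>V\<^esub> x \<in> K" if "a \<in> carrier (hecke_ring N mul)" "x \<in> K" for a x
      using that s(4) V.smult_closed by (auto simp: K_def simp flip: Q.quot_smult)
  qed (auto simp: K_def)
  then consider "K = carrier V" | "K \<subseteq> max_sub" using proper_submodule_le by blast
  then show "S = {\<zero>\<^bsub>L\<^esub>} \<or> S = carrier L"
  proof cases
    case 1
    then have "proj h \<in> S" if "h \<in> hecke_carrier N" for h
      using memK that smult_x0_closed by blast
    then show ?thesis using s(2) proj_surj by blast
  next
    case 2
    have "C = \<zero>\<^bsub>L\<^esub>" if C: "C \<in> S" for C
    proof -
      obtain h where h: "h \<in> hecke_carrier N" "C = proj h" using C s(2) proj_surj by blast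
      then have "h \<odot>\<^bsub>V\<^esub> x0 \<in> max_sub" using memK C 2 by blast
      then show ?thesis using h by (simp add: proj_eq_zero_iff smult_x0_mem_max_sub)
    qed
    then show ?thesis using s(1) by blast
  qed
qed

text \<open>This makes the definite description behind \<open>L_module\<close> evaluate to
  \<open>max_sub\<close>. In the quotient by \<open>K\<close> the image of \<open>max_sub\<close> is
  zero or everything, and the latter would force the generator into \<open>max_sub\<close>.\<close>

lemma unique_max_sub:
  assumes K: "submodule K (hecke_ring N mul) V"
    and irr: "irreducible_module (hecke_ring N mul) (quot_module V K)"
  shows "K = max_sub"
proof -
  interpret P: module_quotient "hecke_ring N mul" V K
    by (rule module_quotientI[OF V.left_module_axioms K])
  note S = submodule_closed[OF K]
  have "K \<noteq> carrier V"
  proof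
    assume "K = carrier V"
    then have "K +>\<^bsub>V\<^esub> x = K" if "x \<in> carrier V" for x
      using P.coset_eq_self_iff that by blast
    then have "carrier (quot_module V K) = (\<lambda>x. K) ` carrier V"
      unfolding P.quot_carrier by (rule image_cong[OF refl])
    also have "\<dots> = {\<zero>\<^bsub>quot_module V K\<^esub>}"
      using x0 by (auto simp: P.quot_zero)
    finally have "carrier (quot_module V K) = {\<zero>\<^bsub>quot_module V K\<^esub>}" .
    with irr show False by (simp add: irreducible_module_def)
  qed
  with K have le: "K \<subseteq> max_sub" by (rule proper_submodule_le)
  have mc: "x \<in> carrier V" if "x \<in> max_sub" for x
    using that submodule_closed(2)[OF submodule_max_sub] by blast
  from irr P.submodule_image[OF submodule_max_sub]
  consider "(\<lambda>x. K +>\<^bsub>V\<^esub> x) ` max_sub = {K}" | "(\<lambda>x. K +>\<^bsub>V\<^esub> x) ` max_sub = carrier (quot_module V K)"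
    by (auto simp: irreducible_module_def P.quot_zero)
  then show ?thesis
  proof cases
    case 1
    have "x \<in> K" if "x \<in> max_sub" for x
    proof -
      have "K +>\<^bsub>V\<^esub> x = K" using 1 that by blast
      then show ?thesis using P.coset_eq_self_iff mc that by blast
    qed
    with le show ?thesis by blast
  next
    case 2
    then have "K +>\<^bsub>V\<^esub> x0 \<in> (\<lambda>x. K +>\<^bsub>V\<^esub> x) ` max_sub" using x0 by (auto simp: P.quot_carrier)
    then obtain x where x: "x \<in> max_sub" "K +>\<^bsub>V\<^esub> x0 = K +>\<^bsub>V\<^esub> x" by blast
    then have "x0 \<ominus>\<^bsub>V\<^esub> x \<in> max_sub" using P.coset_eq_iff[OF x0 mc] le by blast
    then have "(x0 \<ominus>\<^bsub>V\<^esub> x) \<oplus>\<^bsub>V\<^esub> x \<in> max_sub"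
      using submodule_closed(3)[OF submodule_max_sub] x by blast
    then have "x0 \<in> max_sub"
      using x0 mc[OF x(1)] by (simp add: V.M.minus_eq V.M.a_assoc V.M.l_neg)
    with x0_notin_max_sub show ?thesis by blast
  qed
qed

lemma unique_irreducible_quotient_eq: "unique_irreducible_quotient (hecke_ring N mul) V = L"
  unfolding unique_irreducible_quotient_def
  by (subst the_equality[of _ max_sub]) (auto simp: submodule_max_sub irreducible_L unique_max_sub)

interpretation L: left_module "hecke_ring N mul" L by (rule Q.left_module_quot)

lemma cscale_proj: "h \<in> hecke_carrier N \<Longrightarrow> cscale L c (proj h) = proj (mul (emb (sym_const c)) h)"
  by (simp add: cscale_def proj_smult)

text \<open>The filtration has scalar coefficients only and exhausts the algebra, and
  \<open>J\<close> maps to zero; so the images of the finitely many \<open>t_w\<close> span.\<close>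

lemma fin_dim_L: "fin_dim_module L"
proof -
  define B where "B = (\<lambda>w. proj (tt w)) ` {w. w permutes {1..N}}"
  define span where "span = {x \<in> carrier L. \<exists>c. x = (\<Oplus>\<^bsub>L\<^esub>b\<in>B. cscale L (c b) b)}"
  have B: "finite B" "B \<subseteq> carrier L"
    unfolding B_def by (auto simp: finite_permutations intro!: proj_closed)
  have cs: "cscale L c b \<in> carrier L" if "b \<in> carrier L" for c b
    using that L.smult_closed by (simp add: cscale_def)
  have cadd: "cscale L (c + d) b = cscale L c b \<oplus>\<^bsub>L\<^esub> cscale L d b" if "b \<in> carrier L" for c d b
    using that L.smult_l_distr[of "emb (sym_const c)" "emb (sym_const d)" b]
    by (simp add: cscale_def sym_const_add emb_add)
  have c0: "cscale L 0 b = \<zero>\<^bsub>L\<^esub>" if "b \<in> carrier L" for b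
    using that L.zero_smult by (simp add: cscale_def sym_const_def emb_def tens_def)
  have single: "cscale L c b \<in> span" if "b \<in> B" for c b
  proof -
    have "(\<Oplus>\<^bsub>L\<^esub>b'\<in>B. cscale L (if b = b' then c else 0) b')
        = (\<Oplus>\<^bsub>L\<^esub>b'\<in>B. if b = b' then cscale L c b' else \<zero>\<^bsub>L\<^esub>)"
      using B cs c0 by (intro L.M.finsum_cong') auto
    also have "\<dots> = cscale L c b"
      using B cs that by (intro L.M.add.finprod_singleton) auto
    finally show ?thesis
      unfolding span_def using that B cs by (auto intro!: exI[of _ "\<lambda>b'. if b = b' then c else 0"])
  qed
  have add: "x \<oplus>\<^bsub>L\<^esub> y \<in> span" if x: "x \<in> span" and y: "y \<in> span" for x y
  proof -
    obtain c d where c: "x = (\<Oplus>\<^bsub>L\<^esub>b\<in>B. cscale L (c b) b)" and d: "y = (\<Oplus>\<^bsub>L\<^esub>b\<in>B. cscale L (d b) b)"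
      using x y by (auto simp: span_def)
    have "x \<oplus>\<^bsub>L\<^esub> y = (\<Oplus>\<^bsub>L\<^esub>b\<in>B. cscale L (c b) b \<oplus>\<^bsub>L\<^esub> cscale L (d b) b)"
      unfolding c d using B cs by (intro L.M.finsum_addf[symmetric]) auto
    also have "\<dots> = (\<Oplus>\<^bsub>L\<^esub>b\<in>B. cscale L (c b + d b) b)"
      using B cs cadd by (intro L.M.finsum_cong') auto
    finally have "x \<oplus>\<^bsub>L\<^esub> y = (\<Oplus>\<^bsub>L\<^esub>b\<in>B. cscale L (c b + d b) b)" .
    moreover have "x \<oplus>\<^bsub>L\<^esub> y \<in> carrier L"
      using x y unfolding span_def by (intro L.M.add.m_closed) blast+
    ultimately show ?thesis
      unfolding span_def by (intro CollectI conjI exI[of _ "\<lambda>b. c b + d b"])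
  qed
  have "proj h \<in> span" if "h \<in> fil k" for h k
    using that
  proof (induction rule: fil.induct)
    case (fil_J h)
    then have "proj h = \<zero>\<^bsub>L\<^esub>" using J_subset_ker J_carrier by (subst proj_eq_zero_iff) auto
    also have "\<dots> = cscale L 0 (proj (tt id))"
      by (intro c0[symmetric] proj_closed hecke_carrier_tt permutes_id)
    also have "\<dots> \<in> span" by (intro single) (auto simp: B_def permutes_id)
    finally show ?case .
  next
    case (fil_word n w c)
    then have w: "w permutes {1..N}" using perm_word_permutes by blast
    then have "proj (tens (sym_const c) w) = cscale L c (proj (tt w))"
      by (simp add: cscale_proj tens_const_eq)
    also have "\<dots> \<in> span" using w by (intro single) (auto simp: B_def)
    finally show ?case .
  next
    case (fil_add h h')
    then show ?case using add fil_carrier by (simp flip: proj_add)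
  qed
  then have "x \<in> span" if "x \<in> carrier L" for x
    using proj_surj[OF that] fil_exhaust by blast
  then show ?thesis
    unfolding fin_dim_module_def using B by (intro exI[of _ B]) (auto simp: span_def)
qed

lemma unitary_L: "unitary_module N mul star L"
proof -
  \<comment> \<open>Two preimages of a class differ by an element of \<open>ker\<close>, whose
    effect on \<open>u\<close> vanishes wherever \<open>ip\<close> looks; the choice therefore does
    not affect the form.\<close>
  define rep where "rep C = (SOME h. h \<in> hecke_carrier N \<and> C = proj h)" for C
  define form where "form C D = ip N (hecke_op N (rep C) u) (hecke_op N (rep D) u)" for C D
  have rep: "hecke_op N (rep (proj h)) u B = hecke_op N h u B"
    if h: "h \<in> hecke_carrier N" and B: "B \<subseteq> {1..N}" for h B
  proof -
    have "rep (proj h) \<in> hecke_carrier N \<and> proj h = proj (rep (proj h))"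
      unfolding rep_def by (rule someI[of _ h]) (simp add: h)
    then have "h - rep (proj h) \<in> ker" using h proj_eq_iff by blast
    then have "hecke_op N (h - rep (proj h)) u B = 0" using B by (simp add: ker_def)
    then show ?thesis by (simp add: hecke_op_diff)
  qed
  have form: "form (proj h) (proj k) = ip N (hecke_op N h u) (hecke_op N k u)"
    if "h \<in> hecke_carrier N" "k \<in> hecke_carrier N" for h k
    unfolding form_def using rep that by (intro ip_cong)
  have herm: "pos_def_hermitian_form L form"
    unfolding pos_def_hermitian_form_def
  proof (intro conjI ballI allI impI)
    fix x y z assume "x \<in> carrier L" "y \<in> carrier L" "z \<in> carrier L"
    then obtain h k l where "h \<in> hecke_carrier N" "k \<in> hecke_carrier N" "l \<in> hecke_carrier N"
      "x = proj h" "y = proj k" "z = proj l" by (metis proj_surj)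
    then show "form (x \<oplus>\<^bsub>L\<^esub> y) z = form x z + form y z"
      by (simp add: proj_add form hecke_op_add ip_add_left)
  next
    fix c x y assume "x \<in> carrier L" "y \<in> carrier L"
    then obtain h k where "h \<in> hecke_carrier N" "k \<in> hecke_carrier N" "x = proj h" "y = proj k"
      by (metis proj_surj)
    then show "form (cscale L c x) y = c * form x y" and "form y x = cnj (form x y)"
      by (simp_all add: cscale_proj form hecke_op_emb_mul ip_scale_left) (rule ip_cnj)
  next
    fix x assume "x \<in> carrier L" and nz: "x \<noteq> \<zero>\<^bsub>L\<^esub>"
    then obtain h where h: "h \<in> hecke_carrier N" "x = proj h" by (metis proj_surj)
    then have "Re (form x x) \<noteq> 0" using nz by (simp add: form proj_eq_zero_iff ker_iff)
    moreover have "Re (form x x) \<ge> 0" using h by (simp add: form ip_self_nonneg)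
    ultimately show "0 < Re (form x x)" by simp
  qed
  have "form (a \<odot>\<^bsub>L\<^esub> x) y = form x (star a \<odot>\<^bsub>L\<^esub> y)"
    if a: "a \<in> hecke_carrier N" and xy: "x \<in> carrier L" "y \<in> carrier L" for a x y
  proof -
    obtain h k where "h \<in> hecke_carrier N" "k \<in> hecke_carrier N" "x = proj h" "y = proj k"
      using xy by (metis proj_surj)
    then show ?thesis using a by (simp add: proj_smult form star_closed hecke_op_mul ip_hecke_op)
  qed
  with herm show ?thesis
    unfolding unitary_module_def using fin_dim_L Q.left_module_quot by blast
qed

end

section \<open>The principal series module\<close>

lemma theta_op_funpow_weight:
  assumes "weight_vector N \<nu> u" "i \<in> {1..N}"
  shows "(theta_op N i ^^ n) (\<lambda>B. c * u B) = (\<lambda>B. complex_of_real (\<nu> i) ^ n * c * u B)"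
proof (induction n)
  case (Suc n)
  have "theta_op N i u = (\<lambda>B. complex_of_real (\<nu> i) * u B)"
    using assms by (simp add: weight_vector_def)
  then have "theta_op N i (\<lambda>B. d * u B) = (\<lambda>B. d * (complex_of_real (\<nu> i) * u B))" for d
    using op_linearD(2)[OF op_linear_theta_op, of N i d u] by (intro ext) simp
  from this[of "complex_of_real (\<nu> i) ^ n * c"] show ?case using Suc by (simp add: algebra_simps)
qed simp

lemma mon_op_weight:
  assumes "weight_vector N \<nu> u" "set xs \<subseteq> {1..N}"
  shows "mon_op xs N \<mu> u = (\<lambda>B. (\<Prod>i\<leftarrow>xs. complex_of_real (\<nu> i) ^ Poly_Mapping.lookup \<mu> i) * u B)"
  using assms(2)
proof (induction xs)
  case (Cons i xs)
  then show ?case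
    using theta_op_funpow_weight[OF assms(1), of i "Poly_Mapping.lookup \<mu> i"
        "\<Prod>i\<leftarrow>xs. complex_of_real (\<nu> i) ^ Poly_Mapping.lookup \<mu> i"]
    by (simp add: mon_op_Cons)
qed (simp add: mon_op_Nil)

lemma poly_op_weight:
  assumes "weight_vector N \<nu> u" "p \<in> Sym_carrier N"
  shows "poly_op N p u = (\<lambda>B. sym_eval \<nu> p * u B)"
proof -
  have "(\<Prod>i\<leftarrow>[1..<Suc N]. complex_of_real (\<nu> i) ^ Poly_Mapping.lookup \<mu> i)
      = (\<Prod>i\<in>Poly_Mapping.keys \<mu>. complex_of_real (\<nu> i) ^ Poly_Mapping.lookup \<mu> i)"
    if "\<mu> \<in> Poly_Mapping.keys p" for \<mu>
  proof -
    have "Poly_Mapping.keys \<mu> \<subseteq> {1..N}" using assms(2) that by (auto simp: Sym_carrier_def)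
    moreover have "(\<Prod>i\<leftarrow>[1..<Suc N]. complex_of_real (\<nu> i) ^ Poly_Mapping.lookup \<mu> i)
        = (\<Prod>i\<in>{1..N}. complex_of_real (\<nu> i) ^ Poly_Mapping.lookup \<mu> i)"
      by (subst prod.distinct_set_conv_list[symmetric]) (auto simp: atLeastLessThanSuc_atLeastAtMost simp del: upt_Suc)
    ultimately show ?thesis
      by (auto intro!: prod.mono_neutral_cong_right simp: in_keys_iff)
  qed
  moreover have "set [1..<Suc N] \<subseteq> {1..N}" by auto
  ultimately show ?thesis
    unfolding poly_op_def sym_eval_def sum_distrib_right
    by (intro ext sum.cong refl) (simp add: mon_op_weight[OF assms(1)] mult_ac del: upt_Suc)
qed

text \<open>Values of \<open>sym_eval\<close> are read off from the eigenvalue on \<open>u\<close>,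
  which replaces calculations with supports of polynomials.\<close>

lemma sym_eval_eqI:
  assumes "weight_vector N \<nu> u" "p \<in> Sym_carrier N" "poly_op N p u = (\<lambda>B. z * u B)"
  shows "sym_eval \<nu> p = z"
proof -
  obtain B where "u B \<noteq> 0" using assms(1) by (auto simp: weight_vector_def)
  moreover have "sym_eval \<nu> p * u B = z * u B"
    using poly_op_weight[OF assms(1,2)] assms(3) by (metis (no_types))
  ultimately show ?thesis by simp
qed

section \<open>The tensor product by generators and relations\<close>

context weight_rep
begin

definition free_mod :: "(hecke, (hecke \<times> complex) \<Rightarrow>\<^sub>0 int) module" where
  "free_mod = tensor_free (hecke_ring N mul) (C_module \<nu>)"

definition rels :: "((hecke \<times> complex) \<Rightarrow>\<^sub>0 int) set" where
  "rels = tensor_rels (Sym_ring N) (hecke_ring N mul) emb (C_module \<nu>)"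

lemma X_module_eq: "X_module N mul \<nu> = quot_module free_mod rels"
  by (simp add: X_module_def tensor_module_def free_mod_def rels_def)

lemma free_carrier: "c \<in> carrier free_mod \<longleftrightarrow> Poly_Mapping.keys c \<subseteq> hecke_carrier N \<times> UNIV"
  by (simp add: free_mod_def tensor_free_def C_module_def)

lemma free_add [simp]: "x \<oplus>\<^bsub>free_mod\<^esub> y = x + y"
  and free_zero [simp]: "\<zero>\<^bsub>free_mod\<^esub> = 0"
  by (simp_all add: free_mod_def tensor_free_def)

lemma free_smult: "r \<odot>\<^bsub>free_mod\<^esub> c = frag_extend (\<lambda>(h, z). frag_of (mul r h, z)) c"
  by (simp add: free_mod_def tensor_free_def)

lemma free_smult_frag_of [simp]: "r \<odot>\<^bsub>free_mod\<^esub> frag_of (h, z) = frag_of (mul r h, z)"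
  by (simp add: free_smult)

lemma free_smult_add: "r \<odot>\<^bsub>free_mod\<^esub> (c + d) = r \<odot>\<^bsub>free_mod\<^esub> c + r \<odot>\<^bsub>free_mod\<^esub> d"
  and free_smult_diff: "r \<odot>\<^bsub>free_mod\<^esub> (c - d) = r \<odot>\<^bsub>free_mod\<^esub> c - r \<odot>\<^bsub>free_mod\<^esub> d"
  and free_smult_minus: "r \<odot>\<^bsub>free_mod\<^esub> (- c) = - (r \<odot>\<^bsub>free_mod\<^esub> c)"
  and free_smult_zero [simp]: "r \<odot>\<^bsub>free_mod\<^esub> 0 = 0"
  by (simp_all add: free_smult frag_extend_add frag_extend_diff frag_extend_minus)

lemma abelian_group_free: "abelian_group free_mod"
proof (rule abelian_groupI)
  fix x assume "x \<in> carrier free_mod"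
  then show "\<exists>y\<in>carrier free_mod. y \<oplus>\<^bsub>free_mod\<^esub> x = \<zero>\<^bsub>free_mod\<^esub>"
    by (intro bexI[of _ "- x"]) (simp_all add: free_carrier)
qed (use keys_add in \<open>fastforce simp: free_carrier\<close>)+

lemma free_minus: "x \<in> carrier free_mod \<Longrightarrow> y \<in> carrier free_mod \<Longrightarrow> x \<ominus>\<^bsub>free_mod\<^esub> y = x - y"
proof -
  assume "x \<in> carrier free_mod" "y \<in> carrier free_mod"
  moreover have "\<ominus>\<^bsub>free_mod\<^esub> y = - y"
    using calculation by (intro abelian_group.minus_equality[OF abelian_group_free]) (simp_all add: free_carrier)
  ultimately show ?thesis by (simp add: a_minus_def)
qed

lemma free_induct [consumes 1, case_names zero diff one]:
  assumes "c \<in> carrier free_mod" "P 0"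
    and "\<And>x y. x \<in> carrier free_mod \<Longrightarrow> y \<in> carrier free_mod \<Longrightarrow> P x \<Longrightarrow> P y \<Longrightarrow> P (x - y)"
    and "\<And>h z. h \<in> hecke_carrier N \<Longrightarrow> P (frag_of (h, z))"
  shows "P c"
  by (rule free_Abelian_group_induct[of c "hecke_carrier N \<times> UNIV"])
    (use assms in \<open>auto simp: free_carrier\<close>)

lemma rels_subgroup: "subgroup rels (free_Abelian_group (hecke_carrier N \<times> UNIV))"
proof -
  have c: "frag_of (h, z) \<in> carrier (free_Abelian_group (hecke_carrier N \<times> UNIV))" if "h \<in> hecke_carrier N" for h and z :: complex
    using that by simp
  have d: "x - y \<in> carrier (free_Abelian_group S)"
    if "x \<in> carrier (free_Abelian_group S)" "y \<in> carrier (free_Abelian_group S)" for x y :: "(hecke \<times> complex) \<Rightarrow>\<^sub>0 int" and S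
    using that keys_diff[of x y] by (simp only: carrier_free_Abelian_group_iff) blast
  show ?thesis
    unfolding rels_def tensor_rels_def
    by (simp only: carrier_hecke_ring C_module_def partial_object.simps)
      (intro group.generate_is_subgroup group_free_Abelian_group; auto simp: Sym_ring_def simp del: carrier_free_Abelian_group_iff intro!: c d)
qed

lemma rels_zero: "0 \<in> rels"
  and rels_add: "x \<in> rels \<Longrightarrow> y \<in> rels \<Longrightarrow> x + y \<in> rels"
  and rels_carrier: "x \<in> rels \<Longrightarrow> x \<in> carrier free_mod"
  and rels_minus: "x \<in> rels \<Longrightarrow> - x \<in> rels"
proof -
  note G = rels_subgroup
  show "0 \<in> rels" using subgroup.one_closed[OF G] by simp
  show "x + y \<in> rels" if "x \<in> rels" "y \<in> rels" using subgroup.m_closed[OF G that] by simp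
  show *: "x \<in> carrier free_mod" if "x \<in> rels" for x
    using subsetD[OF subgroup.subset[OF G] that] by (simp only: free_carrier carrier_free_Abelian_group_iff)
  show "- x \<in> rels" if "x \<in> rels"
    using subgroup.m_inv_closed[OF G that] *[OF that] by (simp add: free_carrier)
qed

lemma rels_diff: "x \<in> rels \<Longrightarrow> y \<in> rels \<Longrightarrow> x - y \<in> rels"
  using rels_add[OF _ rels_minus, of x y] by simp

lemma rels_left: "h \<in> hecke_carrier N \<Longrightarrow> k \<in> hecke_carrier N \<Longrightarrow>
    frag_of (h + k, z) - frag_of (h, z) - frag_of (k, z) \<in> rels"
  and rels_right: "h \<in> hecke_carrier N \<Longrightarrow>
    frag_of (h, z + z') - frag_of (h, z) - frag_of (h, z') \<in> rels"
  and rels_balanced: "h \<in> hecke_carrier N \<Longrightarrow> p \<in> Sym_carrier N \<Longrightarrow>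
    frag_of (mul h (emb p), z) - frag_of (h, sym_eval \<nu> p * z) \<in> rels"
  unfolding rels_def tensor_rels_def
  by (rule generate.incl; force simp: C_module_def Sym_ring_def)+

lemma rels_induct [consumes 1, case_names zero left right balanced minus add]:
  assumes c: "c \<in> rels" and zero: "P 0"
    and left: "\<And>h k z. h \<in> hecke_carrier N \<Longrightarrow> k \<in> hecke_carrier N \<Longrightarrow>
      P (frag_of (h + k, z) - frag_of (h, z) - frag_of (k, z))"
    and right: "\<And>h z z'. h \<in> hecke_carrier N \<Longrightarrow> P (frag_of (h, z + z') - frag_of (h, z) - frag_of (h, z'))"
    and balanced: "\<And>h p z. h \<in> hecke_carrier N \<Longrightarrow> p \<in> Sym_carrier N \<Longrightarrow>
      P (frag_of (mul h (emb p), z) - frag_of (h, sym_eval \<nu> p * z))"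
    and minus: "\<And>x. x \<in> rels \<Longrightarrow> P x \<Longrightarrow> P (- x)"
    and add: "\<And>x y. x \<in> rels \<Longrightarrow> y \<in> rels \<Longrightarrow> P x \<Longrightarrow> P y \<Longrightarrow> P (x + y)"
  shows "P c"
proof -
  define G where "G = {frag_of (h \<oplus>\<^bsub>hecke_ring N mul\<^esub> k, v) - frag_of (h, v) - frag_of (k, v) | h k v.
           h \<in> carrier (hecke_ring N mul) \<and> k \<in> carrier (hecke_ring N mul) \<and> v \<in> carrier (C_module \<nu>)} \<union>
        {frag_of (h, v \<oplus>\<^bsub>C_module \<nu>\<^esub> w) - frag_of (h, v) - frag_of (h, w) | h v w.
           h \<in> carrier (hecke_ring N mul) \<and> v \<in> carrier (C_module \<nu>) \<and> w \<in> carrier (C_module \<nu>)} \<union>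
        {frag_of (h \<otimes>\<^bsub>hecke_ring N mul\<^esub> emb a, v) - frag_of (h, a \<odot>\<^bsub>C_module \<nu>\<^esub> v) | h a v.
           h \<in> carrier (hecke_ring N mul) \<and> a \<in> carrier (Sym_ring N) \<and> v \<in> carrier (C_module \<nu>)}"
  have rels: "rels = generate (free_Abelian_group (carrier (hecke_ring N mul) \<times> carrier (C_module \<nu>))) G"
    unfolding rels_def tensor_rels_def G_def ..
  have gen: "P x \<and> x \<in> rels" if "x \<in> G" for x
  proof
    show "P x"
      using that left right balanced unfolding G_def by (auto simp: C_module_def Sym_ring_def)
    show "x \<in> rels" unfolding rels using that by (rule generate.incl)
  qed
  have inv: "inv\<^bsub>free_Abelian_group (carrier (hecke_ring N mul) \<times> carrier (C_module \<nu>))\<^esub> x = - x" if "x \<in> rels" for x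
    using rels_carrier[OF that] by (intro inv_free_Abelian_group) (simp add: free_carrier C_module_def)
  have "P c \<and> c \<in> rels"
    using c[unfolded rels]
  proof (induction rule: generate.induct)
    case one
    show ?case using zero rels_zero by simp
  next
    case (incl x)
    then show ?case by (rule gen)
  next
    case (inv x)
    then show ?case using gen[OF inv] \<open>\<And>x. x \<in> rels \<Longrightarrow> inv\<^bsub>_\<^esub> x = - x\<close> minus rels_minus by simp
  next
    case (eng x y)
    then show ?case using add rels_add by simp
  qed
  then show ?thesis ..
qed

lemma free_diff_closed: "x \<in> carrier free_mod \<Longrightarrow> y \<in> carrier free_mod \<Longrightarrow> x - y \<in> carrier free_mod"
  using keys_diff[of x y] by (auto simp: free_carrier)

lemma free_add_closed: "x \<in> carrier free_mod \<Longrightarrow> y \<in> carrier free_mod \<Longrightarrow> x + y \<in> carrier free_mod"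
  using keys_add[of x y] by (auto simp: free_carrier)

lemma free_frag_of_closed: "h \<in> hecke_carrier N \<Longrightarrow> frag_of (h, z) \<in> carrier free_mod"
  by (simp add: free_carrier)

lemma free_smult_closed:
  assumes "r \<in> hecke_carrier N" "c \<in> carrier free_mod"
  shows "r \<odot>\<^bsub>free_mod\<^esub> c \<in> carrier free_mod"
  using assms(2)
proof (induction rule: free_induct)
  case zero
  show ?case by (simp add: free_carrier)
qed (use assms(1) in \<open>simp_all add: free_smult_diff free_diff_closed free_frag_of_closed\<close>)

lemma rels_smult:
  assumes r: "r \<in> hecke_carrier N" and "c \<in> rels"
  shows "r \<odot>\<^bsub>free_mod\<^esub> c \<in> rels"
  using assms(2)
proof (induction rule: rels_induct)
  case (left h k z)
  then show ?case using r rels_left[of "mul r h" "mul r k" z] by (simp add: free_smult_diff mul_add)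
next
  case (right h z z')
  then show ?case using r rels_right[of "mul r h" z z'] by (simp add: free_smult_diff)
next
  case (balanced h p z)
  then show ?case using r rels_balanced[of "mul r h" p z] by (simp add: free_smult_diff mul_assoc)
qed (simp_all add: rels_zero free_smult_minus rels_minus free_smult_add rels_add)

lemma module_quotient_rels: "module_quotient (hecke_ring N mul) free_mod rels"
proof (intro module_quotient.intro is_ring abelian_group_free)
  show "subgroup rels (add_monoid free_mod)"
  proof (rule group.subgroupI)
    show "group (add_monoid free_mod)" using abelian_group.a_group[OF abelian_group_free] .
    have "inv\<^bsub>add_monoid free_mod\<^esub> x = - x" if "x \<in> rels" for x
    proof -
      have "\<ominus>\<^bsub>free_mod\<^esub> x = - x"
        using rels_carrier[OF that]
        by (intro abelian_group.minus_equality[OF abelian_group_free]) (simp_all add: free_carrier)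
      then show ?thesis by (simp add: a_inv_def)
    qed
    then show "inv\<^bsub>add_monoid free_mod\<^esub> x \<in> rels" if "x \<in> rels" for x using that rels_minus by simp
  qed (use rels_zero rels_add rels_carrier in auto)
next
  fix a b x assume a: "a \<in> carrier (hecke_ring N mul)" "b \<in> carrier (hecke_ring N mul)"
    and x: "x \<in> carrier free_mod"
  then have ab: "a \<in> hecke_carrier N" "b \<in> hecke_carrier N" by simp_all
  show "(a \<otimes>\<^bsub>hecke_ring N mul\<^esub> b) \<odot>\<^bsub>free_mod\<^esub> x = a \<odot>\<^bsub>free_mod\<^esub> (b \<odot>\<^bsub>free_mod\<^esub> x)"
    using x by (induction rule: free_induct) (use ab in \<open>simp_all add: free_smult_diff mul_assoc\<close>)
  have "(a + b) \<odot>\<^bsub>free_mod\<^esub> x - (a \<odot>\<^bsub>free_mod\<^esub> x + b \<odot>\<^bsub>free_mod\<^esub> x) \<in> rels"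
    using x
  proof (induction rule: free_induct)
    case (diff x y)
    have "(a + b) \<odot>\<^bsub>free_mod\<^esub> (x - y) - (a \<odot>\<^bsub>free_mod\<^esub> (x - y) + b \<odot>\<^bsub>free_mod\<^esub> (x - y))
      = ((a + b) \<odot>\<^bsub>free_mod\<^esub> x - (a \<odot>\<^bsub>free_mod\<^esub> x + b \<odot>\<^bsub>free_mod\<^esub> x))
        - ((a + b) \<odot>\<^bsub>free_mod\<^esub> y - (a \<odot>\<^bsub>free_mod\<^esub> y + b \<odot>\<^bsub>free_mod\<^esub> y))"
      by (simp add: free_smult_diff)
    then show ?case using rels_diff[OF diff(3,4)] by simp
  next
    case (one h z)
    then show ?case using rels_left[of "mul a h" "mul b h" z] ab by (simp add: add_mul algebra_simps)
  qed (simp add: rels_zero)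
  moreover have "(a + b) \<odot>\<^bsub>free_mod\<^esub> x \<in> carrier free_mod"
    "a \<odot>\<^bsub>free_mod\<^esub> x + b \<odot>\<^bsub>free_mod\<^esub> x \<in> carrier free_mod"
    using ab x by (simp_all add: free_smult_closed free_add_closed)
  ultimately show "(a \<oplus>\<^bsub>hecke_ring N mul\<^esub> b) \<odot>\<^bsub>free_mod\<^esub> x \<ominus>\<^bsub>free_mod\<^esub>
      (a \<odot>\<^bsub>free_mod\<^esub> x \<oplus>\<^bsub>free_mod\<^esub> b \<odot>\<^bsub>free_mod\<^esub> x) \<in> rels"
    by (simp add: free_minus)
next
  fix x assume "x \<in> carrier free_mod"
  then show "\<one>\<^bsub>hecke_ring N mul\<^esub> \<odot>\<^bsub>free_mod\<^esub> x = x"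
    by (induction rule: free_induct) (simp_all add: free_smult_diff)
qed (simp_all add: free_smult_closed rels_smult free_smult_add)

section \<open>The principal series as a cyclic module over the model\<close>

interpretation T: module_quotient "hecke_ring N mul" free_mod rels
  by (rule module_quotient_rels)

text \<open>The map \<open>h\<close> tensor \<open>z\<close> to \<open>z h u\<close> on the free
  group. Once it is known to kill the relations, it induces the homomorphism from X(\<nu>) and shows
  that the annihilator of the generator annihilates \<open>u\<close>.\<close>

definition eval_free :: "((hecke \<times> complex) \<Rightarrow>\<^sub>0 int) \<Rightarrow> nat set \<Rightarrow> complex" where
  "eval_free c B = (\<Sum>a\<in>Poly_Mapping.keys c. of_int (Poly_Mapping.lookup c a) * (snd a * hecke_op N (fst a) u B))"

lemma eval_free_add: "eval_free (c + d) B = eval_free c B + eval_free d B"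
  unfolding eval_free_def by (rule setsum_keys_plus_distrib) (simp_all add: algebra_simps)

lemma eval_free_diff: "eval_free (c - d) B = eval_free c B - eval_free d B"
  using eval_free_add[of "c - d" d B] by simp

lemma eval_free_frag_of: "eval_free (frag_of (h, z)) B = z * hecke_op N h u B"
  by (simp add: eval_free_def keys_frag_of)

lemma eval_free_rels: "c \<in> rels \<Longrightarrow> eval_free c B = 0"
proof (induction rule: rels_induct)
  case zero
  show ?case by (simp add: eval_free_def)
next
  case (left h k z)
  then show ?case by (simp add: eval_free_diff eval_free_frag_of hecke_op_add distrib_left)
next
  case (right h z z')
  then show ?case by (simp add: eval_free_diff eval_free_frag_of distrib_right)
next
  case (balanced h p z)
  \<comment> \<open>Balancedness is where the weight of \<open>u\<close> enters: \<open>p\<close>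
    acts on it by the same scalar as on the line that X(\<nu>) is induced from.\<close>
  have "hecke_op N (mul h (emb p)) u B = sym_eval \<nu> p * hecke_op N h u B"
    using balanced op_linearD(2)[OF op_linear_hecke_op, of N h "sym_eval \<nu> p" u]
    by (simp add: hecke_op_mul hecke_op_emb poly_op_weight[OF weight_vector])
  then show ?case by (simp add: eval_free_diff eval_free_frag_of)
next
  case (minus x)
  then show ?case using eval_free_diff[of 0 x B] by (simp add: eval_free_def)
next
  case (add x y)
  then show ?case by (simp add: eval_free_add)
qed

definition ann :: "hecke set" where
  "ann = {h \<in> hecke_carrier N. frag_of (h, 1) \<in> rels}"

lemma frag_of_zero_left: "frag_of (0, z) \<in> rels"
  using rels_minus[OF rels_left[of 0 0 z]] by simp

lemma frag_of_zero_right: "h \<in> hecke_carrier N \<Longrightarrow> frag_of (h, 0) \<in> rels"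
  using rels_minus[OF rels_right[of h 0 0]] by simp

lemma weight_ideal_ann: "weight_ideal N mul star \<nu> u ann"
proof (intro weight_ideal.intro weight_ideal_axioms.intro weight_rep_axioms)
  show "0 \<in> ann" by (simp add: ann_def frag_of_zero_left)
  show "ann \<subseteq> hecke_carrier N" by (auto simp: ann_def)
next
  fix h k assume hk: "h \<in> ann" "k \<in> ann"
  then have "frag_of (h + k, 1) - frag_of (h, 1) - frag_of (k, 1) + (frag_of (h, 1) + frag_of (k, 1)) \<in> rels"
    by (intro rels_add rels_left) (auto simp: ann_def)
  then show "h + k \<in> ann" using hk by (simp add: ann_def)
next
  fix h k assume "h \<in> hecke_carrier N" "k \<in> ann"
  then show "mul h k \<in> ann" using rels_smult[of h "frag_of (k, 1)"] by (simp add: ann_def)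
next
  fix i assume i: "i \<in> {1..N}"
  define p where "p = sym_var i + sym_const (- \<nu> i)"
  have p: "p \<in> Sym_carrier N"
    unfolding p_def using i by (intro Sym_carrier_add Sym_carrier_var Sym_carrier_const)
  have "theta_op N i u = (\<lambda>B. complex_of_real (\<nu> i) * u B)"
    using weight_vector i by (simp add: weight_vector_def)
  then have "poly_op N p u = (\<lambda>B. 0 * u B)"
    by (simp add: p_def poly_op_add poly_op_sym_var[OF i])
  then have "sym_eval \<nu> p = 0" by (rule sym_eval_eqI[OF weight_vector p])
  \<comment> \<open>Since \<open>p\<close> evaluates to 0 at \<nu>, moving it across the tensor sign
    leaves the unit tensor 0, itself a relation.\<close>
  then have "frag_of (emb p, 1) - frag_of (tt id, 0) \<in> rels"
    using rels_balanced[OF _ p, of "tt id" 1] p by (simp add: permutes_id)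
  from rels_add[OF this frag_of_zero_right[of "tt id"]] have "emb p \<in> ann"
    using p by (simp add: ann_def permutes_id)
  then show "emb (sym_var i + sym_const (- \<nu> i)) \<in> ann" by (simp only: p_def)
next
  fix h and B :: "nat set" assume "h \<in> ann"
  then show "hecke_op N h u B = 0"
    using eval_free_rels[of "frag_of (h, 1)" B] by (simp add: ann_def eval_free_frag_of)
qed

definition gen :: "((hecke \<times> complex) \<Rightarrow>\<^sub>0 int) set" where
  "gen = rels +>\<^bsub>free_mod\<^esub> frag_of (tt id, 1)"

lemma smult_gen: "h \<in> hecke_carrier N \<Longrightarrow>
    h \<odot>\<^bsub>X_module N mul \<nu>\<^esub> gen = rels +>\<^bsub>free_mod\<^esub> frag_of (h, 1)"
  by (simp add: gen_def X_module_eq T.quot_smult free_frag_of_closed permutes_id)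

lemma cyclic_weight_module_X: "cyclic_weight_module N mul star \<nu> u ann (X_module N mul \<nu>) gen"
proof (intro cyclic_weight_module.intro cyclic_weight_module_axioms.intro weight_ideal_ann)
  show "left_module (hecke_ring N mul) (X_module N mul \<nu>)"
    unfolding X_module_eq by (rule T.left_module_quot)
  show "gen \<in> carrier (X_module N mul \<nu>)"
    by (simp add: gen_def X_module_eq T.quot_carrier free_frag_of_closed permutes_id)
next
  fix h assume h: "h \<in> hecke_carrier N"
  then show "h \<odot>\<^bsub>X_module N mul \<nu>\<^esub> gen = \<zero>\<^bsub>X_module N mul \<nu>\<^esub> \<longleftrightarrow> h \<in> ann"
    by (simp add: smult_gen ann_def)
      (simp add: X_module_eq T.quot_zero T.coset_eq_self_iff free_frag_of_closed)
next
  fix x assume "x \<in> carrier (X_module N mul \<nu>)"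
  then obtain c where c: "c \<in> carrier free_mod" "x = rels +>\<^bsub>free_mod\<^esub> c"
    by (auto simp: X_module_eq T.quot_carrier)
  have "\<exists>h\<in>hecke_carrier N. c - frag_of (h, 1) \<in> rels"
    using c(1)
  proof (induction rule: free_induct)
    case zero
    show ?case using rels_minus[OF frag_of_zero_left] by (intro bexI[of _ 0]) simp_all
  next
    case (diff x y)
    then obtain h k where hk: "h \<in> hecke_carrier N" "k \<in> hecke_carrier N"
      "x - frag_of (h, 1) \<in> rels" "y - frag_of (k, 1) \<in> rels" by blast
    have "frag_of ((h - k) + k, 1) - frag_of (h - k, 1) - frag_of (k, 1) \<in> rels"
      using hk by (intro rels_left hecke_carrier_diff)
    from rels_add[OF this rels_diff[OF hk(3,4)]]
    have "x - y - frag_of (h - k, 1) \<in> rels" by (simp add: algebra_simps)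
    then show ?case using hk hecke_carrier_diff by blast
  next
    case (one h z)
    \<comment> \<open>A scalar crosses the tensor sign as a constant polynomial, so \<open>h\<close>
      tensor \<open>z\<close> becomes an algebra element applied to the generator.\<close>
    have "sym_eval \<nu> (sym_const z) = z"
      by (rule sym_eval_eqI[OF weight_vector]) simp_all
    then have "frag_of (h, z) - frag_of (mul h (emb (sym_const z)), 1) \<in> rels"
      using rels_minus[OF rels_balanced[OF one, of "sym_const z" 1]] by simp
    then show ?case using one by (intro bexI[of _ "mul h (emb (sym_const z))"]) simp_all
  qed
  then show "\<exists>h\<in>hecke_carrier N. x = h \<odot>\<^bsub>X_module N mul \<nu>\<^esub> gen"
    using c by (simp add: smult_gen T.coset_eq_iff free_frag_of_closed free_minus cong: bex_cong)
qed

end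

theorem mainTheorem4:
  fixes N :: nat
    and mul :: "hecke \<Rightarrow> hecke \<Rightarrow> hecke"
    and star :: "hecke \<Rightarrow> hecke"
    and R' :: "(nat \<times> nat) set"
    and \<nu> :: "nat \<Rightarrow> real"
  assumes "N \<ge> 1"
    and "graded_hecke_GL_star N mul star"
    and "R' \<subseteq> pos_roots N"
    and "H_inter N R' = {\<nu>}"
  shows "unitary_module N mul star (L_module N mul \<nu>)"
proof -
  obtain A where A: "A \<subseteq> {1..N}" "A = {} \<or> odd N"
    "\<And>i. i \<in> {1..N} \<Longrightarrow> \<nu> i = block_weight N A i / 2"
    using isolated_point_eq_block_weight[OF assms(3,4)] by blast
  obtain u where u: "weight_vector N (\<lambda>i. block_weight N A i / 2) u"
    using weight_vector_exists[OF A(1,2)] by blast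
  have \<nu>: "\<nu> \<in> C_chamber N" using assms(4) by (auto simp: H_inter_def)
  have "weight_rep N mul star \<nu> u"
  proof (intro weight_rep.intro weight_rep_axioms.intro assms(2))
    show "weight_vector N \<nu> u"
      using u unfolding weight_vector_def by (metis A(3))
    show "inj_on \<nu> {1..N}"
    proof (rule inj_onI)
      fix i j assume ij: "i \<in> {1..N}" "j \<in> {1..N}" "\<nu> i = \<nu> j"
      have "\<nu> a > \<nu> b" if "a \<in> {1..N}" "b \<in> {1..N}" "a < b" for a b
        using \<nu> that by (auto simp: C_chamber_def)
      from this[of i j] this[of j i] ij show "i = j" by (cases i j rule: linorder_cases) auto
    qed
    show "\<nu> (longest N i) = - \<nu> i" if "i \<in> {1..N}" for i
    proof -
      have "\<nu> i + \<nu> (N + 1 - i) = 0" using \<nu> that by (simp add: C_chamber_def)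
      then show ?thesis using that by (simp add: longest_def)
    qed
  qed
  then interpret weight_rep N mul star \<nu> u .
  interpret C: cyclic_weight_module N mul star \<nu> u ann "X_module N mul \<nu>" gen
    by (rule cyclic_weight_module_X)
  show ?thesis
    unfolding L_module_def C.unique_irreducible_quotient_eq by (rule C.unitary_L)
qed

end
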